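(* Let $R$ be a ring having a descending chain of two-sided ideals $I_0\supseteq I_1\supseteq I_2\supseteq\cdots$ such that, for every $i\in\mathbb{N}_0$, the ring $R/I_i$ is semisimple artinian, the ideal $I_i$ is idempotent, and $I_i$ is finitely generated as a left ideal. Then to any sequence $s=(c_0,c_1,\dots)$ of elements of $\mathbb{N}=\{1,2,\dots\}$ one can associate a countably generated projective right $R$-module $P_s$ with trace ideal $I_0$ such that the following properties hold: (i) For every $k\ge 0$, $$P_s\otimes_R R/I_{k+1}\cong (I_0/I_{k+1})^{\alpha_0}\oplus(I_1/I_{k+1})^{\alpha_1}\oplus\cdots\oplus(I_k/I_{k+1})^{\alpha_k},$$ where $\alpha_0,\dots,\alpha_k\in\mathbb{N}_0$ are numbers associated to $s$ which determine the first $k+1$ terms of $s$ (i.e. if $s$ and $s'$ have the same associated numbers $\alpha_0,\dots,\alpha_k$ then $s$ and $s'$ have the same first $k+1$ terms). In particular, $P_s/P_sI_k$ is finitely generated for any $k\ge 0$. (ii) If $I_k\supsetneq I_{k+1}$ for every $k\ge 0$, then $P_s\cong P_{s'}$ implies $s=s'$. (iii) For every $k\ge 0$, $P_s\cong Q_{k0}\oplus\cdots\oplus Q_{kk}$ where $\mathrm{Tr}(Q_{ki})=I_i$ for $i=0,\dots,k$. (iv) If $R$ is right noetherian and $I_k\supsetneq I_{k+1}$ for every $k\ge 0$, then $P_s$ is not fair sized.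
   Context: Rings are associative with $1$. $\mathbb{N}_0=\{0,1,2,\dots\}$. The trace ideal of a right $R$-module $P$ is $\mathrm{Tr}(P)=\sum_{f\in \mathrm{Hom}_R(P,R)}f(P)$. For a right $R$-module $M$, let $\mathcal{I}(M)$ be the set of two-sided ideals $I$ of $R$ such that $M/MI$ is finitely generated. A countably generated projective right $R$-module $P$ is fair sized if $\mathcal{I}(P)$ has a minimal element with respect to inclusion. *)

theory Defs
  imports "HOL-Algebra.Algebra" "HOL-Library.Countable_Set"
begin

text \<open>
  The modules of \<open>HOL-Algebra\<close> are modules over commutative rings. We reuse its record type
  for right modules over arbitrary rings, writing the scalar first: the element \<open>x r\<close> of a
  right module \<open>M\<close> is \<open>r \<odot>\<^bsub>M\<^esub> x\<close>, so that \<open>(x r) s = x (r s)\<close>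
  becomes \<open>s \<odot> (r \<odot> x) = (r \<otimes> s) \<odot> x\<close>. The library's predicate \<^term>\<open>submodule\<close> (a subgroup
  closed under the scalar action) does not depend on commutativity or on the side, and is used
  as it is. The ring multiplication that the record type provides on modules is irrelevant.
\<close>

locale right_module = R?: ring R + M?: abelian_group M
  for R :: "('a, 'm) ring_scheme" and M :: "('a, 'b, 'n) module_scheme" (structure) +
  assumes smult_closed: "\<lbrakk>r \<in> carrier R; x \<in> carrier M\<rbrakk> \<Longrightarrow> r \<odot>\<^bsub>M\<^esub> x \<in> carrier M"
    and smult_add_ring: "\<lbrakk>r \<in> carrier R; s \<in> carrier R; x \<in> carrier M\<rbrakk>
      \<Longrightarrow> (r \<oplus>\<^bsub>R\<^esub> s) \<odot>\<^bsub>M\<^esub> x = r \<odot>\<^bsub>M\<^esub> x \<oplus>\<^bsub>M\<^esub> s \<odot>\<^bsub>M\<^esub> x"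
    and smult_add_module: "\<lbrakk>r \<in> carrier R; x \<in> carrier M; y \<in> carrier M\<rbrakk>
      \<Longrightarrow> r \<odot>\<^bsub>M\<^esub> (x \<oplus>\<^bsub>M\<^esub> y) = r \<odot>\<^bsub>M\<^esub> x \<oplus>\<^bsub>M\<^esub> r \<odot>\<^bsub>M\<^esub> y"
    and smult_assoc: "\<lbrakk>r \<in> carrier R; s \<in> carrier R; x \<in> carrier M\<rbrakk>
      \<Longrightarrow> s \<odot>\<^bsub>M\<^esub> (r \<odot>\<^bsub>M\<^esub> x) = (r \<otimes>\<^bsub>R\<^esub> s) \<odot>\<^bsub>M\<^esub> x"
    and smult_one: "x \<in> carrier M \<Longrightarrow> \<one>\<^bsub>R\<^esub> \<odot>\<^bsub>M\<^esub> x = x"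

definition regular_right :: "('a, 'm) ring_scheme \<Rightarrow> ('a, 'a) module"
  where "regular_right R = \<lparr>carrier = carrier R, monoid.mult = monoid.mult R, one = one R,
    ring.zero = ring.zero R, ring.add = ring.add R, smult = (\<lambda>r x. x \<otimes>\<^bsub>R\<^esub> r)\<rparr>"

text \<open>A left module; only its submodules (the left ideals) and their generators are used.\<close>

definition regular_left :: "('a, 'm) ring_scheme \<Rightarrow> ('a, 'a) module"
  where "regular_left R = \<lparr>carrier = carrier R, monoid.mult = monoid.mult R, one = one R,
    ring.zero = ring.zero R, ring.add = ring.add R, smult = (\<lambda>r x. r \<otimes>\<^bsub>R\<^esub> x)\<rparr>"

definition restrict_module :: "('a, 'b) module \<Rightarrow> 'b set \<Rightarrow> ('a, 'b) module"
  where "restrict_module M N = M\<lparr>carrier := N\<rparr>"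

definition module_hom ::
    "('a, 'm) ring_scheme \<Rightarrow> ('a, 'b) module \<Rightarrow> ('a, 'c) module \<Rightarrow> ('b \<Rightarrow> 'c) set"
  where "module_hom R M N = {f \<in> carrier M \<rightarrow> carrier N.
    (\<forall>x\<in>carrier M. \<forall>y\<in>carrier M. f (x \<oplus>\<^bsub>M\<^esub> y) = f x \<oplus>\<^bsub>N\<^esub> f y) \<and>
    (\<forall>r\<in>carrier R. \<forall>x\<in>carrier M. f (r \<odot>\<^bsub>M\<^esub> x) = r \<odot>\<^bsub>N\<^esub> f x)}"

definition module_iso ::
    "('a, 'm) ring_scheme \<Rightarrow> ('a, 'b) module \<Rightarrow> ('a, 'c) module \<Rightarrow> bool"
  where "module_iso R M N \<longleftrightarrow> (\<exists>f\<in>module_hom R M N. bij_betw f (carrier M) (carrier N))"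

definition module_span :: "('a, 'm) ring_scheme \<Rightarrow> ('a, 'b) module \<Rightarrow> 'b set \<Rightarrow> 'b set"
  where "module_span R M Y = \<Inter>{N. submodule N R M \<and> Y \<subseteq> N}"

definition finitely_generated :: "('a, 'm) ring_scheme \<Rightarrow> ('a, 'b) module \<Rightarrow> bool"
  where "finitely_generated R M \<longleftrightarrow>
    (\<exists>Y. finite Y \<and> Y \<subseteq> carrier M \<and> module_span R M Y = carrier M)"

definition countably_generated :: "('a, 'm) ring_scheme \<Rightarrow> ('a, 'b) module \<Rightarrow> bool"
  where "countably_generated R M \<longleftrightarrow>
    (\<exists>Y. countable Y \<and> Y \<subseteq> carrier M \<and> module_span R M Y = carrier M)"

definition direct_sum :: "'i set \<Rightarrow> ('i \<Rightarrow> ('a, 'b) module) \<Rightarrow> ('a, 'i \<Rightarrow> 'b) module"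
  where "direct_sum A M =
    \<lparr>carrier = {f \<in> (\<Pi>\<^sub>E i\<in>A. carrier (M i)). finite {i \<in> A. f i \<noteq> \<zero>\<^bsub>M i\<^esub>}},
     monoid.mult = undefined, one = undefined,
     ring.zero = (\<lambda>i\<in>A. \<zero>\<^bsub>M i\<^esub>),
     ring.add = (\<lambda>f g. \<lambda>i\<in>A. f i \<oplus>\<^bsub>M i\<^esub> g i),
     smult = (\<lambda>r f. \<lambda>i\<in>A. r \<odot>\<^bsub>M i\<^esub> f i)\<rparr>"

definition module_power :: "('a, 'b) module \<Rightarrow> nat \<Rightarrow> ('a, nat \<Rightarrow> 'b) module"
  where "module_power M n = direct_sum {..<n} (\<lambda>_. M)"

definition direct_summand :: "('a, 'm) ring_scheme \<Rightarrow> ('a, 'b) module \<Rightarrow> 'b set \<Rightarrow> bool"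
  where "direct_summand R M N \<longleftrightarrow> submodule N R M \<and>
    (\<exists>N'. submodule N' R M \<and> N \<inter> N' = {\<zero>\<^bsub>M\<^esub>} \<and> N <+>\<^bsub>M\<^esub> N' = carrier M)"

text \<open>
  Projective: isomorphic to a direct summand of a free module \<open>R\<^sup>(\<^sup>Y\<^sup>)\<close>. Unlike the lifting
  property, this does not quantify over modules of arbitrary type; taking the basis \<open>Y\<close>
  inside the type of the elements of \<open>P\<close> is no restriction, because \<open>P\<close> is a quotient
  of the free module on its own elements.
\<close>

definition projective :: "('a, 'm) ring_scheme \<Rightarrow> ('a, 'b) module \<Rightarrow> bool"
  where "projective R P \<longleftrightarrow> (\<exists>(Y :: 'b set) N.
    direct_summand R (direct_sum Y (\<lambda>_. regular_right R)) N \<and>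
    module_iso R P (restrict_module (direct_sum Y (\<lambda>_. regular_right R)) N))"

definition quotient_module :: "('a, 'b) module \<Rightarrow> 'b set \<Rightarrow> ('a, 'b set) module"
  where "quotient_module M N =
    \<lparr>carrier = a_rcosets\<^bsub>M\<^esub> N, monoid.mult = undefined, one = undefined,
     ring.zero = N, ring.add = set_add M,
     smult = (\<lambda>r Y. \<Union>x\<in>Y. N +>\<^bsub>M\<^esub> (r \<odot>\<^bsub>M\<^esub> x))\<rparr>"

text \<open>The submodule \<open>MJ\<close>.\<close>

definition module_times_ideal :: "('a, 'b) module \<Rightarrow> 'a set \<Rightarrow> 'b set"
  where "module_times_ideal M J =
    generate (add_monoid M) {r \<odot>\<^bsub>M\<^esub> x | r x. r \<in> J \<and> x \<in> carrier M}"

definition trace_ideal :: "('a, 'm) ring_scheme \<Rightarrow> ('a, 'b) module \<Rightarrow> 'a set"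
  where "trace_ideal R P =
    generate (add_monoid R) (\<Union>f\<in>module_hom R P (regular_right R). f ` carrier P)"

definition fg_quotient_ideals :: "('a, 'm) ring_scheme \<Rightarrow> ('a, 'b) module \<Rightarrow> 'a set set"
  where "fg_quotient_ideals R M =
    {J. ideal J R \<and> finitely_generated R (quotient_module M (module_times_ideal M J))}"

text \<open>The following is meant for countably generated projective modules.\<close>

definition fair_sized :: "('a, 'm) ring_scheme \<Rightarrow> ('a, 'b) module \<Rightarrow> bool"
  where "fair_sized R P \<longleftrightarrow>
    (\<exists>J\<in>fg_quotient_ideals R P. \<forall>J'\<in>fg_quotient_ideals R P. J' \<subseteq> J \<longrightarrow> J' = J)"

definition semisimple_module :: "('a, 'm) ring_scheme \<Rightarrow> ('a, 'b) module \<Rightarrow> bool"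
  where "semisimple_module R M \<longleftrightarrow> (\<forall>N. submodule N R M \<longrightarrow> direct_summand R M N)"

definition artinian_module :: "('a, 'm) ring_scheme \<Rightarrow> ('a, 'b) module \<Rightarrow> bool"
  where "artinian_module R M \<longleftrightarrow>
    (\<forall>N :: nat \<Rightarrow> 'b set. (\<forall>n. submodule (N n) R M) \<and> (\<forall>n. N (Suc n) \<subseteq> N n)
      \<longrightarrow> (\<exists>n. \<forall>m\<ge>n. N m = N n))"

definition semisimple_artinian :: "('a, 'm) ring_scheme \<Rightarrow> bool"
  where "semisimple_artinian R \<longleftrightarrow> ring R \<and>
    semisimple_module R (regular_right R) \<and> artinian_module R (regular_right R)"

definition right_noetherian :: "('a, 'm) ring_scheme \<Rightarrow> bool"
  where "right_noetherian R \<longleftrightarrow> ring R \<and>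
    (\<forall>J. submodule J R (regular_right R)
      \<longrightarrow> finitely_generated R (restrict_module (regular_right R) J))"

text \<open>
  The tensor product of a right \<open>R\<close>-module \<open>P\<close> and an \<open>R\<close>-\<open>S\<close>-bimodule \<open>B\<close>, where \<open>B\<close> is given as
  a right \<open>S\<close>-module together with its left action \<open>l :: 'a \<Rightarrow> 'b \<Rightarrow> 'b\<close> of \<open>R\<close>: the free abelian group
  on the pairs \<open>(x, b)\<close> modulo the usual relations, with \<open>(x \<otimes> b) s = x \<otimes> (b s)\<close>.
\<close>

definition tensor_relations ::
    "('a, 'm) ring_scheme \<Rightarrow> ('a, 'p) module \<Rightarrow> ('s, 'b) module \<Rightarrow> ('a \<Rightarrow> 'b \<Rightarrow> 'b)
      \<Rightarrow> ('p \<times> 'b \<Rightarrow>\<^sub>0 int) set"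
  where "tensor_relations R P B l =
    {frag_of (x \<oplus>\<^bsub>P\<^esub> y, b) - frag_of (x, b) - frag_of (y, b) | x y b.
      x \<in> carrier P \<and> y \<in> carrier P \<and> b \<in> carrier B} \<union>
    {frag_of (x, b \<oplus>\<^bsub>B\<^esub> c) - frag_of (x, b) - frag_of (x, c) | x b c.
      x \<in> carrier P \<and> b \<in> carrier B \<and> c \<in> carrier B} \<union>
    {frag_of (r \<odot>\<^bsub>P\<^esub> x, b) - frag_of (x, l r b) | r x b.
      r \<in> carrier R \<and> x \<in> carrier P \<and> b \<in> carrier B}"

definition tensor_product ::
    "('a, 'm) ring_scheme \<Rightarrow> ('a, 'p) module \<Rightarrow> ('s, 'b) module \<Rightarrow> ('a \<Rightarrow> 'b \<Rightarrow> 'b)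
      \<Rightarrow> ('s, ('p \<times> 'b \<Rightarrow>\<^sub>0 int) set) module"
  where "tensor_product R P B l =
    (let F = free_Abelian_group (carrier P \<times> carrier B);
         K = generate F (tensor_relations R P B l)
     in \<lparr>carrier = carrier (F Mod K), monoid.mult = undefined, one = undefined,
         ring.zero = \<one>\<^bsub>F Mod K\<^esub>, ring.add = monoid.mult (F Mod K),
         smult = (\<lambda>s Y. \<Union>t\<in>Y. K #>\<^bsub>F\<^esub> frag_extend (\<lambda>(x, b). frag_of (x, s \<odot>\<^bsub>B\<^esub> b)) t)\<rparr>)"

text \<open>\<open>P \<otimes>\<^sub>R R/J\<close> as a right \<open>R/J\<close>-module.\<close>

definition tensor_quotient ::
    "('a, 'm) ring_scheme \<Rightarrow> ('a, 'p) module \<Rightarrow> 'a set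
      \<Rightarrow> ('a set, ('p \<times> 'a set \<Rightarrow>\<^sub>0 int) set) module"
  where "tensor_quotient R P J =
    tensor_product R P (regular_right (R Quot J)) (\<lambda>r b. (J +>\<^bsub>R\<^esub> r) \<otimes>\<^bsub>R Quot J\<^esub> b)"

text \<open>For \<open>J \<subseteq> I\<close>, the ideal \<open>I/J\<close> of \<open>R/J\<close> as a right \<open>R/J\<close>-module.\<close>

definition ideal_quotient ::
    "('a, 'm) ring_scheme \<Rightarrow> 'a set \<Rightarrow> 'a set \<Rightarrow> ('a set, 'a set) module"
  where "ideal_quotient R I J =
    restrict_module (regular_right (R Quot J)) ((\<lambda>x. J +>\<^bsub>R\<^esub> x) ` I)"

end

theory Submission
  imports Defs
begin

text \<open>
  We construct \<open>P\<^sub>s\<close> as a direct limit of free modules \<open>F\<^sub>0 \<rightarrow> F\<^sub>1 \<rightarrow> \<dots>\<close>. Every basis element of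
  \<open>F\<^sub>t\<close> has a level \<open>i \<le> t\<close>, and \<open>A\<^sub>t : F\<^sub>t \<rightarrow> F\<^sub>t\<^sub>+\<^sub>1\<close> sends it to a column whose entries generate the left
  ideal \<open>I\<^sub>i\<close>: an element \<open>\<epsilon>\<close> that is a two-sided identity of \<open>I\<^sub>i\<close> modulo \<open>I\<^sub>t\<^sub>+\<^sub>1\<close>, placed at the same basis
  element, and left generators of \<open>I\<^sub>t\<^sub>+\<^sub>1\<close>, placed at new basis elements of level \<open>t + 1\<close>. As the ideals
  are idempotent, there are maps \<open>C\<^sub>t\<close> with \<open>C\<^sub>t A\<^sub>t\<^sub>+\<^sub>1 A\<^sub>t = A\<^sub>t\<close>, and this makes the limit projective.
  Modulo \<open>I\<^sub>k\<^sub>+\<^sub>1\<close> the later maps only keep the images of the elements \<open>\<epsilon>\<close>, so \<open>P\<^sub>s / P\<^sub>s I\<^sub>k\<^sub>+\<^sub>1\<close> is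
  the sum of one copy of \<open>I\<^sub>i / I\<^sub>k\<^sub>+\<^sub>1\<close> for each basis element of level \<open>i \<le> k\<close>. The sequence \<open>s\<close> is encoded
  in the numbers of additional basis elements of each level. Since \<open>R / I\<^sub>q\<^sub>+\<^sub>1\<close> is artinian and
  \<open>I\<^sub>q \<noteq> I\<^sub>q\<^sub>+\<^sub>1\<close>, the module \<open>P\<^sub>s\<close> cannot be generated modulo \<open>P\<^sub>s I\<^sub>q\<^sub>+\<^sub>1\<close> by fewer elements than \<open>F\<^sub>q\<close> has basis
  elements, which gives (ii). For (iv), the set of ideals \<open>J\<close> with \<open>P\<^sub>s / P\<^sub>s J\<close> finitely
  generated is closed under intersections, so a minimal \<open>J\<close> would be contained in all \<open>I\<^sub>k\<close>, and a
  fixed number of elements would generate \<open>P\<^sub>s\<close> modulo \<open>P\<^sub>s I\<^sub>k\<close> for all \<open>k\<close>.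
\<close>

section \<open>Right modules\<close>

text \<open>Elements of the limit are not handled as classes. The maps \<open>C\<^sub>t\<close>
  allow the class of \<open>y\<close> in \<open>F\<^sub>s\<close> to be recorded by the sequence of
  its images \<open>A\<^sub>t \<dots> A\<^sub>s y\<close>, continued below stage \<open>s\<close> by
  applying the \<open>C\<^sub>t\<close>. Classes agree exactly if their sequences do. So all the
  modules share one type, and every coordinate is a homomorphism to \<open>R\<close>; this yields
  the dual basis, the trace and a test for membership in \<open>P J\<close>. The sizes
  \<open>n t\<close> of the \<open>F\<^sub>t\<close> form a divisor chain, and row \<open>c\<close>
  of \<open>A\<^sub>t\<close> meets only column \<open>c mod n t\<close>. Hence the residue of an
  index modulo \<open>n k\<close> is preserved by all maps from stage \<open>k\<close> on, the tower
  splits there into blocks, and grouping residues by level gives (iii). Each basis element of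
  \<open>F\<^sub>t\<close> produces \<open>1 + m + s\<close> basis elements of
  \<open>F\<^sub>t\<^sub>+\<^sub>1\<close>, where \<open>m\<close> counts the chosen generators of
  \<open>I\<^sub>t\<^sub>+\<^sub>1\<close> and \<open>s\<close> is the next term of the sequence. So
  the sizes determine the sequence. Terms that are at least 1 keep the sizes strictly increasing
  even if \<open>m = 0\<close>; therefore every level occurs, and the contradiction in (iv) rests on
  the same growth.\<close>

lemma (in abelian_group) submoduleI_gen:
  assumes "H \<subseteq> carrier G" "\<zero> \<in> H" "\<And>x. x \<in> H \<Longrightarrow> \<ominus> x \<in> H"
    "\<And>x y. \<lbrakk>x \<in> H; y \<in> H\<rbrakk> \<Longrightarrow> x \<oplus> y \<in> H"
  shows "subgroup H (add_monoid G)"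
  by (rule subgroup.intro) (use assms in \<open>auto simp: a_inv_def\<close>)

lemma (in abelian_group) finsum_in_subgroup:
  assumes "subgroup H (add_monoid G)" "\<And>i. i \<in> A \<Longrightarrow> f i \<in> H"
  shows "finsum G f A \<in> H"
proof -
  interpret H: subgroup H "add_monoid G" by fact
  show ?thesis using assms(2)
  proof (induct A rule: infinite_finite_induct)
    case (insert x F)
    have "finsum G f (insert x F) = f x \<oplus> finsum G f F"
      using insert H.subset by (subst finsum_insert) auto
    then show ?case using insert H.m_closed by auto
  qed (use H.one_closed in auto)
qed

context right_module
begin

lemma smult_zero: assumes r: "r \<in> carrier R" shows "r \<odot>\<^bsub>M\<^esub> \<zero>\<^bsub>M\<^esub> = \<zero>\<^bsub>M\<^esub>"
proof -
  have "r \<odot>\<^bsub>M\<^esub> \<zero>\<^bsub>M\<^esub> = r \<odot>\<^bsub>M\<^esub> \<zero>\<^bsub>M\<^esub> \<oplus>\<^bsub>M\<^esub> r \<odot>\<^bsub>M\<^esub> \<zero>\<^bsub>M\<^esub>"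
    using smult_add_module[of r "\<zero>\<^bsub>M\<^esub>" "\<zero>\<^bsub>M\<^esub>"] r by simp
  moreover have "r \<odot>\<^bsub>M\<^esub> \<zero>\<^bsub>M\<^esub> \<in> carrier M" using smult_closed r by simp
  ultimately show ?thesis by (metis M.add.r_cancel_one')
qed

lemma zero_smult: assumes x: "x \<in> carrier M" shows "\<zero>\<^bsub>R\<^esub> \<odot>\<^bsub>M\<^esub> x = \<zero>\<^bsub>M\<^esub>"
proof -
  have "\<zero>\<^bsub>R\<^esub> \<odot>\<^bsub>M\<^esub> x = \<zero>\<^bsub>R\<^esub> \<odot>\<^bsub>M\<^esub> x \<oplus>\<^bsub>M\<^esub> \<zero>\<^bsub>R\<^esub> \<odot>\<^bsub>M\<^esub> x"
    using smult_add_ring[of "\<zero>\<^bsub>R\<^esub>" "\<zero>\<^bsub>R\<^esub>" x] x by simp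
  moreover have "\<zero>\<^bsub>R\<^esub> \<odot>\<^bsub>M\<^esub> x \<in> carrier M" using smult_closed x by simp
  ultimately show ?thesis by (metis M.add.r_cancel_one')
qed

lemma minus_smult:
  assumes "r \<in> carrier R" "x \<in> carrier M"
  shows "(\<ominus>\<^bsub>R\<^esub> r) \<odot>\<^bsub>M\<^esub> x = \<ominus>\<^bsub>M\<^esub> (r \<odot>\<^bsub>M\<^esub> x)"
proof (rule M.minus_equality[symmetric])
  show "(\<ominus>\<^bsub>R\<^esub> r) \<odot>\<^bsub>M\<^esub> x \<oplus>\<^bsub>M\<^esub> r \<odot>\<^bsub>M\<^esub> x = \<zero>\<^bsub>M\<^esub>"
    using smult_add_ring[of "\<ominus>\<^bsub>R\<^esub> r" r x] assms by (simp add: R.l_neg zero_smult)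
qed (use assms smult_closed in auto)

lemma smult_minus:
  assumes "r \<in> carrier R" "x \<in> carrier M"
  shows "r \<odot>\<^bsub>M\<^esub> (\<ominus>\<^bsub>M\<^esub> x) = \<ominus>\<^bsub>M\<^esub> (r \<odot>\<^bsub>M\<^esub> x)"
proof (rule M.minus_equality[symmetric])
  show "r \<odot>\<^bsub>M\<^esub> (\<ominus>\<^bsub>M\<^esub> x) \<oplus>\<^bsub>M\<^esub> r \<odot>\<^bsub>M\<^esub> x = \<zero>\<^bsub>M\<^esub>"
    using smult_add_module[of r "\<ominus>\<^bsub>M\<^esub> x" x] assms by (simp add: M.l_neg smult_zero)
qed (use assms smult_closed in auto)

lemma smult_finsum:
  assumes "r \<in> carrier R" "f \<in> A \<rightarrow> carrier M"
  shows "r \<odot>\<^bsub>M\<^esub> finsum M f A = (\<Oplus>\<^bsub>M\<^esub>i\<in>A. r \<odot>\<^bsub>M\<^esub> f i)"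
  using assms(2)
proof (induct A rule: infinite_finite_induct)
  case (insert x F)
  then have "r \<odot>\<^bsub>M\<^esub> finsum M f (insert x F) = r \<odot>\<^bsub>M\<^esub> (f x \<oplus>\<^bsub>M\<^esub> finsum M f F)"
    by (subst M.finsum_insert) auto
  also have "\<dots> = r \<odot>\<^bsub>M\<^esub> f x \<oplus>\<^bsub>M\<^esub> (\<Oplus>\<^bsub>M\<^esub>i\<in>F. r \<odot>\<^bsub>M\<^esub> f i)"
    using insert assms(1) by (subst smult_add_module) auto
  also have "\<dots> = (\<Oplus>\<^bsub>M\<^esub>i\<in>insert x F. r \<odot>\<^bsub>M\<^esub> f i)"
    using insert assms(1) by (subst M.finsum_insert) (auto intro!: smult_closed)
  finally show ?case .
qed (simp_all add: assms(1) smult_zero)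

lemma submoduleI:
  assumes "H \<subseteq> carrier M" "\<zero>\<^bsub>M\<^esub> \<in> H"
    "\<And>x y. \<lbrakk>x \<in> H; y \<in> H\<rbrakk> \<Longrightarrow> x \<oplus>\<^bsub>M\<^esub> y \<in> H"
    "\<And>r x. \<lbrakk>r \<in> carrier R; x \<in> H\<rbrakk> \<Longrightarrow> r \<odot>\<^bsub>M\<^esub> x \<in> H"
  shows "submodule H R M"
proof (intro submodule.intro submodule_axioms.intro M.submoduleI_gen)
  fix x assume "x \<in> H"
  then have "\<ominus>\<^bsub>M\<^esub> x = (\<ominus>\<^bsub>R\<^esub> \<one>\<^bsub>R\<^esub>) \<odot>\<^bsub>M\<^esub> x"
    using assms(1) by (auto simp: minus_smult smult_one)
  then show "\<ominus>\<^bsub>M\<^esub> x \<in> H" using assms(4) \<open>x \<in> H\<close> by simp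
qed (use assms in auto)

lemma finsum_in_submodule:
  assumes "submodule H R M" "\<And>i. i \<in> A \<Longrightarrow> f i \<in> H"
  shows "finsum M f A \<in> H"
  using M.finsum_in_subgroup[OF submodule.axioms(1)[OF assms(1)]] assms(2) by blast

end

lemma module_span_eq_carrierI:
  assumes "right_module R M" "Y \<subseteq> carrier M"
    "\<And>N. \<lbrakk>submodule N R M; Y \<subseteq> N\<rbrakk> \<Longrightarrow> carrier M \<subseteq> N"
  shows "module_span R M Y = carrier M"
proof -
  interpret right_module R M by fact
  have "submodule (carrier M) R M"
    by (rule submoduleI) (auto intro: smult_closed)
  then show ?thesis using assms unfolding module_span_def by blast
qed

lemma module_hom_closed: "\<lbrakk>f \<in> module_hom R M N; x \<in> carrier M\<rbrakk> \<Longrightarrow> f x \<in> carrier N"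
  by (auto simp: module_hom_def)

lemma module_hom_add: "\<lbrakk>f \<in> module_hom R M N; x \<in> carrier M; y \<in> carrier M\<rbrakk>
    \<Longrightarrow> f (x \<oplus>\<^bsub>M\<^esub> y) = f x \<oplus>\<^bsub>N\<^esub> f y"
  by (auto simp: module_hom_def)

lemma module_hom_smult: "\<lbrakk>f \<in> module_hom R M N; r \<in> carrier R; x \<in> carrier M\<rbrakk>
    \<Longrightarrow> f (r \<odot>\<^bsub>M\<^esub> x) = r \<odot>\<^bsub>N\<^esub> f x"
  by (auto simp: module_hom_def)

lemma module_homI:
  assumes "\<And>x. x \<in> carrier M \<Longrightarrow> f x \<in> carrier N"
    "\<And>x y. \<lbrakk>x \<in> carrier M; y \<in> carrier M\<rbrakk> \<Longrightarrow> f (x \<oplus>\<^bsub>M\<^esub> y) = f x \<oplus>\<^bsub>N\<^esub> f y"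
    "\<And>r x. \<lbrakk>r \<in> carrier R; x \<in> carrier M\<rbrakk> \<Longrightarrow> f (r \<odot>\<^bsub>M\<^esub> x) = r \<odot>\<^bsub>N\<^esub> f x"
  shows "f \<in> module_hom R M N"
  using assms by (auto simp: module_hom_def)

lemma module_hom_zero:
  assumes "right_module R M" "right_module R N" "f \<in> module_hom R M N"
  shows "f \<zero>\<^bsub>M\<^esub> = \<zero>\<^bsub>N\<^esub>"
proof -
  interpret M: right_module R M by fact
  interpret N: right_module R N by fact
  have "f \<zero>\<^bsub>M\<^esub> = \<zero>\<^bsub>R\<^esub> \<odot>\<^bsub>N\<^esub> f \<zero>\<^bsub>M\<^esub>"
    using module_hom_smult[OF assms(3), of "\<zero>\<^bsub>R\<^esub>" "\<zero>\<^bsub>M\<^esub>"] by (simp add: M.smult_zero)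
  then show ?thesis by (simp add: N.zero_smult module_hom_closed[OF assms(3)])
qed

lemma module_hom_minus:
  assumes "right_module R M" "right_module R N" "f \<in> module_hom R M N" "x \<in> carrier M"
  shows "f (\<ominus>\<^bsub>M\<^esub> x) = \<ominus>\<^bsub>N\<^esub> f x"
proof -
  interpret M: right_module R M by fact
  interpret N: right_module R N by fact
  have "f (\<ominus>\<^bsub>M\<^esub> x) = f ((\<ominus>\<^bsub>R\<^esub> \<one>\<^bsub>R\<^esub>) \<odot>\<^bsub>M\<^esub> x)"
    using assms(4) by (simp add: M.minus_smult M.smult_one)
  also have "\<dots> = \<ominus>\<^bsub>N\<^esub> f x"
    using assms(4) module_hom_closed[OF assms(3,4)]
    by (simp add: module_hom_smult[OF assms(3)] N.minus_smult N.smult_one)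
  finally show ?thesis .
qed

lemma module_hom_finsum:
  assumes "right_module R M" "right_module R N" "f \<in> module_hom R M N" "g \<in> A \<rightarrow> carrier M"
  shows "f (finsum M g A) = (\<Oplus>\<^bsub>N\<^esub>i\<in>A. f (g i))"
proof -
  interpret M: right_module R M by fact
  interpret N: right_module R N by fact
  show ?thesis using assms(4)
  proof (induct A rule: infinite_finite_induct)
    case (insert x F)
    have "f (finsum M g (insert x F)) = f (g x \<oplus>\<^bsub>M\<^esub> finsum M g F)"
      using insert by (subst M.finsum_insert) auto
    also have "\<dots> = f (g x) \<oplus>\<^bsub>N\<^esub> (\<Oplus>\<^bsub>N\<^esub>i\<in>F. f (g i))"
      using insert by (subst module_hom_add[OF assms(3)]) auto
    also have "\<dots> = (\<Oplus>\<^bsub>N\<^esub>i\<in>insert x F. f (g i))"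
      using insert by (subst N.finsum_insert) (auto intro!: module_hom_closed[OF assms(3)])
    finally show ?case .
  qed (simp_all add: module_hom_zero[OF assms(1-3)])
qed

section \<open>Regular modules, submodules and direct sums as right modules\<close>

lemma regular_right_simps [simp]:
  "carrier (regular_right R) = carrier R" "\<zero>\<^bsub>regular_right R\<^esub> = \<zero>\<^bsub>R\<^esub>"
  "x \<oplus>\<^bsub>regular_right R\<^esub> y = x \<oplus>\<^bsub>R\<^esub> y" "r \<odot>\<^bsub>regular_right R\<^esub> x = x \<otimes>\<^bsub>R\<^esub> r"
  by (simp_all add: regular_right_def)

lemma regular_left_simps [simp]:
  "carrier (regular_left R) = carrier R" "\<zero>\<^bsub>regular_left R\<^esub> = \<zero>\<^bsub>R\<^esub>"
  "x \<oplus>\<^bsub>regular_left R\<^esub> y = x \<oplus>\<^bsub>R\<^esub> y" "r \<odot>\<^bsub>regular_left R\<^esub> x = r \<otimes>\<^bsub>R\<^esub> x"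
  by (simp_all add: regular_left_def)

lemma restrict_module_simps [simp]:
  "carrier (restrict_module M N) = N" "\<zero>\<^bsub>restrict_module M N\<^esub> = \<zero>\<^bsub>M\<^esub>"
  "x \<oplus>\<^bsub>restrict_module M N\<^esub> y = x \<oplus>\<^bsub>M\<^esub> y" "r \<odot>\<^bsub>restrict_module M N\<^esub> x = r \<odot>\<^bsub>M\<^esub> x"
  by (simp_all add: restrict_module_def)

text \<open>Additive inverses come from the scalar action: \<open>(-1) x + x = 0 x = 0\<close>. This
  is why \<open>z_smult\<close> stands among the assumptions in place of an inverse.\<close>

lemma right_moduleI:
  fixes R (structure) and M (structure)
  assumes "ring R"
    and zero: "\<zero>\<^bsub>M\<^esub> \<in> carrier M"
    and add: "\<And>x y. \<lbrakk>x \<in> carrier M; y \<in> carrier M\<rbrakk> \<Longrightarrow> x \<oplus>\<^bsub>M\<^esub> y \<in> carrier M"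
    and smult: "\<And>r x. \<lbrakk>r \<in> carrier R; x \<in> carrier M\<rbrakk> \<Longrightarrow> r \<odot>\<^bsub>M\<^esub> x \<in> carrier M"
    and "\<And>x y z. \<lbrakk>x \<in> carrier M; y \<in> carrier M; z \<in> carrier M\<rbrakk>
      \<Longrightarrow> x \<oplus>\<^bsub>M\<^esub> y \<oplus>\<^bsub>M\<^esub> z = x \<oplus>\<^bsub>M\<^esub> (y \<oplus>\<^bsub>M\<^esub> z)"
    and "\<And>x y. \<lbrakk>x \<in> carrier M; y \<in> carrier M\<rbrakk> \<Longrightarrow> x \<oplus>\<^bsub>M\<^esub> y = y \<oplus>\<^bsub>M\<^esub> x"
    and "\<And>x. x \<in> carrier M \<Longrightarrow> \<zero>\<^bsub>M\<^esub> \<oplus>\<^bsub>M\<^esub> x = x"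
    and z_smult: "\<And>x. x \<in> carrier M \<Longrightarrow> \<zero>\<^bsub>R\<^esub> \<odot>\<^bsub>M\<^esub> x = \<zero>\<^bsub>M\<^esub>"
    and rest: "\<And>r s x. \<lbrakk>r \<in> carrier R; s \<in> carrier R; x \<in> carrier M\<rbrakk>
      \<Longrightarrow> (r \<oplus>\<^bsub>R\<^esub> s) \<odot>\<^bsub>M\<^esub> x = r \<odot>\<^bsub>M\<^esub> x \<oplus>\<^bsub>M\<^esub> s \<odot>\<^bsub>M\<^esub> x"
      "\<And>r x y. \<lbrakk>r \<in> carrier R; x \<in> carrier M; y \<in> carrier M\<rbrakk>
      \<Longrightarrow> r \<odot>\<^bsub>M\<^esub> (x \<oplus>\<^bsub>M\<^esub> y) = r \<odot>\<^bsub>M\<^esub> x \<oplus>\<^bsub>M\<^esub> r \<odot>\<^bsub>M\<^esub> y"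
      "\<And>r s x. \<lbrakk>r \<in> carrier R; s \<in> carrier R; x \<in> carrier M\<rbrakk>
      \<Longrightarrow> s \<odot>\<^bsub>M\<^esub> (r \<odot>\<^bsub>M\<^esub> x) = (r \<otimes>\<^bsub>R\<^esub> s) \<odot>\<^bsub>M\<^esub> x"
      "\<And>x. x \<in> carrier M \<Longrightarrow> \<one>\<^bsub>R\<^esub> \<odot>\<^bsub>M\<^esub> x = x"
  shows "right_module R M"
proof -
  interpret R: ring R by fact
  have "\<exists>y\<in>carrier M. y \<oplus>\<^bsub>M\<^esub> x = \<zero>\<^bsub>M\<^esub>" if "x \<in> carrier M" for x
  proof
    have "(\<ominus>\<^bsub>R\<^esub> \<one>\<^bsub>R\<^esub>) \<odot>\<^bsub>M\<^esub> x \<oplus>\<^bsub>M\<^esub> \<one>\<^bsub>R\<^esub> \<odot>\<^bsub>M\<^esub> x = \<zero>\<^bsub>M\<^esub>"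
      using rest(1)[of "\<ominus>\<^bsub>R\<^esub> \<one>\<^bsub>R\<^esub>" "\<one>\<^bsub>R\<^esub>" x] that by (simp add: R.l_neg z_smult)
    then show "(\<ominus>\<^bsub>R\<^esub> \<one>\<^bsub>R\<^esub>) \<odot>\<^bsub>M\<^esub> x \<oplus>\<^bsub>M\<^esub> x = \<zero>\<^bsub>M\<^esub>" using rest(4) that by simp
    show "(\<ominus>\<^bsub>R\<^esub> \<one>\<^bsub>R\<^esub>) \<odot>\<^bsub>M\<^esub> x \<in> carrier M" using smult that by simp
  qed
  then have "abelian_group M"
    by (intro abelian_groupI) (use assms in auto)
  then show ?thesis
    by (intro right_module.intro right_module_axioms.intro) (use assms in auto)
qed

lemma (in ring) regular_right_module: "right_module R (regular_right R)"
proof (rule right_moduleI)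
  fix x y assume "x \<in> carrier (regular_right R)" "y \<in> carrier (regular_right R)"
  then show "x \<oplus>\<^bsub>regular_right R\<^esub> y = y \<oplus>\<^bsub>regular_right R\<^esub> x" by (simp add: a_comm)
qed (auto simp: ring_axioms a_assoc r_distr l_distr m_assoc)

lemma restrict_right_module:
  assumes "right_module R M" "submodule N R M" shows "right_module R (restrict_module M N)"
proof -
  interpret right_module R M by fact
  interpret N: submodule N R M by fact
  have sub: "\<And>x. x \<in> N \<Longrightarrow> x \<in> carrier M" using N.subset by auto
  show ?thesis
  proof (rule right_moduleI)
    fix x y assume "x \<in> carrier (restrict_module M N)" "y \<in> carrier (restrict_module M N)"
    then show "x \<oplus>\<^bsub>restrict_module M N\<^esub> y = y \<oplus>\<^bsub>restrict_module M N\<^esub> x"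
      by (simp add: M.a_comm sub)
  qed (use N.one_closed N.m_closed in \<open>auto simp: R.ring_axioms sub M.a_assoc zero_smult
        smult_add_ring smult_add_module smult_assoc smult_one\<close>)
qed

lemma direct_sum_simps [simp]:
  "carrier (direct_sum A M) = {f \<in> (\<Pi>\<^sub>E i\<in>A. carrier (M i)). finite {i \<in> A. f i \<noteq> \<zero>\<^bsub>M i\<^esub>}}"
  "\<zero>\<^bsub>direct_sum A M\<^esub> = (\<lambda>i\<in>A. \<zero>\<^bsub>M i\<^esub>)"
  "f \<oplus>\<^bsub>direct_sum A M\<^esub> g = (\<lambda>i\<in>A. f i \<oplus>\<^bsub>M i\<^esub> g i)"
  "r \<odot>\<^bsub>direct_sum A M\<^esub> f = (\<lambda>i\<in>A. r \<odot>\<^bsub>M i\<^esub> f i)"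
  by (simp_all add: direct_sum_def)

lemma direct_sum_right_module:
  fixes M :: "'i \<Rightarrow> ('a, 'b) module"
  assumes "ring R" "\<And>i. i \<in> A \<Longrightarrow> right_module R (M i)"
  shows "right_module R (direct_sum A M)"
proof (rule right_moduleI)
  interpret R: ring R by fact
  note rm = right_module.axioms(2)[OF assms(2)]
  note cl = right_module.smult_closed[OF assms(2)] abelian_groupE(1)[OF rm]
  fix x y z r s assume x: "x \<in> carrier (direct_sum A M)"
  then have xm: "\<And>i. i \<in> A \<Longrightarrow> x i \<in> carrier (M i)" and xu: "\<And>i. i \<notin> A \<Longrightarrow> x i = undefined"
    by (auto simp: PiE_def extensional_def)
  show "\<zero>\<^bsub>direct_sum A M\<^esub> \<oplus>\<^bsub>direct_sum A M\<^esub> x = x"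
    by (rule ext) (auto simp: xm xu restrict_def abelian_groupE(5)[OF rm])
  show "\<one>\<^bsub>R\<^esub> \<odot>\<^bsub>direct_sum A M\<^esub> x = x"
    by (rule ext) (auto simp: xm xu restrict_def right_module.smult_one[OF assms(2)])
  show "\<zero>\<^bsub>R\<^esub> \<odot>\<^bsub>direct_sum A M\<^esub> x = \<zero>\<^bsub>direct_sum A M\<^esub>"
    by (rule ext) (auto simp: xm restrict_def right_module.zero_smult[OF assms(2)])
  { assume r: "r \<in> carrier R"
    have "finite {i \<in> A. r \<odot>\<^bsub>M i\<^esub> x i \<noteq> \<zero>\<^bsub>M i\<^esub>}"
      by (rule finite_subset[of _ "{i \<in> A. x i \<noteq> \<zero>\<^bsub>M i\<^esub>}"])
        (use x r right_module.smult_zero[OF assms(2)] in auto)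
    then show "r \<odot>\<^bsub>direct_sum A M\<^esub> x \<in> carrier (direct_sum A M)"
      using r by (auto simp: xm cl cong: conj_cong)
    assume s: "s \<in> carrier R"
    show "(r \<oplus>\<^bsub>R\<^esub> s) \<odot>\<^bsub>direct_sum A M\<^esub> x
        = r \<odot>\<^bsub>direct_sum A M\<^esub> x \<oplus>\<^bsub>direct_sum A M\<^esub> s \<odot>\<^bsub>direct_sum A M\<^esub> x"
      by (rule ext) (use r s in \<open>auto simp: xm restrict_def right_module.smult_add_ring[OF assms(2)]\<close>)
    show "s \<odot>\<^bsub>direct_sum A M\<^esub> (r \<odot>\<^bsub>direct_sum A M\<^esub> x) = (r \<otimes>\<^bsub>R\<^esub> s) \<odot>\<^bsub>direct_sum A M\<^esub> x"
      by (rule ext) (use r s in \<open>auto simp: xm restrict_def right_module.smult_assoc[OF assms(2)]\<close>)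
  }
  assume y: "y \<in> carrier (direct_sum A M)"
  then have ym: "\<And>i. i \<in> A \<Longrightarrow> y i \<in> carrier (M i)" by auto
  have "finite {i \<in> A. x i \<oplus>\<^bsub>M i\<^esub> y i \<noteq> \<zero>\<^bsub>M i\<^esub>}"
    by (rule finite_subset[of _ "{i \<in> A. x i \<noteq> \<zero>\<^bsub>M i\<^esub>} \<union> {i \<in> A. y i \<noteq> \<zero>\<^bsub>M i\<^esub>}"])
      (use x y abelian_groupE(2,5)[OF rm] in auto)
  then show "x \<oplus>\<^bsub>direct_sum A M\<^esub> y \<in> carrier (direct_sum A M)"
    by (auto simp: xm ym cl cong: conj_cong)
  show "x \<oplus>\<^bsub>direct_sum A M\<^esub> y = y \<oplus>\<^bsub>direct_sum A M\<^esub> x"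
    by (rule ext) (use xm ym abelian_groupE(4)[OF rm] in \<open>auto simp: restrict_def\<close>)
  show "r \<odot>\<^bsub>direct_sum A M\<^esub> (x \<oplus>\<^bsub>direct_sum A M\<^esub> y)
      = r \<odot>\<^bsub>direct_sum A M\<^esub> x \<oplus>\<^bsub>direct_sum A M\<^esub> r \<odot>\<^bsub>direct_sum A M\<^esub> y"
    if "r \<in> carrier R"
    by (rule ext) (use that in \<open>auto simp: xm ym restrict_def right_module.smult_add_module[OF assms(2)]\<close>)
  assume z: "z \<in> carrier (direct_sum A M)"
  then have zm: "\<And>i. i \<in> A \<Longrightarrow> z i \<in> carrier (M i)" by auto
  show "x \<oplus>\<^bsub>direct_sum A M\<^esub> y \<oplus>\<^bsub>direct_sum A M\<^esub> z = x \<oplus>\<^bsub>direct_sum A M\<^esub> (y \<oplus>\<^bsub>direct_sum A M\<^esub> z)"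
    by (rule ext) (auto simp: xm ym zm restrict_def abelian_groupE(3)[OF rm])
qed (use assms abelian_groupE(2)[OF right_module.axioms(2)[OF assms(2)]] in auto)

section \<open>Projectivity and base change to a quotient ring\<close>

text \<open>The kernel of \<open>p\<close> is a complement of the image of \<open>i\<close>, by
  \<open>x = i (p x) + (x - i (p x))\<close>.\<close>

lemma split_mono_direct_summand:
  fixes P :: "('a, 'b) module" and F :: "('a, 'c) module"
  assumes P: "right_module R P" and F: "right_module R F"
    and i: "i \<in> module_hom R P F" and p: "p \<in> module_hom R F P"
    and pi: "\<And>x. x \<in> carrier P \<Longrightarrow> p (i x) = x"
  shows "direct_summand R F (i ` carrier P) \<and> module_iso R P (restrict_module F (i ` carrier P))"
proof
  interpret P: right_module R P by fact
  interpret F: right_module R F by fact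
  note ih = module_hom_closed[OF i] and ph = module_hom_closed[OF p]
  have i0: "i \<zero>\<^bsub>P\<^esub> = \<zero>\<^bsub>F\<^esub>" and p0: "p \<zero>\<^bsub>F\<^esub> = \<zero>\<^bsub>P\<^esub>"
    using module_hom_zero[OF P F i] module_hom_zero[OF F P p] by auto
  let ?N = "i ` carrier P" and ?N' = "{x \<in> carrier F. p x = \<zero>\<^bsub>P\<^esub>}"
  have N: "submodule ?N R F"
  proof (rule F.submoduleI)
    show "?N \<subseteq> carrier F" using ih by auto
    show "\<zero>\<^bsub>F\<^esub> \<in> ?N" using i0 by (metis P.M.zero_closed imageI)
    show "x \<oplus>\<^bsub>F\<^esub> y \<in> ?N" if "x \<in> ?N" "y \<in> ?N" for x y
      using that module_hom_add[OF i] by (metis (no_types, lifting) P.M.a_closed image_iff)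
    show "r \<odot>\<^bsub>F\<^esub> x \<in> ?N" if "r \<in> carrier R" "x \<in> ?N" for r x
      using that module_hom_smult[OF i] by (metis (no_types, lifting) P.smult_closed image_iff)
  qed
  have N': "submodule ?N' R F"
    by (rule F.submoduleI)
      (auto simp: p0 module_hom_add[OF p] module_hom_smult[OF p] F.smult_closed P.smult_zero)
  have "?N \<inter> ?N' = {\<zero>\<^bsub>F\<^esub>}"
    using pi i0 p0 ih by (auto intro!: image_eqI[of _ i "\<zero>\<^bsub>P\<^esub>"])
  moreover have "?N <+>\<^bsub>F\<^esub> ?N' = carrier F"
  proof
    show "?N <+>\<^bsub>F\<^esub> ?N' \<subseteq> carrier F" using ih by (auto simp: set_add_def')
    show "carrier F \<subseteq> ?N <+>\<^bsub>F\<^esub> ?N'"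
    proof
      fix x assume x: "x \<in> carrier F"
      let ?y = "\<ominus>\<^bsub>F\<^esub> i (p x) \<oplus>\<^bsub>F\<^esub> x"
      have y: "?y \<in> carrier F" using x ih ph by simp
      have "p ?y = \<ominus>\<^bsub>P\<^esub> p x \<oplus>\<^bsub>P\<^esub> p x"
        using x ih ph by (simp add: module_hom_add[OF p] module_hom_minus[OF F P p] pi)
      then have "?y \<in> ?N'" using y x ph by (simp add: P.M.l_neg)
      moreover have "x = i (p x) \<oplus>\<^bsub>F\<^esub> ?y"
        using x ih ph by (simp add: F.M.a_assoc[symmetric] F.M.r_neg)
      ultimately show "x \<in> ?N <+>\<^bsub>F\<^esub> ?N'"
        using x ph unfolding set_add_def' by blast
    qed
  qed
  ultimately show "direct_summand R F ?N" using N N' unfolding direct_summand_def by blast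
  have "i \<in> module_hom R P (restrict_module F ?N)"
    using i by (auto simp: module_hom_def)
  moreover have "bij_betw i (carrier P) ?N"
    using pi by (auto simp: bij_betw_def intro!: inj_on_inverseI[of _ p])
  ultimately show "module_iso R P (restrict_module F ?N)" by (auto simp: module_iso_def)
qed

text \<open>The dual basis lemma: \<open>x \<mapsto> (f y x)\<^sub>y\<close> embeds \<open>P\<close>
  into the free module on \<open>Y\<close>, and sending a vector to the combination of the
  \<open>e y\<close> with its coordinates is a retraction. The index set lies in the type of
  elements of \<open>P\<close>, as the definition of \<open>projective\<close> demands.\<close>

lemma dual_basis_projective:
  fixes P :: "('a, 'b) module" and Y :: "'b set"
  assumes P: "right_module R P"
    and e: "\<And>y. y \<in> Y \<Longrightarrow> e y \<in> carrier P"
    and f: "\<And>y. y \<in> Y \<Longrightarrow> f y \<in> module_hom R P (regular_right R)"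
    and ef: "\<And>x. x \<in> carrier P \<Longrightarrow> \<exists>A. finite A \<and> A \<subseteq> Y \<and> (\<forall>y\<in>Y - A. f y x = \<zero>\<^bsub>R\<^esub>) \<and>
      x = (\<Oplus>\<^bsub>P\<^esub>y\<in>A. f y x \<odot>\<^bsub>P\<^esub> e y)"
  shows "projective R P"
proof -
  interpret P: right_module R P by fact
  let ?F = "direct_sum Y (\<lambda>_. regular_right R)"
  have F: "right_module R ?F"
    by (rule direct_sum_right_module) (auto simp: P.R.ring_axioms P.R.regular_right_module)
  define i where "i x = (\<lambda>y\<in>Y. f y x)" for x
  define supp where "supp g = {y \<in> Y. g y \<noteq> \<zero>\<^bsub>R\<^esub>}" for g
  define p where "p g = (\<Oplus>\<^bsub>P\<^esub>y\<in>supp g. g y \<odot>\<^bsub>P\<^esub> e y)" for g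
  have fc: "f y x \<in> carrier R" if "y \<in> Y" "x \<in> carrier P" for x y
    using module_hom_closed[OF f] that by fastforce
  \<comment> \<open>Two vectors have different supports; to add their images both sums are first
    taken over a common finite set.\<close>
  have p_eq: "p g = (\<Oplus>\<^bsub>P\<^esub>y\<in>A. g y \<odot>\<^bsub>P\<^esub> e y)"
    if "finite A" "supp g \<subseteq> A" "A \<subseteq> Y" "\<And>y. y \<in> Y \<Longrightarrow> g y \<in> carrier R" for g A
    unfolding p_def
    by (rule P.M.add.finprod_mono_neutral_cong_left)
      (use that e P.zero_smult P.smult_closed in \<open>auto simp: supp_def\<close>)
  have i: "i \<in> module_hom R P ?F"
  proof (rule module_homI)
    fix x assume x: "x \<in> carrier P"
    obtain A where "finite A" "\<forall>y\<in>Y - A. f y x = \<zero>\<^bsub>R\<^esub>" using ef[OF x] by blast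
    then have "finite {y \<in> Y. f y x \<noteq> \<zero>\<^bsub>R\<^esub>}" by (auto intro: finite_subset[of _ A])
    then show "i x \<in> carrier ?F" using fc x by (auto simp: i_def cong: conj_cong)
  qed (use module_hom_add[OF f] module_hom_smult[OF f] in \<open>auto simp: i_def cong: restrict_cong\<close>)
  have p: "p \<in> module_hom R ?F P"
  proof (rule module_homI)
    fix g assume g: "g \<in> carrier ?F"
    then have gc: "g y \<in> carrier R" if "y \<in> Y" for y using that by auto
    have fs: "finite (supp g)" using g by (auto simp: supp_def)
    show "p g \<in> carrier P" unfolding p_def
      using gc e P.smult_closed by (auto simp: supp_def intro!: P.M.finsum_closed)
    { fix r assume r: "r \<in> carrier R"
      have "p (r \<odot>\<^bsub>?F\<^esub> g) = (\<Oplus>\<^bsub>P\<^esub>y\<in>supp g. (r \<odot>\<^bsub>?F\<^esub> g) y \<odot>\<^bsub>P\<^esub> e y)"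
        by (rule p_eq) (use fs gc r in \<open>auto simp: supp_def\<close>)
      also have "\<dots> = (\<Oplus>\<^bsub>P\<^esub>y\<in>supp g. r \<odot>\<^bsub>P\<^esub> (g y \<odot>\<^bsub>P\<^esub> e y))"
        using r gc e by (intro P.M.finsum_cong') (auto simp: P.smult_assoc P.smult_closed supp_def)
      also have "\<dots> = r \<odot>\<^bsub>P\<^esub> p g" unfolding p_def
        using r gc e by (intro P.smult_finsum[symmetric]) (auto simp: P.smult_closed supp_def)
      finally show "p (r \<odot>\<^bsub>?F\<^esub> g) = r \<odot>\<^bsub>P\<^esub> p g" . }
    fix h assume h: "h \<in> carrier ?F"
    then have hc: "h y \<in> carrier R" if "y \<in> Y" for y using that by auto
    have hs: "finite (supp h)" using h by (auto simp: supp_def)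
    let ?A = "supp g \<union> supp h"
    have A: "?A \<subseteq> Y" by (auto simp: supp_def)
    have "p (g \<oplus>\<^bsub>?F\<^esub> h) = (\<Oplus>\<^bsub>P\<^esub>y\<in>?A. (g \<oplus>\<^bsub>?F\<^esub> h) y \<odot>\<^bsub>P\<^esub> e y)"
      by (rule p_eq) (use fs hs gc hc in \<open>auto simp: supp_def\<close>)
    also have "\<dots> = (\<Oplus>\<^bsub>P\<^esub>y\<in>?A. g y \<odot>\<^bsub>P\<^esub> e y \<oplus>\<^bsub>P\<^esub> h y \<odot>\<^bsub>P\<^esub> e y)"
      using gc hc e A by (intro P.M.finsum_cong') (auto simp: P.smult_add_ring P.smult_closed)
    also have "\<dots> = (\<Oplus>\<^bsub>P\<^esub>y\<in>?A. g y \<odot>\<^bsub>P\<^esub> e y) \<oplus>\<^bsub>P\<^esub> (\<Oplus>\<^bsub>P\<^esub>y\<in>?A. h y \<odot>\<^bsub>P\<^esub> e y)"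
      using gc hc e A by (intro P.M.finsum_addf) (auto simp: P.smult_closed)
    also have "\<dots> = p g \<oplus>\<^bsub>P\<^esub> p h"
      using p_eq[of ?A g] p_eq[of ?A h] fs hs gc hc A by auto
    finally show "p (g \<oplus>\<^bsub>?F\<^esub> h) = p g \<oplus>\<^bsub>P\<^esub> p h" .
  qed
  have "p (i x) = x" if x: "x \<in> carrier P" for x
  proof -
    obtain A where A: "finite A" "A \<subseteq> Y" "\<forall>y\<in>Y - A. f y x = \<zero>\<^bsub>R\<^esub>"
      "x = (\<Oplus>\<^bsub>P\<^esub>y\<in>A. f y x \<odot>\<^bsub>P\<^esub> e y)" using ef[OF x] by blast
    have "p (i x) = (\<Oplus>\<^bsub>P\<^esub>y\<in>A. i x y \<odot>\<^bsub>P\<^esub> e y)"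
      by (rule p_eq) (use A fc x in \<open>auto simp: supp_def i_def\<close>)
    also have "\<dots> = (\<Oplus>\<^bsub>P\<^esub>y\<in>A. f y x \<odot>\<^bsub>P\<^esub> e y)"
      using A(2) fc x e by (intro P.M.finsum_cong') (auto simp: i_def P.smult_closed)
    finally show ?thesis using A(4) by simp
  qed
  then have "direct_summand R ?F (i ` carrier P) \<and> module_iso R P (restrict_module ?F (i ` carrier P))"
    by (rule split_mono_direct_summand[OF P F i p])
  then show ?thesis unfolding projective_def by blast
qed

section \<open>Cosets modulo an ideal and the tensor product with \<open>R/J\<close>\<close>

lemma (in ideal) quot_simps:
  shows "carrier (R Quot I) = (\<lambda>x. I +> x) ` carrier R" "\<zero>\<^bsub>R Quot I\<^esub> = I"
    "\<one>\<^bsub>R Quot I\<^esub> = I +> \<one>"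
    "\<lbrakk>x \<in> carrier R; y \<in> carrier R\<rbrakk> \<Longrightarrow> (I +> x) \<oplus>\<^bsub>R Quot I\<^esub> (I +> y) = I +> (x \<oplus> y)"
    "\<lbrakk>x \<in> carrier R; y \<in> carrier R\<rbrakk> \<Longrightarrow> (I +> x) \<otimes>\<^bsub>R Quot I\<^esub> (I +> y) = I +> (x \<otimes> y)"
  by (auto simp: FactRing_def A_RCOSETS_def' a_rcos_sum rcoset_mult_add)

lemma (in ideal) quot_eq_iff:
  assumes "x \<in> carrier R" "y \<in> carrier R"
  shows "I +> x = I +> y \<longleftrightarrow> x \<ominus> y \<in> I"
  using assms a_rcos_module_minus[OF ring_axioms assms(2,1)]
  by (metis a_rcos_self a_repr_independence')

lemma (in ideal) quot_eq_zero_iff: "x \<in> carrier R \<Longrightarrow> I +> x = I \<longleftrightarrow> x \<in> I"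
  by (metis a_coset_join1 a_coset_join2 a_subgroup)

lemma (in comm_group) free_Abelian_hom_sub:
  assumes "h \<in> hom (free_Abelian_group S) G" "Poly_Mapping.keys x \<subseteq> S" "Poly_Mapping.keys y \<subseteq> S"
  shows "h (x - y) = h x \<otimes> inv (h y)"
proof -
  interpret h: group_hom "free_Abelian_group S" G h
    by (intro group_hom.intro group_hom_axioms.intro) (auto simp: assms is_group)
  have "h (x + (- y)) = h x \<otimes> h (- y)"
    using h.hom_mult[of x "- y"] assms by simp
  moreover have "h (- y) = inv (h y)" using h.hom_inv[of y] assms by simp
  ultimately show ?thesis by simp
qed

text \<open>Every tensor equals some \<open>x \<otimes> 1\<close>, since \<open>(x, J + r)\<close>
  and \<open>(x r, 1)\<close> are identified, and \<open>x \<otimes> 1 = 0\<close> for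
  \<open>x\<close> in \<open>P J\<close>. So an additive, semilinear surjection \<open>th\<close>
  whose kernel lies in \<open>P J\<close> induces an isomorphism. Any such \<open>W\<close> can be
  used directly, without passing through \<open>P/PJ\<close> as an
  \<open>R/J\<close>-module.\<close>

lemma tensor_quotient_iso:
  fixes P :: "('a, 'p) module" and W :: "('a set, 'x) module"
  assumes P: "right_module R P" and J: "ideal J R" and W: "right_module (R Quot J) W"
    and th: "\<And>x. x \<in> carrier P \<Longrightarrow> th x \<in> carrier W"
    and th_add: "\<And>x y. \<lbrakk>x \<in> carrier P; y \<in> carrier P\<rbrakk> \<Longrightarrow> th (x \<oplus>\<^bsub>P\<^esub> y) = th x \<oplus>\<^bsub>W\<^esub> th y"
    and th_smult: "\<And>r x. \<lbrakk>r \<in> carrier R; x \<in> carrier P\<rbrakk>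
      \<Longrightarrow> th (r \<odot>\<^bsub>P\<^esub> x) = (J +>\<^bsub>R\<^esub> r) \<odot>\<^bsub>W\<^esub> th x"
    and th_surj: "\<And>w. w \<in> carrier W \<Longrightarrow> \<exists>x\<in>carrier P. th x = w"
    and th_ker: "\<And>x. \<lbrakk>x \<in> carrier P; th x = \<zero>\<^bsub>W\<^esub>\<rbrakk> \<Longrightarrow> x \<in> module_times_ideal P J"
  shows "module_iso (R Quot J) (tensor_quotient R P J) W"
proof -
  interpret P: right_module R P by fact
  interpret J: ideal J R by fact
  let ?Q = "R Quot J"
  interpret Q: ring ?Q by (rule J.quotient_is_ring)
  interpret W: right_module ?Q W by fact
  let ?co = "\<lambda>r. J +>\<^bsub>R\<^esub> r"
  let ?S = "carrier P \<times> carrier ?Q"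
  define F where "F = free_Abelian_group ?S"
  interpret F: comm_group F unfolding F_def by (rule abelian_free_Abelian_group)
  let ?l = "\<lambda>r b. ?co r \<otimes>\<^bsub>?Q\<^esub> b"
  define Rel where "Rel = tensor_relations R P (regular_right ?Q) ?l"
  define K where "K = generate F Rel"
  have co: "?co r \<in> carrier ?Q" if "r \<in> carrier R" for r using that by (auto simp: J.quot_simps)
  have F_simps [simp]: "\<And>t. t \<in> carrier F \<longleftrightarrow> Poly_Mapping.keys t \<subseteq> ?S" "\<one>\<^bsub>F\<^esub> = 0"
    "\<And>t u. t \<otimes>\<^bsub>F\<^esub> u = t + u"
    by (auto simp: F_def)
  have diffF: "t - u \<in> carrier F" if "t \<in> carrier F" "u \<in> carrier F" for t u
    using that keys_diff[of t u] by auto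
  have Rel_add_l: "frag_of (x \<oplus>\<^bsub>P\<^esub> y, b) - frag_of (x, b) - frag_of (y, b) \<in> Rel"
    if "x \<in> carrier P" "y \<in> carrier P" "b \<in> carrier ?Q" for x y b
    unfolding Rel_def tensor_relations_def regular_right_simps using that by blast
  have Rel_add_r: "frag_of (x, b \<oplus>\<^bsub>?Q\<^esub> c) - frag_of (x, b) - frag_of (x, c) \<in> Rel"
    if "x \<in> carrier P" "b \<in> carrier ?Q" "c \<in> carrier ?Q" for x b c
    unfolding Rel_def tensor_relations_def regular_right_simps using that by blast
  have Rel_smult: "frag_of (r \<odot>\<^bsub>P\<^esub> x, b) - frag_of (x, ?l r b) \<in> Rel"
    if "r \<in> carrier R" "x \<in> carrier P" "b \<in> carrier ?Q" for r x b
    unfolding Rel_def tensor_relations_def regular_right_simps using that by blast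
  have Rel_subset: "Rel \<subseteq> H"
    if 1: "\<And>x y b. \<lbrakk>x \<in> carrier P; y \<in> carrier P; b \<in> carrier ?Q\<rbrakk>
        \<Longrightarrow> frag_of (x \<oplus>\<^bsub>P\<^esub> y, b) - frag_of (x, b) - frag_of (y, b) \<in> H"
      and 2: "\<And>x b c. \<lbrakk>x \<in> carrier P; b \<in> carrier ?Q; c \<in> carrier ?Q\<rbrakk>
        \<Longrightarrow> frag_of (x, b \<oplus>\<^bsub>?Q\<^esub> c) - frag_of (x, b) - frag_of (x, c) \<in> H"
      and 3: "\<And>r x b. \<lbrakk>r \<in> carrier R; x \<in> carrier P; b \<in> carrier ?Q\<rbrakk>
        \<Longrightarrow> frag_of (r \<odot>\<^bsub>P\<^esub> x, b) - frag_of (x, ?l r b) \<in> H" for H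
    unfolding Rel_def tensor_relations_def regular_right_simps
    by (intro Un_least; clarify; intro 1 2 3; assumption)
  have fr: "frag_of (x, b) \<in> carrier F" if "x \<in> carrier P" "b \<in> carrier ?Q" for x b
    using that by simp
  have RelF: "Rel \<subseteq> carrier F"
    by (rule Rel_subset; intro diffF fr) (simp_all add: P.smult_closed co)
  have K: "subgroup K F" unfolding K_def by (rule F.generate_is_subgroup[OF RelF])
  interpret K: subgroup K F by (rule K)
  interpret KN: normal K F by (rule F.subgroup_imp_normal[OF K])
  have RelK: "t \<in> K" if "t \<in> Rel" for t unfolding K_def using that by (rule generate.incl)
  have K_diff: "t - u \<in> K" if "t \<in> K" "u \<in> K" for t u
  proof -
    have "t + inv\<^bsub>F\<^esub> u \<in> K" using K.m_closed[OF that(1) K.m_inv_closed[OF that(2)]] by simp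
    moreover have "inv\<^bsub>F\<^esub> u = - u" using K.mem_carrier[OF that(2)] by (simp add: F_def)
    ultimately show ?thesis by simp
  qed
  have coset_eq: "K #>\<^bsub>F\<^esub> t = K #>\<^bsub>F\<^esub> u" if "t \<in> carrier F" "u \<in> carrier F" "t - u \<in> K" for t u
  proof -
    have "t \<in> K #>\<^bsub>F\<^esub> u" unfolding r_coset_def using that(3) by (auto intro!: bexI[of _ "t - u"])
    then show ?thesis using F.repr_independence[OF _ that(2) K] by simp
  qed
  have subgroup_of_F: "subgroup H F"
    if "H \<subseteq> carrier F" "0 \<in> H" "\<And>t u. \<lbrakk>t \<in> H; u \<in> H\<rbrakk> \<Longrightarrow> t - u \<in> H" for H
  proof (rule F.subgroupI)
    show "H \<subseteq> carrier F" "H \<noteq> {}" using that by auto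
    fix t assume t: "t \<in> H"
    have "inv\<^bsub>F\<^esub> t = 0 - t" using t that(1) by (auto simp: F_def)
    then show inv: "inv\<^bsub>F\<^esub> t \<in> H" using that(2,3) t by metis
    fix u assume "u \<in> H"
    have "t \<otimes>\<^bsub>F\<^esub> u = u - (0 - t)" by simp
    then show "t \<otimes>\<^bsub>F\<^esub> u \<in> H" using that(2,3) t \<open>u \<in> H\<close> by metis
  qed
  obtain h where h: "h \<in> hom F (add_monoid W)"
    and h_of: "\<And>x b. \<lbrakk>x \<in> carrier P; b \<in> carrier ?Q\<rbrakk> \<Longrightarrow> h (frag_of (x, b)) = b \<odot>\<^bsub>W\<^esub> th x"
  proof -
    have "(\<lambda>(x, b). b \<odot>\<^bsub>W\<^esub> th x) ` ?S \<subseteq> carrier (add_monoid W)"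
      using th W.smult_closed by auto
    from comm_group.free_Abelian_group_universal[OF W.M.a_comm_group this] obtain h
      where "h \<in> hom F (add_monoid W)" "\<And>z. z \<in> ?S \<Longrightarrow> h (frag_of z) = (\<lambda>(x, b). b \<odot>\<^bsub>W\<^esub> th x) z"
      unfolding F_def by blast
    then show ?thesis using that by force
  qed
  have h_closed: "h t \<in> carrier W" if "t \<in> carrier F" for t
    using h that unfolding hom_def by auto
  have h_diff: "h (t - u) = h t \<ominus>\<^bsub>W\<^esub> h u" if "t \<in> carrier F" "u \<in> carrier F" for t u
    using comm_group.free_Abelian_hom_sub[OF W.M.a_comm_group h[unfolded F_def]] that
    by (simp add: F_def a_minus_def a_inv_def)
  have h0: "h 0 = \<zero>\<^bsub>W\<^esub>"
    using h_diff[of 0 0] h_closed[of 0] by (simp add: W.M.minus_eq W.M.r_neg)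
  have hK: "h t = \<zero>\<^bsub>W\<^esub>" if "t \<in> K" for t
  proof -
    let ?H = "{t \<in> carrier F. h t = \<zero>\<^bsub>W\<^esub>}"
    have dd: "t - u \<in> ?H" if "t \<in> carrier F" "u \<in> carrier F" "h t = h u" for t u
      using that diffF h_diff h_closed by (simp add: W.M.minus_eq W.M.r_neg)
    have ddd: "t - u - v \<in> ?H" if "t \<in> carrier F" "u \<in> carrier F" "v \<in> carrier F"
      "h t = h u \<oplus>\<^bsub>W\<^esub> h v" for t u v
    proof (rule dd)
      have "h (t - u) = h u \<oplus>\<^bsub>W\<^esub> h v \<oplus>\<^bsub>W\<^esub> \<ominus>\<^bsub>W\<^esub> h u"
        using that h_diff by (simp add: W.M.minus_eq)
      also have "\<dots> = h v"
        using h_closed[OF that(2)] h_closed[OF that(3)]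
        by (simp add: W.M.a_comm[of "h u" "h v"] W.M.a_assoc W.M.r_neg)
      finally show "h (t - u) = h v" .
    qed (use that diffF in auto)
    have "Rel \<subseteq> ?H"
    proof (rule Rel_subset)
      fix x y b assume *: "x \<in> carrier P" "y \<in> carrier P" "b \<in> carrier ?Q"
      show "frag_of (x \<oplus>\<^bsub>P\<^esub> y, b) - frag_of (x, b) - frag_of (y, b) \<in> ?H"
        by (rule ddd) (use * in \<open>simp_all add: fr h_of th_add th W.smult_add_module del: F_simps\<close>)
    next
      fix x b c assume *: "x \<in> carrier P" "b \<in> carrier ?Q" "c \<in> carrier ?Q"
      show "frag_of (x, b \<oplus>\<^bsub>?Q\<^esub> c) - frag_of (x, b) - frag_of (x, c) \<in> ?H"
        by (rule ddd) (use * in \<open>simp_all add: fr h_of th W.smult_add_ring del: F_simps\<close>)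
    next
      fix r x b assume *: "r \<in> carrier R" "x \<in> carrier P" "b \<in> carrier ?Q"
      then have "?l r b \<in> carrier ?Q" using co by simp
      then show "frag_of (r \<odot>\<^bsub>P\<^esub> x, b) - frag_of (x, ?l r b) \<in> ?H"
        by (intro dd) (use * in \<open>simp_all add: fr h_of th th_smult co W.smult_assoc P.smult_closed del: F_simps\<close>)
    qed
    moreover have "subgroup ?H F"
    proof (rule subgroup_of_F)
      show "t - u \<in> ?H" if "t \<in> ?H" "u \<in> ?H" for t u using that by (intro dd) simp_all
    qed (use h0 in auto)
    ultimately have "K \<subseteq> ?H" unfolding K_def by (rule F.generate_subgroup_incl)
    then show ?thesis using that by blast
  qed
  \<comment> \<open>The map \<open>x \<mapsto> x \<otimes> 1\<close>; it turns out to be additive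
    and onto, and to vanish on \<open>P J\<close>.\<close>
  define tau where "tau x = K #>\<^bsub>F\<^esub> frag_of (x, \<one>\<^bsub>?Q\<^esub>)" for x
  have rel_smult: "K #>\<^bsub>F\<^esub> frag_of (x, ?co r) = tau (r \<odot>\<^bsub>P\<^esub> x)"
    if "x \<in> carrier P" "r \<in> carrier R" for x r
  proof -
    have "frag_of (r \<odot>\<^bsub>P\<^esub> x, \<one>\<^bsub>?Q\<^esub>) - frag_of (x, ?l r \<one>\<^bsub>?Q\<^esub>) \<in> Rel"
      by (rule Rel_smult) (use that in simp_all)
    then have "frag_of (r \<odot>\<^bsub>P\<^esub> x, \<one>\<^bsub>?Q\<^esub>) - frag_of (x, ?co r) \<in> K"
      using RelK that co by simp
    from coset_eq[OF fr fr this] that co P.smult_closed show ?thesis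
      unfolding tau_def by auto
  qed
  have rel_add: "frag_of (x \<oplus>\<^bsub>P\<^esub> y, b) - frag_of (x, b) - frag_of (y, b) \<in> K"
    if "x \<in> carrier P" "y \<in> carrier P" "b \<in> carrier ?Q" for x y b
    by (intro RelK Rel_add_l that)
  have tau_add: "tau (x \<oplus>\<^bsub>P\<^esub> y) = K #>\<^bsub>F\<^esub> (frag_of (x, \<one>\<^bsub>?Q\<^esub>) + frag_of (y, \<one>\<^bsub>?Q\<^esub>))"
    if "x \<in> carrier P" "y \<in> carrier P" for x y
    unfolding tau_def
  proof (rule coset_eq)
    show "frag_of (x, \<one>\<^bsub>?Q\<^esub>) + frag_of (y, \<one>\<^bsub>?Q\<^esub>) \<in> carrier F"
      using F.m_closed[OF fr fr] that by simp
  qed (use that rel_add[of x y "\<one>\<^bsub>?Q\<^esub>"] in \<open>auto simp: algebra_simps\<close>)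
  have tau_zero: "tau \<zero>\<^bsub>P\<^esub> = K"
  proof -
    have "0 \<in> K" using K.one_closed by simp
    from K_diff[OF this rel_add[of "\<zero>\<^bsub>P\<^esub>" "\<zero>\<^bsub>P\<^esub>" "\<one>\<^bsub>?Q\<^esub>"]]
    have "frag_of (\<zero>\<^bsub>P\<^esub>, \<one>\<^bsub>?Q\<^esub>) \<in> K" by simp
    then show ?thesis unfolding tau_def using F.coset_join2[OF fr K] by simp
  qed
  have coset_add: "K #>\<^bsub>F\<^esub> (t + u) = (K #>\<^bsub>F\<^esub> t) <#>\<^bsub>F\<^esub> (K #>\<^bsub>F\<^esub> u)"
    if "t \<in> carrier F" "u \<in> carrier F" for t u using KN.rcos_sum[OF that] by simp
  have tau_add': "tau (x \<oplus>\<^bsub>P\<^esub> y) = tau x <#>\<^bsub>F\<^esub> tau y"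
    if "x \<in> carrier P" "y \<in> carrier P" for x y
    unfolding tau_add[OF that] unfolding tau_def by (rule coset_add) (use that in auto)
  have rep: "\<exists>x\<in>carrier P. K #>\<^bsub>F\<^esub> t = tau x" if "t \<in> carrier F" for t
  proof -
    have "Poly_Mapping.keys t \<subseteq> ?S" using that by simp
    then show ?thesis
    proof (rule free_Abelian_group_induct)
      have "K #>\<^bsub>F\<^esub> 0 = K" using F.coset_join2[OF _ K, of 0] K.one_closed by simp
      then show "\<exists>x\<in>carrier P. K #>\<^bsub>F\<^esub> 0 = tau x" using tau_zero by (metis P.M.zero_closed)
    next
      fix t u assume tu: "Poly_Mapping.keys t \<subseteq> ?S" "Poly_Mapping.keys u \<subseteq> ?S"
        "\<exists>x\<in>carrier P. K #>\<^bsub>F\<^esub> t = tau x" "\<exists>x\<in>carrier P. K #>\<^bsub>F\<^esub> u = tau x"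
      then obtain x y where xy: "x \<in> carrier P" "K #>\<^bsub>F\<^esub> t = tau x" "y \<in> carrier P" "K #>\<^bsub>F\<^esub> u = tau y"
        by blast
      \<comment> \<open>The induction on the free abelian group runs over differences, so the
        witness for \<open>t - u\<close> is \<open>x - y\<close>; that it works is additivity
        applied to \<open>(x - y) + y\<close>.\<close>
      let ?z = "x \<oplus>\<^bsub>P\<^esub> \<ominus>\<^bsub>P\<^esub> y" and ?fr = "\<lambda>x. frag_of (x, \<one>\<^bsub>?Q\<^esub>)"
      have tF: "t \<in> carrier F" and uF: "u \<in> carrier F" using tu by auto
      have zy: "?z \<oplus>\<^bsub>P\<^esub> y = x" using xy by (simp add: P.M.a_assoc P.M.l_neg)
      have "t \<in> K #>\<^bsub>F\<^esub> ?fr x" "u \<in> K #>\<^bsub>F\<^esub> ?fr y"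
        using xy(2,4) F.rcos_self[OF tF K] F.rcos_self[OF uF K] by (auto simp: tau_def)
      then obtain k1 k2 where k: "k1 \<in> K" "t = k1 + ?fr x" "k2 \<in> K" "u = k2 + ?fr y"
        unfolding r_coset_def by auto
      have zP: "?z \<in> carrier P" using xy by simp
      have "(k1 - k2) + (?fr (?z \<oplus>\<^bsub>P\<^esub> y) - ?fr ?z - ?fr y) \<in> K"
        using K.m_closed[OF K_diff[OF k(1,3)] rel_add[OF zP xy(3) Q.one_closed]] by simp
      then have "t - u - ?fr ?z \<in> K" unfolding k zy by (simp add: algebra_simps)
      then have "K #>\<^bsub>F\<^esub> (t - u) = tau ?z" unfolding tau_def
        using diffF[OF tF uF] zP by (intro coset_eq fr) auto
      then show "\<exists>x\<in>carrier P. K #>\<^bsub>F\<^esub> (t - u) = tau x" using zP by blast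
    next
      fix z assume "z \<in> ?S"
      then obtain x r where "z = (x, ?co r)" "x \<in> carrier P" "r \<in> carrier R"
        by (auto simp: J.quot_simps)
      then show "\<exists>x\<in>carrier P. K #>\<^bsub>F\<^esub> frag_of z = tau x" using rel_smult P.smult_closed by auto
    qed
  qed
  define T where "T = tensor_quotient R P J"
  define sg where "sg s = frag_extend (\<lambda>(x :: 'p, b). frag_of (x, b \<otimes>\<^bsub>?Q\<^esub> s))" for s
  have T: "carrier T = (\<lambda>t. K #>\<^bsub>F\<^esub> t) ` carrier F"
    "\<And>Y Z. Y \<oplus>\<^bsub>T\<^esub> Z = Y <#>\<^bsub>F\<^esub> Z"
    "\<And>s Y. s \<odot>\<^bsub>T\<^esub> Y = (\<Union>t\<in>Y. K #>\<^bsub>F\<^esub> sg s t)"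
    by (auto simp: T_def tensor_quotient_def tensor_product_def Let_def F_def[symmetric]
        Rel_def[symmetric] K_def[symmetric] FactGroup_def RCOSETS_def sg_def)
  have sgF: "sg s t \<in> carrier F" if "s \<in> carrier ?Q" "t \<in> carrier F" for s t
  proof -
    have "Poly_Mapping.keys (sg s t) \<subseteq> (\<Union>z\<in>Poly_Mapping.keys t. Poly_Mapping.keys ((\<lambda>(x, b). frag_of (x, b \<otimes>\<^bsub>?Q\<^esub> s)) z))"
      unfolding sg_def by (rule keys_frag_extend)
    also have "\<dots> \<subseteq> ?S" using that Q.m_closed by fastforce
    finally show ?thesis by simp
  qed
  have sg_diff: "sg s (t - u) = sg s t - sg s u" for s t u
    by (simp add: sg_def frag_extend_diff)
  have sg_of: "sg s (frag_of (x, b)) = frag_of (x, b \<otimes>\<^bsub>?Q\<^esub> s)" for s x b by (simp add: sg_def)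
  have sgK: "sg s t \<in> K" if s: "s \<in> carrier ?Q" and t: "t \<in> K" for s t
  proof -
    let ?H = "{t \<in> carrier F. sg s t \<in> K}"
    have "Rel \<subseteq> ?H"
    proof (rule Rel_subset)
      fix x y b assume *: "x \<in> carrier P" "y \<in> carrier P" "b \<in> carrier ?Q"
      then show "frag_of (x \<oplus>\<^bsub>P\<^esub> y, b) - frag_of (x, b) - frag_of (y, b) \<in> ?H"
        using RelF Rel_add_l[OF *] Rel_add_l[of x y "b \<otimes>\<^bsub>?Q\<^esub> s"] s
        by (auto simp: sg_diff sg_of RelK simp del: F_simps)
    next
      fix x b c assume *: "x \<in> carrier P" "b \<in> carrier ?Q" "c \<in> carrier ?Q"
      then show "frag_of (x, b \<oplus>\<^bsub>?Q\<^esub> c) - frag_of (x, b) - frag_of (x, c) \<in> ?H"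
        using RelF Rel_add_r[OF *] Rel_add_r[of x "b \<otimes>\<^bsub>?Q\<^esub> s" "c \<otimes>\<^bsub>?Q\<^esub> s"] s
        by (auto simp: sg_diff sg_of RelK Q.l_distr simp del: F_simps)
    next
      fix r x b assume *: "r \<in> carrier R" "x \<in> carrier P" "b \<in> carrier ?Q"
      then show "frag_of (r \<odot>\<^bsub>P\<^esub> x, b) - frag_of (x, ?l r b) \<in> ?H"
        using RelF Rel_smult[OF *] Rel_smult[of r x "b \<otimes>\<^bsub>?Q\<^esub> s"] s co
        by (auto simp: sg_diff sg_of RelK Q.m_assoc simp del: F_simps)
    qed
    moreover have "subgroup ?H F"
      by (rule subgroup_of_F) (use K_diff diffF sg_diff K.one_closed in \<open>auto simp: sg_def\<close>)
    ultimately have "K \<subseteq> ?H" unfolding K_def by (rule F.generate_subgroup_incl)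
    then show ?thesis using t by blast
  qed
  have coset_cases: "\<exists>k\<in>K. t' = k + t" if "t' \<in> K #>\<^bsub>F\<^esub> t" for t t'
    using that unfolding r_coset_def by auto
  have T_smult: "s \<odot>\<^bsub>T\<^esub> (K #>\<^bsub>F\<^esub> t) = K #>\<^bsub>F\<^esub> sg s t" if s: "s \<in> carrier ?Q" and t: "t \<in> carrier F" for s t
  proof -
    have "K #>\<^bsub>F\<^esub> sg s t' = K #>\<^bsub>F\<^esub> sg s t" if t': "t' \<in> K #>\<^bsub>F\<^esub> t" for t'
    proof -
      obtain k where k: "k \<in> K" "t' = k + t" using coset_cases[OF t'] by blast
      have "t' \<in> carrier F" using F.m_closed[of k t] K.mem_carrier[OF k(1)] t k by simp
      moreover have "sg s t' - sg s t \<in> K" using sgK[OF s k(1)] k(2) sg_diff[of s t' t] by simp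
      ultimately show ?thesis using sgF s t by (intro coset_eq) auto
    qed
    then show ?thesis using F.rcos_self[OF t K] unfolding T(3) by blast
  qed
  \<comment> \<open>As \<open>h\<close> vanishes on \<open>K\<close>, it is constant on cosets and
    the choice of the representative does not matter.\<close>
  define psi where "psi Y = h (SOME t. t \<in> Y)" for Y
  have psi: "psi (K #>\<^bsub>F\<^esub> t) = h t" if t: "t \<in> carrier F" for t
  proof -
    have "(SOME u. u \<in> K #>\<^bsub>F\<^esub> t) \<in> K #>\<^bsub>F\<^esub> t" using F.rcos_self[OF t K] by (rule someI)
    then obtain k where k: "k \<in> K" "(SOME u. u \<in> K #>\<^bsub>F\<^esub> t) = k + t" using coset_cases by blast
    have "h (k \<otimes>\<^bsub>F\<^esub> t) = h k \<oplus>\<^bsub>W\<^esub> h t"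
      using h K.mem_carrier[OF k(1)] t unfolding hom_def by auto
    then show ?thesis unfolding psi_def k(2) using hK[OF k(1)] h_closed[OF t] by simp
  qed
  have psi_tau: "psi (tau x) = th x" if "x \<in> carrier P" for x
    unfolding tau_def using that th by (simp add: psi fr h_of W.smult_one)
  have carT: "\<exists>x\<in>carrier P. Y = tau x" if "Y \<in> carrier T" for Y
    using that rep unfolding T(1) by blast
  have tauT: "tau x \<in> carrier T" if "x \<in> carrier P" for x
    unfolding T(1) tau_def using that fr by blast
  have tau_smult: "?co r \<odot>\<^bsub>T\<^esub> tau x = tau (r \<odot>\<^bsub>P\<^esub> x)" if "r \<in> carrier R" "x \<in> carrier P" for r x
  proof -
    have "?co r \<odot>\<^bsub>T\<^esub> tau x = K #>\<^bsub>F\<^esub> frag_of (x, \<one>\<^bsub>?Q\<^esub> \<otimes>\<^bsub>?Q\<^esub> ?co r)"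
      unfolding tau_def using that co fr by (simp add: T_smult sg_of)
    then show ?thesis using that co rel_smult by simp
  qed
  have tau_ideal: "tau x = K" if "x \<in> module_times_ideal P J" for x
  proof -
    let ?H = "{x \<in> carrier P. tau x = K}"
    have "subgroup ?H (add_monoid P)"
    proof (rule P.M.submoduleI_gen)
      show add: "x \<oplus>\<^bsub>P\<^esub> y \<in> ?H" if "x \<in> ?H" "y \<in> ?H" for x y
        using that by (auto simp: tau_add' F.subgroup_mult_id[OF K])
      fix x assume x: "x \<in> ?H"
      have "tau (\<ominus>\<^bsub>P\<^esub> x) = K <#>\<^bsub>F\<^esub> tau (\<ominus>\<^bsub>P\<^esub> x)"
      proof -
        have "tau (\<ominus>\<^bsub>P\<^esub> x) \<in> rcosets\<^bsub>F\<^esub> K" unfolding tau_def using x by (intro F.rcosetsI) (auto simp: K.subset)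
        then show ?thesis using KN.rcosets_mult_eq by simp
      qed
      also have "\<dots> = tau (x \<oplus>\<^bsub>P\<^esub> \<ominus>\<^bsub>P\<^esub> x)" using x by (subst tau_add') auto
      finally show "\<ominus>\<^bsub>P\<^esub> x \<in> ?H" using x by (simp add: P.M.r_neg tau_zero)
    qed (use tau_zero in auto)
    moreover have "{r \<odot>\<^bsub>P\<^esub> x | r x. r \<in> J \<and> x \<in> carrier P} \<subseteq> ?H"
    proof clarify
      fix r x assume r: "r \<in> J" and x: "x \<in> carrier P"
      have rR: "r \<in> carrier R" using r J.a_subset by blast
      \<comment> \<open>The cosets of \<open>r\<close> and of 0 coincide, so
        \<open>x r \<otimes> 1\<close> and \<open>x 0 \<otimes> 1\<close> are the same
        tensor.\<close>
      have "?co r = ?co \<zero>\<^bsub>R\<^esub>"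
        using r J.quot_eq_zero_iff[of r] J.quot_eq_zero_iff[of "\<zero>\<^bsub>R\<^esub>"] rR by (simp add: additive_subgroup.zero_closed[OF J.is_additive_subgroup])
      then have "tau (r \<odot>\<^bsub>P\<^esub> x) = tau (\<zero>\<^bsub>R\<^esub> \<odot>\<^bsub>P\<^esub> x)"
        using rel_smult[OF x rR] rel_smult[OF x, of "\<zero>\<^bsub>R\<^esub>"] by simp
      then show "r \<odot>\<^bsub>P\<^esub> x \<in> carrier P \<and> tau (r \<odot>\<^bsub>P\<^esub> x) = K"
        using rR x P.smult_closed by (simp add: P.zero_smult tau_zero)
    qed
    ultimately have "module_times_ideal P J \<subseteq> ?H"
      unfolding module_times_ideal_def by (intro group.generate_subgroup_incl[OF P.M.a_group])
    then show ?thesis using that by blast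
  qed
  have "psi \<in> module_hom ?Q T W"
  proof (rule module_homI)
    fix Y assume "Y \<in> carrier T"
    then obtain x where x: "x \<in> carrier P" "Y = tau x" using carT by blast
    then show "psi Y \<in> carrier W" using psi_tau th by simp
    { fix Z assume "Z \<in> carrier T"
      then obtain y where y: "y \<in> carrier P" "Z = tau y" using carT by blast
      then show "psi (Y \<oplus>\<^bsub>T\<^esub> Z) = psi Y \<oplus>\<^bsub>W\<^esub> psi Z"
        using x by (simp add: T(2) tau_add'[symmetric] psi_tau th_add) }
    fix s assume "s \<in> carrier ?Q"
    then obtain r where r: "r \<in> carrier R" "s = ?co r" by (auto simp: J.quot_simps)
    then show "psi (s \<odot>\<^bsub>T\<^esub> Y) = s \<odot>\<^bsub>W\<^esub> psi Y"
      using x P.smult_closed by (simp add: tau_smult psi_tau th_smult)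
  qed
  moreover have "bij_betw psi (carrier T) (carrier W)"
    unfolding bij_betw_def
  proof
    show "inj_on psi (carrier T)"
    proof (rule inj_onI)
      fix Y Z assume YZ: "Y \<in> carrier T" "Z \<in> carrier T" "psi Y = psi Z"
      then obtain x y where xy: "x \<in> carrier P" "Y = tau x" "y \<in> carrier P" "Z = tau y"
        using carT by blast
      have eq: "th x = th y" using YZ(3) xy psi_tau by simp
      let ?d = "x \<oplus>\<^bsub>P\<^esub> \<ominus>\<^bsub>P\<^esub> y"
      have dy: "?d \<oplus>\<^bsub>P\<^esub> y = x" using xy by (simp add: P.M.a_assoc P.M.l_neg)
      have "th ?d \<oplus>\<^bsub>W\<^esub> th y = th y"
        using dy eq xy th_add[of ?d y] by simp
      then have "th ?d = \<zero>\<^bsub>W\<^esub>"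
        using th xy by (metis P.M.a_closed P.M.a_inv_closed W.M.add.r_cancel_one)
      then have "tau ?d = K" using th_ker tau_ideal xy by simp
      then have "tau x = K <#>\<^bsub>F\<^esub> tau y" using tau_add'[of ?d y] dy xy by simp
      also have "\<dots> = tau y"
      proof -
        have "tau y \<in> rcosets\<^bsub>F\<^esub> K" unfolding tau_def using xy by (intro F.rcosetsI) (auto simp: K.subset)
        then show ?thesis using KN.rcosets_mult_eq by simp
      qed
      finally show "Y = Z" using xy by simp
    qed
    show "psi ` carrier T = carrier W"
    proof
      show "psi ` carrier T \<subseteq> carrier W" using carT psi_tau th by fastforce
      show "carrier W \<subseteq> psi ` carrier T" using th_surj psi_tau tauT by (metis imageI subsetI)
    qed
  qed
  ultimately show ?thesis unfolding module_iso_def T_def by blast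
qed

section \<open>Left ideals and semisimple artinian quotients\<close>

text \<open>For \<open>J\<close> the whole ring this is the left ideal generated by the
  \<open>w d\<close>. Coefficients restricted to a two-sided ideal are wanted for the matrices of
  the \<open>C\<^sub>t\<close>, whose row \<open>c\<close> has to lie in the ideal of the level of
  \<open>c\<close>.\<close>

definition left_span :: "('a, 'm) ring_scheme \<Rightarrow> 'a set \<Rightarrow> 'i set \<Rightarrow> ('i \<Rightarrow> 'a) \<Rightarrow> 'a set"
  where "left_span R J D w = {\<Oplus>\<^bsub>R\<^esub>d\<in>D. q d \<otimes>\<^bsub>R\<^esub> w d | q. q \<in> D \<rightarrow> J}"

lemma (in abelian_monoid) finsum_swap:
  assumes "finite A" "finite B" "\<And>i j. \<lbrakk>i \<in> A; j \<in> B\<rbrakk> \<Longrightarrow> f i j \<in> carrier G"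
  shows "(\<Oplus>i\<in>A. \<Oplus>j\<in>B. f i j) = (\<Oplus>j\<in>B. \<Oplus>i\<in>A. f i j)"
  using assms(1,3)
proof (induction A rule: finite_induct)
  case (insert x F)
  have "(\<Oplus>i\<in>insert x F. \<Oplus>j\<in>B. f i j) = (\<Oplus>j\<in>B. f x j) \<oplus> (\<Oplus>j\<in>B. \<Oplus>i\<in>F. f i j)"
    using insert by (subst finsum_insert) (auto intro!: finsum_closed)
  also have "\<dots> = (\<Oplus>j\<in>B. f x j \<oplus> (\<Oplus>i\<in>F. f i j))"
    using insert by (intro finsum_addf[symmetric]) (auto intro!: finsum_closed)
  also have "\<dots> = (\<Oplus>j\<in>B. \<Oplus>i\<in>insert x F. f i j)"
    using insert by (intro finsum_cong') (auto intro!: finsum_closed)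
  finally show ?case .
qed (simp add: finsum_zero)

context ring
begin

lemma left_span_zero:
  assumes "ideal J R" "w \<in> D \<rightarrow> carrier R" shows "\<zero> \<in> left_span R J D w"
proof -
  interpret J: ideal J R by fact
  have "(\<Oplus>d\<in>D. \<zero> \<otimes> w d) = (\<Oplus>d\<in>D. \<zero>)" using assms(2) by (intro finsum_cong') (auto simp: Pi_iff)
  then have "\<zero> = (\<Oplus>d\<in>D. \<zero> \<otimes> w d)" by (simp add: finsum_zero)
  then show ?thesis unfolding left_span_def by (auto intro!: exI[of _ "\<lambda>_. \<zero>"])
qed

lemma left_span_add:
  assumes "ideal J R" "w \<in> D \<rightarrow> carrier R" "x \<in> left_span R J D w" "y \<in> left_span R J D w"
  shows "x \<oplus> y \<in> left_span R J D w"
proof -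
  interpret J: ideal J R by fact
  obtain p q where p: "p \<in> D \<rightarrow> J" "x = (\<Oplus>d\<in>D. p d \<otimes> w d)"
    and q: "q \<in> D \<rightarrow> J" "y = (\<Oplus>d\<in>D. q d \<otimes> w d)"
    using assms(3,4) unfolding left_span_def by auto
  have pq: "p d \<in> carrier R" "q d \<in> carrier R" "w d \<in> carrier R" if "d \<in> D" for d
    using p(1) q(1) assms(2) that J.a_subset by auto
  have "(\<Oplus>d\<in>D. (p d \<oplus> q d) \<otimes> w d) = (\<Oplus>d\<in>D. p d \<otimes> w d \<oplus> q d \<otimes> w d)"
    using pq by (intro finsum_cong') (auto simp: l_distr)
  also have "\<dots> = x \<oplus> y" unfolding p(2) q(2) using pq by (intro finsum_addf) auto
  finally show ?thesis unfolding left_span_def using p(1) q(1)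
    by (auto intro!: exI[of _ "\<lambda>d. p d \<oplus> q d"])
qed

lemma left_span_mult:
  assumes "ideal J R" "w \<in> D \<rightarrow> carrier R" "x \<in> J" "y \<in> left_span R (carrier R) D w"
  shows "x \<otimes> y \<in> left_span R J D w"
proof -
  interpret J: ideal J R by fact
  obtain q where q: "q \<in> D \<rightarrow> carrier R" "y = (\<Oplus>d\<in>D. q d \<otimes> w d)"
    using assms(4) unfolding left_span_def by auto
  have c: "q d \<in> carrier R" "w d \<in> carrier R" if "d \<in> D" for d using q(1) assms(2) that by auto
  have x: "x \<in> carrier R" using assms(3) J.a_subset by auto
  have "x \<otimes> y = (\<Oplus>d\<in>D. x \<otimes> (q d \<otimes> w d))"
  proof (cases "finite D")
    case True then show ?thesis unfolding q(2) using c x by (intro finsum_rdistr) auto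
  next
    case False then show ?thesis unfolding q(2) using x by simp
  qed
  also have "\<dots> = (\<Oplus>d\<in>D. (x \<otimes> q d) \<otimes> w d)" using c x by (intro finsum_cong') (auto simp: m_assoc)
  finally show ?thesis unfolding left_span_def using c assms(3)
    by (auto intro!: exI[of _ "\<lambda>d. x \<otimes> q d"] J.I_r_closed)
qed

lemma left_span_incl:
  assumes "ideal J R" "w \<in> D \<rightarrow> carrier R" "finite D" "d \<in> D" "x \<in> J"
  shows "x \<otimes> w d \<in> left_span R J D w"
proof -
  interpret J: ideal J R by fact
  have x: "x \<in> carrier R" using assms J.a_subset by auto
  have "(\<Oplus>c\<in>D. (if d = c then x else \<zero>) \<otimes> w c) = (\<Oplus>c\<in>D. if d = c then x \<otimes> w c else \<zero>)"
    using x assms(2,4) by (intro finsum_cong') (auto simp: Pi_iff)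
  also have "\<dots> = x \<otimes> w d" using x assms by (intro finsum_singleton) auto
  finally show ?thesis unfolding left_span_def using assms
    by (auto intro!: exI[of _ "\<lambda>c. if d = c then x else \<zero>"])
qed

lemma left_ideal_submoduleI:
  assumes "L \<subseteq> carrier R" "\<zero> \<in> L" "\<And>x y. \<lbrakk>x \<in> L; y \<in> L\<rbrakk> \<Longrightarrow> x \<oplus> y \<in> L"
    "\<And>r x. \<lbrakk>r \<in> carrier R; x \<in> L\<rbrakk> \<Longrightarrow> r \<otimes> x \<in> L"
  shows "submodule L R (regular_left R)"
proof -
  have "\<ominus> x \<in> L" if "x \<in> L" for x
  proof -
    have "x \<in> carrier R" using that assms(1) by auto
    then have "\<ominus> x = \<ominus> \<one> \<otimes> x" by (simp add: l_minus)
    then show ?thesis using assms(4)[of "\<ominus> \<one>" x] that by simp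
  qed
  then have "subgroup L (add_monoid R)"
    using assms by (intro submoduleI_gen) auto
  then have "subgroup L (add_monoid (regular_left R))"
    by (simp add: subgroup_def m_inv_def)
  then show ?thesis using assms(4) by (simp add: submodule_def submodule_axioms_def)
qed

text \<open>Finite generation concerns submodules of \<open>I\<close>; for a left ideal
  \<open>L\<close> of \<open>R\<close> it is applied to \<open>L \<inter> I\<close>. The result is
  phrased so that inclusions of \<open>I\<close> in a left ideal can be tested on
  \<open>Y\<close>.\<close>

lemma fg_left_ideal_generators:
  assumes "ideal I R" and fg: "finitely_generated R (restrict_module (regular_left R) I)"
  shows "\<exists>Y. finite Y \<and> Y \<subseteq> I \<and> (\<forall>L. submodule L R (regular_left R) \<and> Y \<subseteq> L \<longrightarrow> I \<subseteq> L)"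
proof -
  interpret I: ideal I R by fact
  let ?M = "restrict_module (regular_left R) I"
  obtain Y where Y: "finite Y" "Y \<subseteq> I" "module_span R ?M Y = I"
    using fg unfolding finitely_generated_def by auto
  have "I \<subseteq> L" if L: "submodule L R (regular_left R)" "Y \<subseteq> L" for L
  proof -
    interpret L: submodule L R "regular_left R" by (rule L(1))
    have "subgroup L (add_monoid R)"
      using submodule.axioms(1)[OF L(1)] by (simp add: subgroup_def m_inv_def)
    then have "subgroup (L \<inter> I) (add_monoid R)"
      using add.subgroups_Inter_pair I.a_subgroup by blast
    then have "subgroup (L \<inter> I) ((add_monoid R)\<lparr>carrier := I\<rparr>)"
      by (rule group.subgroup_incl[OF a_group]) (auto intro: I.a_subgroup)
    then have "subgroup (L \<inter> I) (add_monoid ?M)"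
      by (simp add: subgroup_def m_inv_def)
    then have "submodule (L \<inter> I) R ?M"
      using L.smult_closed I.I_l_closed by (auto simp: submodule_def submodule_axioms_def)
    then have "module_span R ?M Y \<subseteq> L \<inter> I"
      unfolding module_span_def using Y(2) L(2) by blast
    then show ?thesis using Y(3) by blast
  qed
  then show ?thesis using Y(1,2) by blast
qed

text \<open>A direct complement of a two-sided ideal provides a left identity; it is also a right identity
  because a semisimple ring has no nonzero nilpotent right ideals.\<close>

lemma semisimple_ideal_identity:
  assumes ss: "semisimple_module R (regular_right R)" and "ideal A R"
  obtains e where "e \<in> A" "\<And>x. x \<in> A \<Longrightarrow> e \<otimes> x = x" "\<And>x. x \<in> A \<Longrightarrow> x \<otimes> e = x"
proof -
  interpret A: ideal A R by fact
  interpret M: right_module R "regular_right R" by (rule regular_right_module)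
  have split: "\<exists>N'. submodule N' R (regular_right R) \<and> N \<inter> N' = {\<zero>} \<and>
      (\<exists>e f. e \<in> N \<and> f \<in> N' \<and> \<one> = e \<oplus> f)" if N: "submodule N R (regular_right R)" for N
  proof -
    obtain N' where N': "submodule N' R (regular_right R)" "N \<inter> N' = {\<zero>}"
      "N <+>\<^bsub>regular_right R\<^esub> N' = carrier R"
      using ss N unfolding semisimple_module_def direct_summand_def by auto
    have "\<one> \<in> N <+>\<^bsub>regular_right R\<^esub> N'" using N'(3) by simp
    then show ?thesis using N'(1,2) by (auto simp: set_add_def')
  qed
  have subm: "r \<oplus> s \<in> N" "r \<otimes> t \<in> N" "r \<in> carrier R"
    if "submodule N R (regular_right R)" "r \<in> N" "s \<in> N" "t \<in> carrier R" for N r s t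
    using submodule.axioms(1)[OF that(1), THEN subgroup.m_closed, of r s]
      submodule.smult_closed[OF that(1), of t r]
      submodule.axioms(1)[OF that(1), THEN subgroup.subset] that by auto
  have neg: "\<ominus> r \<in> N" if "submodule N R (regular_right R)" "r \<in> N" for N r
    using subm(2,3)[OF that that(2), of "\<ominus> \<one>"] by (simp add: r_minus)
  have "submodule A R (regular_right R)"
    by (rule M.submoduleI) (auto simp: A.a_subset additive_subgroup.zero_closed[OF A.is_additive_subgroup]
        additive_subgroup.a_closed[OF A.is_additive_subgroup] A.I_r_closed)
  from split[OF this] obtain N e f where N: "submodule N R (regular_right R)" "A \<inter> N = {\<zero>}"
    "e \<in> A" "f \<in> N" "\<one> = e \<oplus> f" by blast
  note eR = A.Icarr[OF N(3)] and fR = subm(3)[OF N(1) N(4) N(4) one_closed]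
  have e: "e \<otimes> x = x \<and> f \<otimes> x = \<zero>" if x: "x \<in> A" for x
  proof -
    have xR: "x \<in> carrier R" by (rule A.Icarr[OF x])
    have s: "x = e \<otimes> x \<oplus> f \<otimes> x" using N(5) xR eR fR by (metis l_distr l_one)
    have fx: "f \<otimes> x \<in> A \<inter> N" using subm(2)[OF N(1) N(4) N(4) xR] A.I_l_closed[OF x fR] by simp
    then have "f \<otimes> x = \<zero>" using N(2) by blast
    then show ?thesis using s xR eR by simp
  qed
  have "x \<otimes> e = x" if x: "x \<in> A" for x
  proof -
    have xR: "x \<in> carrier R" by (rule A.Icarr[OF x])
    \<comment> \<open>Since \<open>x = x e + x f\<close>, this element is the obstruction to
      \<open>e\<close> being a right identity. It satisfies \<open>y R y = 0\<close>, because
      \<open>f\<close> annihilates \<open>A\<close> from the left.\<close>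
    let ?y = "x \<otimes> f"
    have yR: "?y \<in> carrier R" using xR fR by simp
    have nil: "?y \<otimes> r \<otimes> ?y = \<zero>" if r: "r \<in> carrier R" for r
    proof -
      have "r \<otimes> ?y \<in> A" using A.I_l_closed[OF A.I_r_closed[OF x fR] r] .
      then have "f \<otimes> (r \<otimes> ?y) = \<zero>" using e by blast
      moreover have "?y \<otimes> r \<otimes> ?y = x \<otimes> (f \<otimes> (r \<otimes> ?y))" using xR fR r by (simp add: m_assoc)
      ultimately show ?thesis using xR by simp
    qed
    let ?H = "{?y \<otimes> r | r. r \<in> carrier R}"
    have "submodule ?H R (regular_right R)"
    proof (rule M.submoduleI)
      show "\<zero>\<^bsub>regular_right R\<^esub> \<in> ?H" using yR by (auto intro!: exI[of _ \<zero>])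
      show "u \<oplus>\<^bsub>regular_right R\<^esub> v \<in> ?H" if "u \<in> ?H" "v \<in> ?H" for u v
        using that yR by clarsimp (metis add.m_closed r_distr)
      show "r \<odot>\<^bsub>regular_right R\<^esub> u \<in> ?H" if "r \<in> carrier R" "u \<in> ?H" for r u
        using that yR by clarsimp (metis m_assoc m_closed)
    qed (use yR in auto)
    from split[OF this] obtain H' h h' where H': "submodule H' R (regular_right R)" "?H \<inter> H' = {\<zero>}"
      "h \<in> ?H" "h' \<in> H'" "\<one> = h \<oplus> h'" by blast
    then obtain r where r: "r \<in> carrier R" "h = ?y \<otimes> r" by blast
    have h'R: "h' \<in> carrier R" using subm(3)[OF H'(1) H'(4) H'(4) one_closed] .
    \<comment> \<open>Multiplying \<open>1 = h + h'\<close> by \<open>y\<close> gives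
      \<open>y = h' y\<close>, an element of both \<open>y R\<close> and its complement.\<close>
    have "h \<otimes> ?y = \<zero>" using nil r by simp
    then have "?y = h' \<otimes> ?y"
      using H'(5) yR h'R r by (metis l_distr l_one l_zero m_closed)
    then have "?y \<in> ?H \<inter> H'"
      using subm(2)[OF H'(1) H'(4) H'(4) yR] yR by (auto intro!: exI[of _ \<one>])
    then have "?y = \<zero>" using H'(2) by blast
    then show ?thesis using N(5) xR eR fR by (metis r_distr r_one r_zero m_closed)
  qed
  then show ?thesis using that N(3) e by blast
qed

text \<open>The ideal \<open>I/J\<close> of the semisimple ring \<open>R/J\<close> has an identity
  element, and \<open>e\<close> is a preimage of it in \<open>I\<close>.\<close>

lemma quotient_semisimple_identity:
  assumes I: "ideal I R" and J: "ideal J R" and JI: "J \<subseteq> I" and ss: "semisimple_artinian (R Quot J)"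
  obtains e where "e \<in> I" "\<And>x. x \<in> I \<Longrightarrow> e \<otimes> x \<ominus> x \<in> J" "\<And>x. x \<in> I \<Longrightarrow> x \<otimes> e \<ominus> x \<in> J"
proof -
  interpret I: ideal I R by fact
  interpret J: ideal J R by fact
  interpret Q: ring "R Quot J" by (rule J.quotient_is_ring)
  have IQ: "ideal ((\<lambda>x. J +> x) ` I) (R Quot J)"
    using ring_ideal_imp_quot_ideal[OF J I] by simp
  obtain e where e: "e \<in> (\<lambda>x. J +> x) ` I"
    "\<And>x. x \<in> (\<lambda>x. J +> x) ` I \<Longrightarrow> e \<otimes>\<^bsub>R Quot J\<^esub> x = x"
    "\<And>x. x \<in> (\<lambda>x. J +> x) ` I \<Longrightarrow> x \<otimes>\<^bsub>R Quot J\<^esub> e = x"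
    using Q.semisimple_ideal_identity[OF _ IQ] ss unfolding semisimple_artinian_def by metis
  then obtain e0 where e0: "e0 \<in> I" "e = J +> e0" by blast
  have "e0 \<otimes> x \<ominus> x \<in> J \<and> x \<otimes> e0 \<ominus> x \<in> J" if "x \<in> I" for x
    using e(2,3)[of "J +> x"] that e0 I.Icarr
    by (simp add: J.quot_simps J.quot_eq_iff[symmetric])
  then show ?thesis using that e0(1) by blast
qed

section \<open>The rank condition over right artinian rings\<close>

text \<open>Finite powers of an artinian module are artinian, by comparison of last nonzero
  coordinates. The \<open>N t\<close> are submodules of the \<open>n\<close>-th power, written as
  sequences vanishing from \<open>n\<close> on. A single repetition in the chain is enough for the
  argument with an injective endomorphism.\<close>

lemma artinian_power:
  fixes N :: "nat \<Rightarrow> (nat \<Rightarrow> 'a) set"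
  assumes art: "artinian_module R (regular_right R)"
    and N: "\<And>t v i. v \<in> N t \<Longrightarrow> v i \<in> carrier R" "\<And>t v i. \<lbrakk>v \<in> N t; n \<le> i\<rbrakk> \<Longrightarrow> v i = \<zero>"
    and zero: "\<And>t. (\<lambda>_. \<zero>) \<in> N t"
    and add: "\<And>t u v. \<lbrakk>u \<in> N t; v \<in> N t\<rbrakk> \<Longrightarrow> (\<lambda>i. u i \<oplus> v i) \<in> N t"
    and smult: "\<And>t v r. \<lbrakk>v \<in> N t; r \<in> carrier R\<rbrakk> \<Longrightarrow> (\<lambda>i. v i \<otimes> r) \<in> N t"
    and dec: "\<And>t. N (Suc t) \<subseteq> N t"
  obtains T where "N (Suc T) = N T"
proof -
  interpret M: right_module R "regular_right R" by (rule regular_right_module)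
  define L where "L j t = {v j | v. v \<in> N t \<and> (\<forall>i>j. v i = \<zero>)}" for j :: nat and t :: nat
  have "\<exists>T. \<forall>t\<ge>T. L j t = L j T" for j
  proof -
    have "submodule (L j t) R (regular_right R)" for t
    proof (rule M.submoduleI)
      show "L j t \<subseteq> carrier (regular_right R)" using N(1) by (auto simp: L_def)
      show "\<zero>\<^bsub>regular_right R\<^esub> \<in> L j t" using zero by (auto simp: L_def intro!: exI[of _ "\<lambda>_. \<zero>"])
      show "x \<oplus>\<^bsub>regular_right R\<^esub> y \<in> L j t" if "x \<in> L j t" "y \<in> L j t" for x y
      proof -
        obtain u v where "x = u j" "y = v j" "u \<in> N t" "v \<in> N t" "\<forall>i>j. u i = \<zero>" "\<forall>i>j. v i = \<zero>"
          using \<open>x \<in> L j t\<close> \<open>y \<in> L j t\<close> by (auto simp: L_def)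
        then show ?thesis using add[of u t v] by (auto simp: L_def intro!: exI[of _ "\<lambda>i. u i \<oplus> v i"])
      qed
      show "r \<odot>\<^bsub>regular_right R\<^esub> x \<in> L j t" if "r \<in> carrier R" "x \<in> L j t" for r x
      proof -
        obtain u where "x = u j" "u \<in> N t" "\<forall>i>j. u i = \<zero>"
          using \<open>x \<in> L j t\<close> by (auto simp: L_def)
        then show ?thesis using smult[of u t r] \<open>r \<in> carrier R\<close>
          by (auto simp: L_def intro!: exI[of _ "\<lambda>i. u i \<otimes> r"])
      qed
    qed
    moreover have "L j (Suc t) \<subseteq> L j t" for t using dec by (auto simp: L_def)
    ultimately show ?thesis using art unfolding artinian_module_def by blast
  qed
  then obtain T0 where T0: "\<And>j t. t \<ge> T0 j \<Longrightarrow> L j t = L j (T0 j)" by metis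
  \<comment> \<open>From here on, the chains \<open>L j\<close> with \<open>j < n\<close> are all
    constant.\<close>
  define T where "T = Max (T0 ` {..<Suc n})"
  have T: "T0 j \<le> T" if "j < n" for j unfolding T_def using that by (intro Max_ge) auto
  have "v \<in> N (Suc T)" if "v \<in> N T" "\<forall>i\<ge>j. v i = \<zero>" "j \<le> n" for v j
    using that
  proof (induction j arbitrary: v)
    case 0
    then have "v = (\<lambda>_. \<zero>)" by auto
    then show ?case using zero by simp
  next
    case (Suc j)
    have "v j \<in> L j T" using Suc.prems by (auto simp: L_def Suc_le_eq)
    also have "L j T = L j (Suc T)" using T[of j] T0[of j T] T0[of j "Suc T"] Suc.prems(3) by auto
    finally obtain w where w: "v j = w j" "w \<in> N (Suc T)" "\<forall>i>j. w i = \<zero>" by (auto simp: L_def)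
    \<comment> \<open>Subtracting \<open>w\<close> clears coordinate \<open>j\<close> of
      \<open>v\<close>, so the induction hypothesis applies to \<open>v - w\<close>.\<close>
    define m where "m = (\<lambda>i. w i \<otimes> \<ominus> \<one>)"
    have m: "m \<in> N (Suc T)" unfolding m_def using w(2) by (intro smult) auto
    have wR: "w i \<in> carrier R" and vR: "v i \<in> carrier R" for i using N(1) w(2) Suc.prems(1) by auto
    have mi: "m i = \<ominus> w i" for i unfolding m_def using wR by (simp add: r_minus)
    have "(\<lambda>i. v i \<oplus> m i) \<in> N (Suc T)"
    proof (rule Suc.IH)
      show "(\<lambda>i. v i \<oplus> m i) \<in> N T" using m dec Suc.prems(1) by (intro add) auto
      show "\<forall>i\<ge>j. v i \<oplus> m i = \<zero>"
      proof (intro allI impI)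
        fix i assume "j \<le> i"
        then consider "i = j" | "j < i" by linarith
        then show "v i \<oplus> m i = \<zero>"
          by cases (use w Suc.prems(2) wR vR in \<open>auto simp: mi r_neg Suc_le_eq\<close>)
      qed
    qed (use Suc.prems in auto)
    from add[OF this w(2)] have "(\<lambda>i. v i \<oplus> m i \<oplus> w i) \<in> N (Suc T)" .
    moreover have "(\<lambda>i. v i \<oplus> m i \<oplus> w i) = v" using wR vR by (auto simp: mi a_assoc l_neg)
    ultimately show ?case by simp
  qed
  from this[of _ n] have "N T \<subseteq> N (Suc T)" using N(2) by auto
  then show ?thesis using that dec by blast
qed

text \<open>If \<open>m < n\<close>, then \<open>v \<mapsto> B v\<close> would be an injective and non-surjective
  endomorphism of \<open>A\<^sup>n\<close>.\<close>

lemma artinian_rank_condition: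
  fixes m n :: nat
  assumes art: "artinian_module R (regular_right R)" and A: "ideal A R"
    and e: "e \<in> A" "\<And>x. x \<in> A \<Longrightarrow> e \<otimes> x = x"
    and C: "\<And>c i. C c i \<in> carrier R" and B: "\<And>i c. B i c \<in> carrier R"
    and CB: "\<And>c c'. \<lbrakk>c < n; c' < n\<rbrakk> \<Longrightarrow> (\<Oplus>i\<in>{..<m}. C c i \<otimes> B i c') = (if c = c' then e else \<zero>)"
    and mn: "m < n"
  shows "e = \<zero>"
proof -
  interpret A: ideal A R by fact
  note A0 = additive_subgroup.zero_closed[OF A.is_additive_subgroup]
  note Aa = additive_subgroup.a_closed[OF A.is_additive_subgroup]
  define V where "V = {v. (\<forall>c. v c \<in> A) \<and> (\<forall>c\<ge>n. v c = \<zero>)}"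
  \<comment> \<open>The vector \<open>B v\<close> has length \<open>m\<close>; it is padded with
    zeros to length \<open>n\<close>, which makes \<open>U\<close> an endomorphism of
    \<open>V\<close>.\<close>
  define U where "U v i = (if i < m then \<Oplus>c\<in>{..<n}. B i c \<otimes> v c else \<zero>)" for v i
  have AR: "x \<in> carrier R" if "x \<in> A" for x using that A.Icarr by auto
  have sumA: "(\<Oplus>c\<in>S. f c) \<in> A" if "\<And>c. c \<in> S \<Longrightarrow> f c \<in> A" for S :: "nat set" and f
    by (rule finsum_in_subgroup[OF A.a_subgroup that])
  have UV: "U v \<in> V" if "v \<in> V" for v
    using that mn A0 A.I_l_closed B by (auto simp: U_def V_def intro!: sumA)
  have inj: "u = v" if u: "u \<in> V" and v: "v \<in> V" and eq: "U u = U v" for u v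
  proof -
    \<comment> \<open>\<open>C B w = e w = w\<close>, because the coordinates of \<open>w\<close>
      lie in \<open>A\<close>; so \<open>w\<close> is recovered from \<open>U w\<close>.\<close>
    have rec: "w c = (\<Oplus>i\<in>{..<m}. C c i \<otimes> U w i)" if w: "w \<in> V" and c: "c < n" for w c
    proof -
      have wA: "w c' \<in> A" and wR: "w c' \<in> carrier R" for c' using w AR by (auto simp: V_def)
      have "(\<Oplus>i\<in>{..<m}. C c i \<otimes> U w i) = (\<Oplus>i\<in>{..<m}. \<Oplus>c'\<in>{..<n}. C c i \<otimes> B i c' \<otimes> w c')"
        using C B wR by (intro finsum_cong') (auto simp: U_def finsum_rdistr m_assoc)
      also have "\<dots> = (\<Oplus>c'\<in>{..<n}. \<Oplus>i\<in>{..<m}. C c i \<otimes> B i c' \<otimes> w c')"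
        using C B wR by (intro finsum_swap) auto
      also have "\<dots> = (\<Oplus>c'\<in>{..<n}. if c = c' then w c' else \<zero>)"
      proof (intro finsum_cong')
        fix c' assume c': "c' \<in> {..<n}"
        have "(\<Oplus>i\<in>{..<m}. C c i \<otimes> B i c' \<otimes> w c') = (\<Oplus>i\<in>{..<m}. C c i \<otimes> B i c') \<otimes> w c'"
          using C B wR by (intro finsum_ldistr[symmetric]) auto
        then show "(\<Oplus>i\<in>{..<m}. C c i \<otimes> B i c' \<otimes> w c') = (if c = c' then w c' else \<zero>)"
          using CB[OF c, of c'] c' e(2)[OF wA] wR by auto
      qed (use wR in auto)
      also have "\<dots> = w c" using c wR by (intro finsum_singleton) auto
      finally show ?thesis by simp
    qed
    show "u = v"
    proof
      fix c show "u c = v c"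
        using rec[OF u, of c] rec[OF v, of c] eq u v by (cases "c < n") (auto simp: V_def)
    qed
  qed
  define N where "N t = (U ^^ t) ` V" for t
  have itV: "(U ^^ t) v \<in> V" if "v \<in> V" for t v using that UV by (induction t) auto
  have U_add: "U (\<lambda>i. u i \<oplus> v i) = (\<lambda>i. U u i \<oplus> U v i)" if "u \<in> V" "v \<in> V" for u v
  proof
    fix i
    have R: "u c \<in> carrier R" "v c \<in> carrier R" for c using that AR by (auto simp: V_def)
    have "(\<Oplus>c\<in>{..<n}. B i c \<otimes> (u c \<oplus> v c)) = (\<Oplus>c\<in>{..<n}. B i c \<otimes> u c \<oplus> B i c \<otimes> v c)"
      using R B by (intro finsum_cong') (auto simp: r_distr)
    also have "\<dots> = (\<Oplus>c\<in>{..<n}. B i c \<otimes> u c) \<oplus> (\<Oplus>c\<in>{..<n}. B i c \<otimes> v c)"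
      using R B by (intro finsum_addf) auto
    finally show "U (\<lambda>i. u i \<oplus> v i) i = U u i \<oplus> U v i" by (simp add: U_def)
  qed
  have U_smult: "U (\<lambda>i. v i \<otimes> r) = (\<lambda>i. U v i \<otimes> r)" if "v \<in> V" "r \<in> carrier R" for v r
  proof
    fix i
    have R: "v c \<in> carrier R" for c using that AR by (auto simp: V_def)
    have "(\<Oplus>c\<in>{..<n}. B i c \<otimes> (v c \<otimes> r)) = (\<Oplus>c\<in>{..<n}. B i c \<otimes> v c \<otimes> r)"
      using R B that by (intro finsum_cong') (auto simp: m_assoc)
    also have "\<dots> = (\<Oplus>c\<in>{..<n}. B i c \<otimes> v c) \<otimes> r"
      using R B that by (intro finsum_ldistr[symmetric]) auto
    finally show "U (\<lambda>i. v i \<otimes> r) i = U v i \<otimes> r" using that by (simp add: U_def)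
  qed
  have V_add: "(\<lambda>i. u i \<oplus> v i) \<in> V" if "u \<in> V" "v \<in> V" for u v using that Aa by (auto simp: V_def)
  have V_smult: "(\<lambda>i. v i \<otimes> r) \<in> V" if "v \<in> V" "r \<in> carrier R" for v r
    using that A.I_r_closed by (auto simp: V_def)
  have it_add: "(U ^^ t) (\<lambda>i. u i \<oplus> v i) = (\<lambda>i. (U ^^ t) u i \<oplus> (U ^^ t) v i)" if "u \<in> V" "v \<in> V" for u v t
    by (induction t) (simp_all add: U_add itV that)
  have it_smult: "(U ^^ t) (\<lambda>i. v i \<otimes> r) = (\<lambda>i. (U ^^ t) v i \<otimes> r)" if "v \<in> V" "r \<in> carrier R" for v r t
    by (induction t) (simp_all add: U_smult itV that)
  have V0: "(\<lambda>_. \<zero>) \<in> V" using A0 by (auto simp: V_def)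
  have it0: "(U ^^ t) (\<lambda>_. \<zero>) = (\<lambda>_. \<zero>)" for t
    using it_smult[OF V0 zero_closed, of t] itV[OF V0, of t] AR by (auto simp: V_def)
  obtain T where T: "N (Suc T) = N T"
  proof (rule artinian_power[OF art, of N n])
    show "N (Suc t) \<subseteq> N t" for t
      using UV by (auto simp: N_def funpow_Suc_right simp del: funpow.simps)
    show "(\<lambda>_. \<zero>) \<in> N t" for t unfolding N_def using it0[of t] V0 by (metis imageI)
    show "(\<lambda>i. u i \<oplus> v i) \<in> N t" if "u \<in> N t" "v \<in> N t" for t u v
      using that it_add[symmetric] V_add unfolding N_def by auto
    show "(\<lambda>i. v i \<otimes> r) \<in> N t" if "v \<in> N t" "r \<in> carrier R" for t v r
      using that it_smult[symmetric] V_smult unfolding N_def by auto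
    have NV: "N t \<subseteq> V" for t using itV by (auto simp: N_def)
    show "v i \<in> carrier R" if "v \<in> N t" for t v i using that NV[of t] AR by (auto simp: V_def)
    show "v i = \<zero>" if "v \<in> N t" "n \<le> i" for t v i using that NV[of t] by (auto simp: V_def)
  qed
  have it_inj: "u = v" if "u \<in> V" "v \<in> V" "(U ^^ t) u = (U ^^ t) v" for u v t
    using that(3)
  proof (induction t)
    case (Suc t)
    then have "U ((U ^^ t) u) = U ((U ^^ t) v)" by simp
    then show ?case using inj itV that Suc.IH by blast
  qed simp
  \<comment> \<open>Coordinate \<open>n - 1\<close> of a value of \<open>U\<close> is part of the
    padding, as \<open>m \<le> n - 1\<close>. Once \<open>w\<close> is such a value,
    \<open>e = 0\<close> follows.\<close>
  define w where "w c = (if c = n - 1 then e else \<zero>)" for c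
  have wV: "w \<in> V" using e(1) A0 mn by (auto simp: V_def w_def)
  then have "(U ^^ T) w \<in> N (Suc T)" unfolding T by (auto simp: N_def)
  then obtain v where v: "v \<in> V" "(U ^^ T) w = (U ^^ T) (U v)"
    by (auto simp: N_def funpow_Suc_right simp del: funpow.simps)
  then have "w = U v" using it_inj wV UV by blast
  then have "w (n - 1) = U v (n - 1)" by simp
  then show ?thesis using mn by (simp add: w_def U_def)
qed

lemma (in ideal) quot_finsum:
  assumes "f \<in> S \<rightarrow> carrier R"
  shows "I +> (\<Oplus>i\<in>S. f i) = (\<Oplus>\<^bsub>R Quot I\<^esub>i\<in>S. I +> f i)"
  using assms
proof (induction S rule: infinite_finite_induct)
  interpret Q: ring "R Quot I" by (rule quotient_is_ring)
  { case (infinite A) then show ?case using quot_eq_zero_iff[OF zero_closed]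
      by (simp add: quot_simps) }
  { case empty then show ?case using quot_eq_zero_iff[OF zero_closed]
      by (simp add: quot_simps) }
  case (insert x F)
  then have "I +> (\<Oplus>i\<in>insert x F. f i) = I +> (f x \<oplus> (\<Oplus>i\<in>F. f i))"
    by (subst finsum_insert) auto
  also have "\<dots> = (I +> f x) \<oplus>\<^bsub>R Quot I\<^esub> (I +> (\<Oplus>i\<in>F. f i))"
    using insert by (intro quot_simps(4)[symmetric]) auto
  also have "\<dots> = (\<Oplus>\<^bsub>R Quot I\<^esub>i\<in>insert x F. I +> f i)"
    using insert by (subst Q.finsum_insert) (auto simp: quot_simps)
  finally show ?case .
qed

text \<open>The rank condition read in \<open>R/J\<close> for the ideal \<open>I/J\<close>;
  formulating it by congruences spares its users the cosets.\<close>

lemma quotient_rank_condition: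
  fixes m n :: nat
  assumes I: "ideal I R" and J: "ideal J R" and JI: "J \<subseteq> I"
    and art: "artinian_module (R Quot J) (regular_right (R Quot J))"
    and e: "e \<in> I" "\<And>x. x \<in> I \<Longrightarrow> e \<otimes> x \<ominus> x \<in> J"
    and C: "\<And>c i. C c i \<in> carrier R" and B: "\<And>i c. B i c \<in> carrier R"
    and CB: "\<And>c c'. \<lbrakk>c < n; c' < n\<rbrakk>
      \<Longrightarrow> (\<Oplus>i\<in>{..<m}. C c i \<otimes> B i c') \<ominus> (if c = c' then e else \<zero>) \<in> J"
    and mn: "m < n"
  shows "e \<in> J"
proof -
  interpret I: ideal I R by fact
  interpret J: ideal J R by fact
  interpret Q: ring "R Quot J" by (rule J.quotient_is_ring)
  have IQ: "ideal ((\<lambda>x. J +> x) ` I) (R Quot J)"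
    using ring_ideal_imp_quot_ideal[OF J I] by simp
  have eR: "e \<in> carrier R" using e(1) I.Icarr by auto
  have "J +> e = \<zero>\<^bsub>R Quot J\<^esub>"
  proof (rule Q.artinian_rank_condition[OF art IQ, where C = "\<lambda>c i. J +> C c i" and B = "\<lambda>i c. J +> B i c"])
    show "J +> e \<in> (\<lambda>x. J +> x) ` I" using e(1) by auto
    show "(J +> e) \<otimes>\<^bsub>R Quot J\<^esub> x = x" if x: "x \<in> (\<lambda>x. J +> x) ` I" for x
    proof -
      obtain y where y: "y \<in> I" "x = J +> y" using x by blast
      then show ?thesis using e(2)[OF y(1)] eR I.Icarr[OF y(1)] by (simp add: J.quot_simps J.quot_eq_iff)
    qed
    fix c c' assume cc: "c < n" "c' < n"
    have "(\<Oplus>\<^bsub>R Quot J\<^esub>i\<in>{..<m}. (J +> C c i) \<otimes>\<^bsub>R Quot J\<^esub> (J +> B i c'))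
        = (\<Oplus>\<^bsub>R Quot J\<^esub>i\<in>{..<m}. J +> C c i \<otimes> B i c')"
      by (intro Q.finsum_cong') (use C B in \<open>auto simp: J.quot_simps\<close>)
    also have "\<dots> = J +> (\<Oplus>i\<in>{..<m}. C c i \<otimes> B i c')"
      by (rule J.quot_finsum[symmetric]) (use C B in auto)
    also have "\<dots> = J +> (if c = c' then e else \<zero>)"
      using CB[OF cc] C B eR by (subst J.quot_eq_iff) auto
    also have "\<dots> = (if c = c' then J +> e else \<zero>\<^bsub>R Quot J\<^esub>)"
      using J.quot_eq_zero_iff[OF zero_closed] additive_subgroup.zero_closed[OF J.is_additive_subgroup]
      by (simp add: J.quot_simps)
    finally show "(\<Oplus>\<^bsub>R Quot J\<^esub>i\<in>{..<m}. (J +> C c i) \<otimes>\<^bsub>R Quot J\<^esub> (J +> B i c'))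
      = (if c = c' then J +> e else \<zero>\<^bsub>R Quot J\<^esub>)" .
  qed (use C B mn in \<open>auto simp: J.quot_simps\<close>)
  then show ?thesis using J.quot_eq_zero_iff[OF eR] by (simp add: J.quot_simps)
qed

end

section \<open>Towers of free modules and their limits\<close>

text \<open>All limits, and all the summands in (iii), are modules of sequences of ring elements
  with pointwise operations, so that they have a common type.\<close>

definition seq_module :: "('a, 'm) ring_scheme \<Rightarrow> (nat \<Rightarrow> 'a) set \<Rightarrow> ('a, nat \<Rightarrow> 'a) module"
  where "seq_module R S = \<lparr>carrier = S, monoid.mult = undefined, one = undefined,
    ring.zero = (\<lambda>_. \<zero>\<^bsub>R\<^esub>), ring.add = (\<lambda>f g j. f j \<oplus>\<^bsub>R\<^esub> g j), smult = (\<lambda>x f j. f j \<otimes>\<^bsub>R\<^esub> x)\<rparr>"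

lemma seq_module_simps [simp]:
  "carrier (seq_module R S) = S" "\<zero>\<^bsub>seq_module R S\<^esub> = (\<lambda>_. \<zero>\<^bsub>R\<^esub>)"
  "f \<oplus>\<^bsub>seq_module R S\<^esub> g = (\<lambda>j. f j \<oplus>\<^bsub>R\<^esub> g j)" "x \<odot>\<^bsub>seq_module R S\<^esub> f = (\<lambda>j. f j \<otimes>\<^bsub>R\<^esub> x)"
  by (simp_all add: seq_module_def)

lemma (in ring) seq_module_right_module:
  assumes "\<And>z j. z \<in> S \<Longrightarrow> z j \<in> carrier R" "(\<lambda>_. \<zero>) \<in> S"
    "\<And>u v. \<lbrakk>u \<in> S; v \<in> S\<rbrakk> \<Longrightarrow> (\<lambda>j. u j \<oplus> v j) \<in> S"
    "\<And>u x. \<lbrakk>u \<in> S; x \<in> carrier R\<rbrakk> \<Longrightarrow> (\<lambda>j. u j \<otimes> x) \<in> S"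
  shows "right_module R (seq_module R S)"
proof (rule right_moduleI)
  fix x y assume "x \<in> carrier (seq_module R S)" "y \<in> carrier (seq_module R S)"
  then show "x \<oplus>\<^bsub>seq_module R S\<^esub> y = y \<oplus>\<^bsub>seq_module R S\<^esub> x"
    using assms(1) by (auto simp: a_comm)
qed (use assms in \<open>auto simp: ring_axioms a_assoc r_distr l_distr m_assoc\<close>)

text \<open>An element of a limit is a family indexed by a stage \<open>t\<close> and a coordinate
  \<open>c\<close>; pairing flattens it to a sequence.\<close>

definition entry :: "(nat \<Rightarrow> 'a) \<Rightarrow> nat \<Rightarrow> nat \<Rightarrow> 'a"
  where "entry z t c = z (prod_encode (t, c))"

definition of_entries :: "(nat \<Rightarrow> nat \<Rightarrow> 'a) \<Rightarrow> nat \<Rightarrow> 'a"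
  where "of_entries Z j = (case prod_decode j of (t, c) \<Rightarrow> Z t c)"

lemma entry_of_entries [simp]: "entry (of_entries Z) = Z"
  by (simp add: entry_def of_entries_def fun_eq_iff)

lemma entry_inject: "entry y = entry z \<Longrightarrow> y = z"
proof
  fix j assume "entry y = entry z"
  then have "entry y (fst (prod_decode j)) (snd (prod_decode j))
      = entry z (fst (prod_decode j)) (snd (prod_decode j))" by simp
  then show "y j = z j" by (simp add: entry_def)
qed

text \<open>The stage at which the basis element \<open>c\<close> first appears.\<close>

definition level :: "(nat \<Rightarrow> nat) \<Rightarrow> nat \<Rightarrow> nat"
  where "level n c = (LEAST t. c < n t)"

text \<open>Divisibility makes the reductions modulo the sizes compatible with each other, so
  residues survive the composition of the maps of a tower. Strict growth makes \<open>level\<close>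
  meaningful and every level nonempty.\<close>

locale level_sizes =
  fixes n :: "nat \<Rightarrow> nat"
  assumes n_pos: "0 < n 0"
    and n_dvd: "\<And>t. n t dvd n (Suc t)"
    and n_less: "\<And>t. n t < n (Suc t)"
begin

lemma n_mono: "s \<le> t \<Longrightarrow> n s \<le> n t"
  by (rule lift_Suc_mono_le[of n]) (use n_less less_imp_le in auto)

lemma n_strict: "s < t \<Longrightarrow> n s < n t"
  by (rule lift_Suc_mono_less[of n]) (use n_less in auto)

lemma n_positive: "0 < n t"
  using n_pos n_mono[of 0 t] by simp

lemma n_dvd_le: "s \<le> t \<Longrightarrow> n s dvd n t"
proof (induction t rule: dec_induct)
  case (step t) then show ?case using dvd_trans[OF _ n_dvd] by simp
qed simp

lemma mod_mod_n: "s \<le> t \<Longrightarrow> c mod n t mod n s = c mod n s"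
  by (simp add: mod_mod_cancel n_dvd_le)

lemma n_gt: "t < n t"
  by (induction t) (use n_pos n_less in \<open>auto intro: le_less_trans Suc_leI\<close>)

lemma less_n_iff: "c < n t \<longleftrightarrow> level n c \<le> t"
proof
  assume "c < n t" then show "level n c \<le> t" unfolding level_def by (rule Least_le)
next
  assume le: "level n c \<le> t"
  have "c < n (level n c)" unfolding level_def by (rule LeastI[of _ c]) (rule n_gt)
  then show "c < n t" using n_mono[OF le] by simp
qed

lemma level_mono: "c \<le> d \<Longrightarrow> level n c \<le> level n d"
  using less_n_iff[of d "level n d"] less_n_iff[of c "level n d"] by simp

lemma level_mod: "level n (c mod m) \<le> level n c"
  by (rule level_mono) simp

lemma level_ge: "n t \<le> c \<Longrightarrow> Suc t \<le> level n c"
  using less_n_iff[of c t] by simp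

end

text \<open>The index set of the free module \<open>F\<^sub>t\<close> is \<open>{..<n t}\<close>. The map
  \<open>A\<^sub>t : F\<^sub>t \<rightarrow> F\<^sub>t\<^sub>+\<^sub>1\<close> has exactly one potentially nonzero entry per row,
  namely \<open>a t c\<close> in row \<open>c\<close> and column \<open>c mod n t\<close>, and \<open>r t\<close> is the matrix of a map
  \<open>C\<^sub>t : F\<^sub>t\<^sub>+\<^sub>2 \<rightarrow> F\<^sub>t\<^sub>+\<^sub>1\<close> with \<open>C\<^sub>t A\<^sub>t\<^sub>+\<^sub>1 A\<^sub>t = A\<^sub>t\<close>.\<close>

locale tower = ring R + level_sizes n for R (structure) and n +
  fixes I :: "nat \<Rightarrow> 'a set"
    and a :: "nat \<Rightarrow> nat \<Rightarrow> 'a" and r :: "nat \<Rightarrow> nat \<Rightarrow> nat \<Rightarrow> 'a"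
  assumes ideal_I: "\<And>i. ideal (I i) R"
    and I_dec: "\<And>i. I (Suc i) \<subseteq> I i"
    and a_in: "\<And>t c. a t c \<in> I (level n c)"
    and a_zero: "\<And>t c. n (Suc t) \<le> c \<Longrightarrow> a t c = \<zero>"
    and a_id: "\<And>t c x. \<lbrakk>c < n t; x \<in> I (level n c)\<rbrakk> \<Longrightarrow> a t c \<otimes> x \<ominus> x \<in> I (Suc t)"
    and a_gen: "\<And>t p x. \<lbrakk>p < n t; x \<in> I (level n p)\<rbrakk>
      \<Longrightarrow> x \<in> left_span R (carrier R) {c. c < n (Suc t) \<and> c mod n t = p} (a t)"
    and r_in: "\<And>t c d. r t c d \<in> I (level n c)"
    and r_zero: "\<And>t c d. n (Suc t) \<le> c \<Longrightarrow> r t c d = \<zero>"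
    and r_mod: "\<And>t c d. d mod n t \<noteq> c mod n t \<Longrightarrow> r t c d = \<zero>"
    and raa: "\<And>t c. c < n (Suc t) \<Longrightarrow>
      (\<Oplus>d\<in>{..<n (Suc (Suc t))}. r t c d \<otimes> (a (Suc t) d \<otimes> a t (d mod n (Suc t)))) = a t c"
begin

lemma I_mono: "i \<le> j \<Longrightarrow> I j \<subseteq> I i"
  by (rule lift_Suc_antimono_le[of I]) (rule I_dec)

lemma I_carrier: "x \<in> I i \<Longrightarrow> x \<in> carrier R"
  using ideal.Icarr[OF ideal_I] by blast

lemma I_zero: "\<zero> \<in> I i"
  by (rule additive_subgroup.zero_closed[OF ideal.axioms(1)[OF ideal_I]])

lemma I_add: "\<lbrakk>x \<in> I i; y \<in> I i\<rbrakk> \<Longrightarrow> x \<oplus> y \<in> I i"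
  by (rule additive_subgroup.a_closed[OF ideal.axioms(1)[OF ideal_I]])

lemma I_minus: "\<lbrakk>x \<in> I i; y \<in> I i\<rbrakk> \<Longrightarrow> x \<ominus> y \<in> I i"
  unfolding a_minus_def using I_add additive_subgroup.a_inv_closed[OF ideal.axioms(1)[OF ideal_I]]
    abelian_group_axioms by blast

lemma I_lmult: "\<lbrakk>x \<in> carrier R; y \<in> I i\<rbrakk> \<Longrightarrow> x \<otimes> y \<in> I i"
  by (rule ideal.I_l_closed[OF ideal_I])

lemma I_rmult: "\<lbrakk>y \<in> I i; x \<in> carrier R\<rbrakk> \<Longrightarrow> y \<otimes> x \<in> I i"
  by (rule ideal.I_r_closed[OF ideal_I])

lemma a_carrier: "a t c \<in> carrier R" and r_carrier: "r t c d \<in> carrier R"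
  using a_in r_in I_carrier by blast+

definition A :: "nat \<Rightarrow> (nat \<Rightarrow> 'a) \<Rightarrow> nat \<Rightarrow> 'a"
  where "A t y c = a t c \<otimes> y (c mod n t)"

definition C :: "nat \<Rightarrow> (nat \<Rightarrow> 'a) \<Rightarrow> nat \<Rightarrow> 'a"
  where "C t y c = (\<Oplus>d\<in>{..<n (Suc (Suc t))}. r t c d \<otimes> y d)"

lemma A_carrier: "(\<And>c. y c \<in> carrier R) \<Longrightarrow> A t y c \<in> carrier R"
  by (simp add: A_def a_carrier)

lemma A_in: "(\<And>c. y c \<in> carrier R) \<Longrightarrow> A t y c \<in> I (level n c)"
  by (simp add: A_def a_in I_rmult)

lemma I_finsum: "(\<And>d. d \<in> D \<Longrightarrow> f d \<in> I i) \<Longrightarrow> (\<Oplus>d\<in>D. f d) \<in> I i"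
  by (rule finsum_in_subgroup[OF additive_subgroup.a_subgroup[OF ideal.axioms(1)[OF ideal_I]]])

lemma C_in: "(\<And>c. y c \<in> carrier R) \<Longrightarrow> C t y c \<in> I (level n c)"
  unfolding C_def by (intro I_finsum I_rmult r_in)

lemma C_carrier: "(\<And>c. y c \<in> carrier R) \<Longrightarrow> C t y c \<in> carrier R"
  using C_in I_carrier by blast

lemma C_add:
  assumes "\<And>c. y c \<in> carrier R" "\<And>c. z c \<in> carrier R"
  shows "C t (\<lambda>c. y c \<oplus> z c) c = C t y c \<oplus> C t z c"
proof -
  have "C t (\<lambda>c. y c \<oplus> z c) c = (\<Oplus>d\<in>{..<n (Suc (Suc t))}. r t c d \<otimes> y d \<oplus> r t c d \<otimes> z d)"
    unfolding C_def using assms r_carrier by (intro finsum_cong') (auto simp: r_distr)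
  also have "\<dots> = C t y c \<oplus> C t z c"
    unfolding C_def using assms r_carrier by (intro finsum_addf) auto
  finally show ?thesis .
qed

lemma C_mult:
  assumes "\<And>c. y c \<in> carrier R" "x \<in> carrier R"
  shows "C t (\<lambda>c. y c \<otimes> x) c = C t y c \<otimes> x"
proof -
  have "C t (\<lambda>c. y c \<otimes> x) c = (\<Oplus>d\<in>{..<n (Suc (Suc t))}. r t c d \<otimes> y d \<otimes> x)"
    unfolding C_def using assms r_carrier by (intro finsum_cong') (auto simp: m_assoc)
  also have "\<dots> = C t y c \<otimes> x"
    unfolding C_def using assms r_carrier by (intro finsum_ldistr[symmetric]) auto
  finally show ?thesis .
qed

lemma C_zero: "C t (\<lambda>_. \<zero>) c = \<zero>"
proof -
  have "C t (\<lambda>_. \<zero>) c = (\<Oplus>d\<in>{..<n (Suc (Suc t))}. \<zero>)"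
    unfolding C_def using r_carrier by (intro finsum_cong') auto
  then show ?thesis by (simp add: finsum_zero)
qed

lemma C_beyond: "\<lbrakk>n (Suc t) \<le> c; \<And>c. y c \<in> carrier R\<rbrakk> \<Longrightarrow> C t y c = \<zero>"
proof -
  assume "n (Suc t) \<le> c" "\<And>c. y c \<in> carrier R"
  then have "C t y c = (\<Oplus>d\<in>{..<n (Suc (Suc t))}. \<zero>)"
    unfolding C_def by (intro finsum_cong') (auto simp: r_zero)
  then show ?thesis by (simp add: finsum_zero)
qed

text \<open>Row \<open>c\<close> of the matrix of \<open>C\<^sub>t\<close> vanishes outside the
  columns congruent to \<open>c\<close> modulo \<open>n t\<close>. Hence \<open>C\<^sub>t\<close>
  respects the residue blocks, as \<open>A\<^sub>t\<close> does.\<close>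

lemma C_cong:
  assumes "\<And>d. d mod n t = c mod n t \<Longrightarrow> y d = z d" "\<And>d. y d \<in> carrier R" "\<And>d. z d \<in> carrier R"
  shows "C t y c = C t z c"
  unfolding C_def
proof (intro finsum_cong')
  show "r t c d \<otimes> y d = r t c d \<otimes> z d" for d
    using assms r_mod[of d t c] by (cases "d mod n t = c mod n t") auto
qed (use assms r_carrier in auto)

text \<open>Coordinate \<open>d\<close> of the composite
  \<open>A\<^sub>t\<^sub>+\<^sub>1 A\<^sub>t\<close> reads \<open>y\<close> at
  \<open>d mod n t\<close>. Where \<open>r t c d\<close> does not vanish this is
  \<open>c mod n t\<close>, so the value of \<open>y\<close> is a common factor on the right and
  \<open>raa\<close> remains. Beyond \<open>n (Suc t)\<close> both sides are 0.\<close>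

lemma CAA:
  assumes "\<And>c. y c \<in> carrier R"
  shows "C t (A (Suc t) (A t y)) c = A t y c"
proof (cases "c < n (Suc t)")
  case True
  have "C t (A (Suc t) (A t y)) c
      = (\<Oplus>d\<in>{..<n (Suc (Suc t))}. r t c d \<otimes> (a (Suc t) d \<otimes> a t (d mod n (Suc t))) \<otimes> y (c mod n t))"
    unfolding C_def
  proof (intro finsum_cong')
    fix d
    show "r t c d \<otimes> A (Suc t) (A t y) d
        = r t c d \<otimes> (a (Suc t) d \<otimes> a t (d mod n (Suc t))) \<otimes> y (c mod n t)"
      using assms a_carrier r_carrier r_mod[of d t c]
      by (cases "d mod n t = c mod n t") (auto simp: A_def m_assoc mod_mod_n)
  qed (use assms a_carrier r_carrier in auto)
  also have "\<dots> = (\<Oplus>d\<in>{..<n (Suc (Suc t))}. r t c d \<otimes> (a (Suc t) d \<otimes> a t (d mod n (Suc t))))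
      \<otimes> y (c mod n t)"
    using assms a_carrier r_carrier by (intro finsum_ldistr[symmetric]) auto
  finally show ?thesis using raa[OF True] by (simp add: A_def)
next
  case False
  then show ?thesis using assms by (simp add: C_beyond A_carrier) (simp add: A_def a_zero)
qed

text \<open>Elements of the direct limit of the \<open>A\<^sub>t\<close> are represented by sequences that are
  coherent under the \<open>C\<^sub>t\<close> and eventually coherent under the \<open>A\<^sub>t\<close>; the entry at \<open>t\<close> lies
  in \<open>F\<^sub>t\<^sub>+\<^sub>1\<close>. The set \<open>coherent k U\<close> starts at stage \<open>k\<close> and is the block given
  by the residues \<open>U\<close> modulo \<open>n k\<close>.\<close>

definition coherent :: "nat \<Rightarrow> nat set \<Rightarrow> (nat \<Rightarrow> nat \<Rightarrow> 'a) \<Rightarrow> bool"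
  where "coherent k U Z \<longleftrightarrow> (\<forall>t c. Z t c \<in> carrier R) \<and> (\<forall>t<k. \<forall>c. Z t c = \<zero>) \<and>
    (\<forall>t\<ge>k. \<forall>c. Z t c = C t (Z (Suc t)) c) \<and> (\<forall>t\<ge>k. \<forall>c. c mod n k \<notin> U \<longrightarrow> Z t c = \<zero>) \<and>
    (\<exists>T. \<forall>t\<ge>T. \<forall>c. Z (Suc t) c = A (Suc t) (Z t) c)"

definition limit_module :: "nat \<Rightarrow> nat set \<Rightarrow> ('a, nat \<Rightarrow> 'a) module"
  where "limit_module k U = seq_module R {z. coherent k U (entry z)}"

lemma coherentD:
  assumes "coherent k U Z"
  shows "Z t c \<in> carrier R" "t < k \<Longrightarrow> Z t c = \<zero>" "k \<le> t \<Longrightarrow> Z t c = C t (Z (Suc t)) c"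
    "\<lbrakk>k \<le> t; c mod n k \<notin> U\<rbrakk> \<Longrightarrow> Z t c = \<zero>"
  using assms by (auto simp: coherent_def)

lemma coherentI:
  assumes "\<And>t c. Z t c \<in> carrier R" "\<And>t c. t < k \<Longrightarrow> Z t c = \<zero>"
    "\<And>t c. k \<le> t \<Longrightarrow> Z t c = C t (Z (Suc t)) c" "\<And>t c. \<lbrakk>k \<le> t; c mod n k \<notin> U\<rbrakk> \<Longrightarrow> Z t c = \<zero>"
    "\<And>t c. T \<le> t \<Longrightarrow> Z (Suc t) c = A (Suc t) (Z t) c"
  shows "coherent k U Z"
  unfolding coherent_def using assms by blast

lemma coherent_eventually:
  assumes "coherent k U Z"
  obtains T where "T \<ge> m" "\<And>t c. t \<ge> T \<Longrightarrow> Z (Suc t) c = A (Suc t) (Z t) c"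
proof -
  obtain T where "\<forall>t\<ge>T. \<forall>c. Z (Suc t) c = A (Suc t) (Z t) c"
    using assms by (auto simp: coherent_def)
  then show ?thesis using that[of "max m T"] by auto
qed

text \<open>From stage \<open>k\<close> on, every entry is a value of some \<open>C\<^sub>t\<close>,
  whose row \<open>c\<close> has entries in the two-sided ideal
  \<open>I (level n c)\<close>.\<close>

lemma coherent_in: "coherent k U Z \<Longrightarrow> Z t c \<in> I (level n c)"
  using coherentD(2)[of k U Z t c] coherentD(3)[of k U Z t c] C_in[of "Z (Suc t)" t c]
    coherentD(1)[of k U Z] I_zero by (cases "t < k") auto

lemma coherent_beyond: "\<lbrakk>coherent k U Z; n (Suc t) \<le> c\<rbrakk> \<Longrightarrow> Z t c = \<zero>"
  using coherentD(2)[of k U Z t c] coherentD(3)[of k U Z t c] C_beyond[of t c "Z (Suc t)"]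
    coherentD(1)[of k U Z] by (cases "t < k") auto

text \<open>The maps \<open>C\<^sub>t\<close> compute every entry from the next stage, so a tail
  determines the sequence. This is what replaces the equivalence relation of a direct limit.\<close>

lemma coherent_unique:
  assumes Y: "coherent k U Y" and Z: "coherent k V Z" and eq: "\<And>t c. s \<le> t \<Longrightarrow> Y t c = Z t c"
  shows "Y = Z"
proof -
  have "Y t = Z t" for t
  proof (cases "s \<le> t")
    case True then show ?thesis using eq by auto
  next
    case False
    then have "t \<le> s" by simp
    then show ?thesis
    proof (induction t rule: inc_induct)
      case base show ?case using eq[of s] by auto
    next
      case (step t)
      show ?case
      proof
        fix c show "Y t c = Z t c"
          using coherentD(2,3)[OF Y, of t c] coherentD(2,3)[OF Z, of t c] step
          by (cases "t < k") auto
      qed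
    qed
  qed
  then show ?thesis by auto
qed

text \<open>The missing stages are filled in downwards by the \<open>C\<^sub>t\<close>; the block
  condition persists because \<open>C\<^sub>t\<close> respects residues. Below \<open>k\<close> the
  sequence is 0 by convention.\<close>

lemma coherent_extend:
  assumes "k \<le> s"
    and "\<And>t c. s \<le> t \<Longrightarrow> Z t c \<in> carrier R"
    and "\<And>t c. s \<le> t \<Longrightarrow> Z t c = C t (Z (Suc t)) c"
    and "\<And>t c. \<lbrakk>s \<le> t; c mod n k \<notin> U\<rbrakk> \<Longrightarrow> Z t c = \<zero>"
    and "\<exists>T. \<forall>t\<ge>T. \<forall>c. Z (Suc t) c = A (Suc t) (Z t) c"
  shows "\<exists>Y. coherent k U Y \<and> (\<forall>t\<ge>s. Y t = Z t)"
  using assms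
proof (induction s arbitrary: Z rule: dec_induct)
  case base
  let ?Y = "\<lambda>t. if t < k then (\<lambda>_. \<zero>) else Z t"
  obtain T where "\<forall>t\<ge>T. \<forall>c. Z (Suc t) c = A (Suc t) (Z t) c" using base by blast
  then have T: "?Y (Suc t) c = A (Suc t) (?Y t) c" if "max T k \<le> t" for t c using that by auto
  have "coherent k U ?Y"
  proof (rule coherentI[where T = "max T k"])
    show "?Y (Suc t) c = A (Suc t) (?Y t) c" if "max T k \<le> t" for t c by (rule T[OF that])
    show "?Y t c \<in> carrier R" for t c using base(1) by simp
    show "?Y t c = C t (?Y (Suc t)) c" if "k \<le> t" for t c using base(2)[OF that, of c] that by simp
    show "?Y t c = \<zero>" if "k \<le> t" "c mod n k \<notin> U" for t c using base(3)[OF that] that by simp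
  qed auto
  then show ?case by (intro exI[of _ ?Y]) auto
next
  case (step s)
  let ?Z = "Z(s := C s (Z (Suc s)))"
  have ZR: "Z t c \<in> carrier R" if "t \<ge> Suc s" for t c using step.prems(1) that by blast
  have "\<exists>Y. coherent k U Y \<and> (\<forall>t\<ge>s. Y t = ?Z t)"
  proof (rule step.IH)
    show "?Z t c \<in> carrier R" if "s \<le> t" for t c
      using that ZR by (cases "t = s") (auto intro: C_carrier)
    show "?Z t c = C t (?Z (Suc t)) c" if "s \<le> t" for t c
      using that step.prems(2)[of t c] by (cases "t = s") auto
    show "?Z t c = \<zero>" if t: "s \<le> t" and c: "c mod n k \<notin> U" for t c
    proof (cases "t = s")
      case True
      have "C s (Z (Suc s)) c = C s (\<lambda>_. \<zero>) c"
      proof (rule C_cong)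
        fix d assume "d mod n s = c mod n s"
        then have "d mod n k = c mod n k" using mod_mod_n[of k s c] mod_mod_n[of k s d] step.hyps by simp
        then show "Z (Suc s) d = \<zero>" using step.prems(3) c by simp
      qed (use ZR in auto)
      then show ?thesis using True C_zero by simp
    next
      case False then show ?thesis using t c step.prems(3) by simp
    qed
    obtain T where "\<forall>t\<ge>T. \<forall>c. Z (Suc t) c = A (Suc t) (Z t) c" using step.prems by blast
    then have "\<forall>t\<ge>max T (Suc s). \<forall>c. ?Z (Suc t) c = A (Suc t) (?Z t) c" by auto
    then show "\<exists>T. \<forall>t\<ge>T. \<forall>c. ?Z (Suc t) c = A (Suc t) (?Z t) c" by blast
  qed
  then obtain Y where Y: "coherent k U Y" "\<forall>t\<ge>s. Y t = ?Z t" by blast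
  then have "\<forall>t\<ge>Suc s. Y t = Z t" by auto
  then show ?case using Y(1) by blast
qed

lemma coherent_zero: "coherent k U (\<lambda>_ _. \<zero>)"
  by (auto simp: coherent_def C_zero A_def a_carrier)

lemma coherent_add:
  assumes Y: "coherent k U Y" and Z: "coherent k U Z"
  shows "coherent k U (\<lambda>t c. Y t c \<oplus> Z t c)"
proof -
  note D = coherentD[OF Y] coherentD[OF Z]
  obtain S where S: "\<And>t c. t \<ge> S \<Longrightarrow> Y (Suc t) c = A (Suc t) (Y t) c"
    using coherent_eventually[OF Y] by blast
  obtain T where T: "T \<ge> S" "\<And>t c. t \<ge> T \<Longrightarrow> Z (Suc t) c = A (Suc t) (Z t) c"
    using coherent_eventually[OF Z] by blast
  have ev: "Y (Suc t) c \<oplus> Z (Suc t) c = A (Suc t) (\<lambda>c. Y t c \<oplus> Z t c) c" if "t \<ge> T" for t c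
    using S[of t c] T that D(1,5) a_carrier by (simp add: A_def r_distr)
  have co: "Y t c \<oplus> Z t c = C t (\<lambda>c. Y (Suc t) c \<oplus> Z (Suc t) c) c" if "k \<le> t" for t c
    using D(3)[OF that] D(7)[OF that] D(1,5) by (simp add: C_add)
  show ?thesis
    by (rule coherentI[OF _ _ co _ ev]) (simp_all add: D(1,2,4,5,6,8))
qed

lemma coherent_mult:
  assumes Y: "coherent k U Y" and x: "x \<in> carrier R"
  shows "coherent k U (\<lambda>t c. Y t c \<otimes> x)"
proof -
  note D = coherentD[OF Y]
  obtain S where S: "\<And>t c. t \<ge> S \<Longrightarrow> Y (Suc t) c = A (Suc t) (Y t) c"
    using coherent_eventually[OF Y] by blast
  have ev: "Y (Suc t) c \<otimes> x = A (Suc t) (\<lambda>c. Y t c \<otimes> x) c" if "t \<ge> S" for t c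
    using S[of t c] that x D(1) a_carrier by (simp add: A_def m_assoc)
  have co: "Y t c \<otimes> x = C t (\<lambda>c. Y (Suc t) c \<otimes> x) c" if "k \<le> t" for t c
    using D(3)[OF that] D(1) x by (simp add: C_mult)
  show ?thesis
    by (rule coherentI[OF _ _ co _ ev]) (simp_all add: D(1,2,4) x)
qed

lemma limit_module_simps [simp]:
  "z \<in> carrier (limit_module k U) \<longleftrightarrow> coherent k U (entry z)"
  "\<zero>\<^bsub>limit_module k U\<^esub> = (\<lambda>_. \<zero>)"
  "y \<oplus>\<^bsub>limit_module k U\<^esub> z = (\<lambda>j. y j \<oplus> z j)"
  "x \<odot>\<^bsub>limit_module k U\<^esub> z = (\<lambda>j. z j \<otimes> x)"
  by (simp_all add: limit_module_def)

lemma entry_simps [simp]: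
  "entry (\<lambda>_. \<zero>) = (\<lambda>_ _. \<zero>)" "entry (\<lambda>j. y j \<oplus> z j) = (\<lambda>t c. entry y t c \<oplus> entry z t c)"
  "entry (\<lambda>j. z j \<otimes> x) = (\<lambda>t c. entry z t c \<otimes> x)"
  by (simp_all add: fun_eq_iff entry_def)

lemma limit_right_module: "right_module R (limit_module k U)"
  unfolding limit_module_def
proof (rule seq_module_right_module)
  show "z j \<in> carrier R" if "z \<in> {z. coherent k U (entry z)}" for z j
    using coherentD(1)[of k U "entry z" "fst (prod_decode j)" "snd (prod_decode j)"] that
    by (simp add: entry_def)
qed (simp_all add: coherent_zero coherent_add coherent_mult)

section \<open>The canonical maps from the free modules to the limit\<close>

text \<open>The composite \<open>A\<^sub>s\<^sub>+\<^sub>j \<dots> A\<^sub>s\<close> of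
  \<open>j + 1\<close> maps: one map is applied already for \<open>j = 0\<close>, in accordance with
  the entry at \<open>t\<close> lying in \<open>F\<^sub>t\<^sub>+\<^sub>1\<close>.\<close>

primrec push :: "nat \<Rightarrow> (nat \<Rightarrow> 'a) \<Rightarrow> nat \<Rightarrow> nat \<Rightarrow> 'a" where
  "push s y 0 = A s y"
| "push s y (Suc j) = A (s + Suc j) (push s y j)"

lemma push_carrier: "(\<And>c. y c \<in> carrier R) \<Longrightarrow> push s y j c \<in> carrier R"
  by (induction j arbitrary: c) (auto intro: A_carrier)

lemma push_add:
  assumes "\<And>c. y c \<in> carrier R" "\<And>c. z c \<in> carrier R"
  shows "push s (\<lambda>c. y c \<oplus> z c) j c = push s y j c \<oplus> push s z j c"
  using assms by (induction j arbitrary: c) (auto simp: A_def r_distr a_carrier push_carrier)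

lemma push_mult:
  assumes "\<And>c. y c \<in> carrier R" "x \<in> carrier R"
  shows "push s (\<lambda>c. y c \<otimes> x) j c = push s y j c \<otimes> x"
  using assms by (induction j arbitrary: c) (auto simp: A_def m_assoc a_carrier push_carrier)

text \<open>\<open>A\<^sub>s\<close> reads only the first \<open>n s\<close> coordinates. Longer
  vectors are thereby truncated silently, for instance an entry at \<open>t\<close>, which belongs
  to \<open>F\<^sub>t\<^sub>+\<^sub>1\<close>, when it is used as a vector of
  \<open>F\<^sub>t\<close>.\<close>

lemma push_cong:
  assumes "\<And>c. c < n s \<Longrightarrow> y c = z c" shows "push s y j = push s z j"
proof (induction j)
  case 0 show ?case using assms n_positive[of s] by (auto simp: A_def)
qed simp

definition block_vectors :: "nat \<Rightarrow> nat set \<Rightarrow> (nat \<Rightarrow> 'a) set"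
  where "block_vectors k U = {y. (\<forall>c. y c \<in> carrier R) \<and> (\<forall>c. c mod n k \<notin> U \<longrightarrow> y c = \<zero>)}"

lemma push_block:
  assumes "k \<le> s" "y \<in> block_vectors k U" "c mod n k \<notin> U" shows "push s y j c = \<zero>"
  using assms(3)
proof (induction j arbitrary: c)
  case 0
  then have "y (c mod n s) = \<zero>" using assms mod_mod_n[OF assms(1)] by (simp add: block_vectors_def)
  then show ?case using a_carrier by (simp add: A_def)
next
  case (Suc j)
  then show ?case using mod_mod_n[of k "s + Suc j" c] assms(1) a_carrier by (simp add: A_def)
qed

text \<open>The canonical map from \<open>F\<^sub>s\<close> to the limit; a sequence with the
  prescribed tail is unique.\<close>

definition incl :: "nat \<Rightarrow> nat set \<Rightarrow> nat \<Rightarrow> (nat \<Rightarrow> 'a) \<Rightarrow> nat \<Rightarrow> 'a"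
  where "incl k U s y = (THE z. coherent k U (entry z) \<and> (\<forall>t\<ge>s. entry z t = push s y (t - s)))"

lemma incl_eqI:
  assumes "coherent k U (entry z)" "\<And>t. t \<ge> s \<Longrightarrow> entry z t = push s y (t - s)"
  shows "incl k U s y = z"
  unfolding incl_def
proof (rule the_equality)
  fix w assume "coherent k U (entry w) \<and> (\<forall>t\<ge>s. entry w t = push s y (t - s))"
  then have "entry w = entry z" using coherent_unique[of k U "entry w" U "entry z" s] assms by auto
  then show "w = z" by (rule entry_inject)
qed (use assms in auto)

text \<open>The successive images of \<open>y\<close> are coherent under the
  \<open>C\<^sub>t\<close> by \<open>CAA\<close>, and \<open>coherent_extend\<close> continues them
  below stage \<open>s\<close>.\<close>

lemma incl:
  assumes "k \<le> s" "y \<in> block_vectors k U"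
  shows "coherent k U (entry (incl k U s y))" "t \<ge> s \<Longrightarrow> entry (incl k U s y) t = push s y (t - s)"
proof -
  let ?Z = "\<lambda>t. push s y (t - s)"
  have y: "y c \<in> carrier R" for c using assms(2) by (simp add: block_vectors_def)
  have "\<exists>Y. coherent k U Y \<and> (\<forall>t\<ge>s. Y t = ?Z t)"
  proof (rule coherent_extend[OF assms(1)])
    show "?Z t c \<in> carrier R" for t c using y by (rule push_carrier)
    show "?Z t c = C t (?Z (Suc t)) c" if "s \<le> t" for t c
    proof (cases "t - s")
      case 0
      then have "t = s" using that by simp
      then show ?thesis using CAA[of y s c, OF y] by simp
    next
      case (Suc j)
      then have t: "t = s + Suc j" using that by simp
      have "C t (A (Suc t) (A t (push s y j))) c = A t (push s y j) c"
        by (rule CAA) (rule push_carrier[OF y])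
      moreover have "t - s = Suc j" "Suc t - s = Suc (Suc j)" using t by simp_all
      ultimately show ?thesis using t by simp
    qed
    show "?Z t c = \<zero>" if "c mod n k \<notin> U" for t c using push_block[OF assms that] .
    have "?Z (Suc t) c = A (Suc t) (?Z t) c" if "t \<ge> s" for t c
      using that by (simp add: Suc_diff_le)
    then show "\<exists>T. \<forall>t\<ge>T. \<forall>c. ?Z (Suc t) c = A (Suc t) (?Z t) c" by blast
  qed
  then obtain Y where Y: "coherent k U Y" "\<forall>t\<ge>s. Y t = ?Z t" by blast
  have "incl k U s y = of_entries Y" by (rule incl_eqI) (use Y in auto)
  then show "coherent k U (entry (incl k U s y))"
    "t \<ge> s \<Longrightarrow> entry (incl k U s y) t = push s y (t - s)"
    using Y by auto
qed

lemma incl_at: "\<lbrakk>k \<le> s; y \<in> block_vectors k U\<rbrakk> \<Longrightarrow> entry (incl k U s y) s c = A s y c"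
  using incl(2)[of k s y U s] by simp

lemma incl_cong:
  assumes "\<And>c. c < n s \<Longrightarrow> y c = z c" shows "incl k U s y = incl k U s z"
proof -
  have "push s y j = push s z j" for j by (rule push_cong) (rule assms)
  then show ?thesis by (simp add: incl_def)
qed

lemma incl_add:
  assumes "k \<le> s" "y \<in> block_vectors k U" "z \<in> block_vectors k U"
  shows "incl k U s (\<lambda>c. y c \<oplus> z c) = (\<lambda>j. incl k U s y j \<oplus> incl k U s z j)"
proof (rule incl_eqI)
  have R: "y c \<in> carrier R" "z c \<in> carrier R" for c using assms by (auto simp: block_vectors_def)
  show "coherent k U (entry (\<lambda>j. incl k U s y j \<oplus> incl k U s z j))"
    using incl(1) assms by (simp add: coherent_add)
  show "entry (\<lambda>j. incl k U s y j \<oplus> incl k U s z j) t = push s (\<lambda>c. y c \<oplus> z c) (t - s)"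
    if "t \<ge> s" for t
    using assms that R by (simp add: incl(2) push_add fun_eq_iff)
qed

lemma incl_mult:
  assumes "k \<le> s" "y \<in> block_vectors k U" "x \<in> carrier R"
  shows "incl k U s (\<lambda>c. y c \<otimes> x) = (\<lambda>j. incl k U s y j \<otimes> x)"
proof (rule incl_eqI)
  have R: "y c \<in> carrier R" for c using assms by (auto simp: block_vectors_def)
  show "coherent k U (entry (\<lambda>j. incl k U s y j \<otimes> x))"
    using incl(1) assms by (simp add: coherent_mult)
  show "entry (\<lambda>j. incl k U s y j \<otimes> x) t = push s (\<lambda>c. y c \<otimes> x) (t - s)"
    if "t \<ge> s" for t
    using assms that R by (simp add: incl(2) push_mult fun_eq_iff)
qed

text \<open>Set to 0 for an index outside the block, so that it lies in the block for every
  \<open>c\<close> and sums may run over all indices below \<open>n s\<close>.\<close>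

definition unit_vector :: "nat \<Rightarrow> nat set \<Rightarrow> nat \<Rightarrow> nat \<Rightarrow> 'a"
  where "unit_vector k U c d = (if d = c \<and> c mod n k \<in> U then \<one> else \<zero>)"

lemma unit_vector_block: "unit_vector k U c \<in> block_vectors k U"
  by (auto simp: unit_vector_def block_vectors_def)

definition generator :: "nat \<Rightarrow> nat set \<Rightarrow> nat \<Rightarrow> nat \<Rightarrow> nat \<Rightarrow> 'a"
  where "generator k U s c = incl k U s (unit_vector k U c)"

lemma generator_carrier: "k \<le> s \<Longrightarrow> generator k U s c \<in> carrier (limit_module k U)"
  by (simp add: generator_def incl(1) unit_vector_block)

lemma incl_eq_sum:
  assumes ks: "k \<le> s" and y: "y \<in> block_vectors k U"
  shows "incl k U s y = (\<Oplus>\<^bsub>limit_module k U\<^esub>c\<in>{..<n s}. y c \<odot>\<^bsub>limit_module k U\<^esub> generator k U s c)"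
proof -
  interpret L: right_module R "limit_module k U" by (rule limit_right_module)
  have yR: "y c \<in> carrier R" for c using y by (auto simp: block_vectors_def)
  have sm: "y c \<odot>\<^bsub>limit_module k U\<^esub> generator k U s c \<in> carrier (limit_module k U)" for c
    by (intro L.smult_closed yR generator_carrier ks)
  have res: "(\<lambda>d. if d \<in> D then y d else \<zero>) \<in> block_vectors k U" for D
    using y by (auto simp: block_vectors_def)
  have "incl k U s (\<lambda>d. if d \<in> D then y d else \<zero>)
      = (\<Oplus>\<^bsub>limit_module k U\<^esub>c\<in>D. y c \<odot>\<^bsub>limit_module k U\<^esub> generator k U s c)" if "finite D" for D
    using that
  proof (induction D)
    case empty
    have "push s (\<lambda>_. \<zero>) j = (\<lambda>_. \<zero>)" for j
      by (induction j) (auto simp: A_def a_carrier)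
    then have "incl k U s (\<lambda>_. \<zero>) = (\<lambda>_. \<zero>)" by (intro incl_eqI) (simp_all add: coherent_zero)
    then show ?case by simp
  next
    case (insert b D)
    have "(\<lambda>d. if d \<in> insert b D then y d else \<zero>)
        = (\<lambda>d. unit_vector k U b d \<otimes> y b \<oplus> (if d \<in> D then y d else \<zero>))"
      using insert(2) y by (auto simp: fun_eq_iff unit_vector_def block_vectors_def)
    moreover have "(\<lambda>d. unit_vector k U b d \<otimes> y b) \<in> block_vectors k U"
      using yR unit_vector_block[of k U b] by (auto simp: block_vectors_def)
    ultimately have "incl k U s (\<lambda>d. if d \<in> insert b D then y d else \<zero>)
        = (y b \<odot>\<^bsub>limit_module k U\<^esub> generator k U s b)
          \<oplus>\<^bsub>limit_module k U\<^esub> incl k U s (\<lambda>d. if d \<in> D then y d else \<zero>)"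
      using ks yR by (simp add: incl_add[OF ks _ res] incl_mult unit_vector_block generator_def)
    also have "\<dots> = (\<Oplus>\<^bsub>limit_module k U\<^esub>c\<in>insert b D. y c \<odot>\<^bsub>limit_module k U\<^esub> generator k U s c)"
      unfolding insert.IH using insert(1,2) sm by (intro L.M.finsum_insert[symmetric]) auto
    finally show ?case .
  qed
  from this[of "{..<n s}"] show ?thesis
    using incl_cong[of s y "\<lambda>d. if d \<in> {..<n s} then y d else \<zero>" k U] by simp
qed

lemma entry_block: "\<lbrakk>coherent k U (entry z); k \<le> t\<rbrakk> \<Longrightarrow> entry z t \<in> block_vectors k U"
  using coherentD(1,4)[of k U "entry z"] by (auto simp: block_vectors_def)

text \<open>Once the entries follow the maps \<open>A\<^sub>t\<close>, they are the successive
  images of any one of them. So \<open>z\<close> comes from its own entry at \<open>t\<close>, a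
  vector of \<open>F\<^sub>t\<^sub>+\<^sub>1\<close>. The bound \<open>m\<close> lets the stage be
  taken as late as desired.\<close>

lemma eventually_incl:
  assumes z: "z \<in> carrier (limit_module k U)"
  obtains T where "T \<ge> m" "T \<ge> k" "\<And>t. t \<ge> T \<Longrightarrow> z = incl k U (Suc t) (entry z t)"
proof -
  have zc: "coherent k U (entry z)" using z by simp
  obtain T where T: "T \<ge> max m k" "\<And>t c. t \<ge> T \<Longrightarrow> entry z (Suc t) c = A (Suc t) (entry z t) c"
    using coherent_eventually[OF zc] by blast
  have "incl k U (Suc t) (entry z t) = z" if t: "t \<ge> T" for t
  proof (rule incl_eqI[OF zc])
    fix t' assume t': "Suc t \<le> t'"
    have "entry z (Suc t + j) = push (Suc t) (entry z t) j" for j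
    proof (induction j)
      case 0 show ?case using T(2)[OF t] by auto
    next
      case (Suc j)
      have "entry z (Suc (Suc t + j)) = A (Suc (Suc t + j)) (entry z (Suc t + j))"
        using T(2)[of "Suc t + j"] t by auto
      then show ?case using Suc by simp
    qed
    from this[of "t' - Suc t"] t' show "entry z t' = push (Suc t) (entry z t) (t' - Suc t)" by simp
  qed
  then show ?thesis using that[of T] T(1) by force
qed

end

section \<open>Projectivity and trace of the limit\<close>

text \<open>Every axiom is carried over by lifting elements along the surjection. This provides the
  module structure on quotients.\<close>

lemma right_module_surj_image:
  fixes P :: "('a, 'b) module" and Q :: "('a, 'c) module"
  assumes P: "right_module R P"
    and img: "f ` carrier P = carrier Q"
    and zero: "f \<zero>\<^bsub>P\<^esub> = \<zero>\<^bsub>Q\<^esub>"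
    and add: "\<And>x y. \<lbrakk>x \<in> carrier P; y \<in> carrier P\<rbrakk> \<Longrightarrow> f (x \<oplus>\<^bsub>P\<^esub> y) = f x \<oplus>\<^bsub>Q\<^esub> f y"
    and smult: "\<And>r x. \<lbrakk>r \<in> carrier R; x \<in> carrier P\<rbrakk> \<Longrightarrow> f (r \<odot>\<^bsub>P\<^esub> x) = r \<odot>\<^bsub>Q\<^esub> f x"
  shows "right_module R Q"
proof -
  interpret P: right_module R P by fact
  have ex: "\<exists>x\<in>carrier P. y = f x" if "y \<in> carrier Q" for y using that img by blast
  have im: "f x \<in> carrier Q" if "x \<in> carrier P" for x using that img by blast
  show ?thesis
  proof (rule right_moduleI)
    show "ring R" by (rule P.R.ring_axioms)
    show "\<zero>\<^bsub>Q\<^esub> \<in> carrier Q" using im[of "\<zero>\<^bsub>P\<^esub>"] zero by simp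
    fix x y z r s assume "x \<in> carrier Q"
    then obtain x' where x: "x' \<in> carrier P" "x = f x'" using ex by blast
    show "\<zero>\<^bsub>Q\<^esub> \<oplus>\<^bsub>Q\<^esub> x = x" using x add[of "\<zero>\<^bsub>P\<^esub>" x'] zero by simp
    show "\<zero>\<^bsub>R\<^esub> \<odot>\<^bsub>Q\<^esub> x = \<zero>\<^bsub>Q\<^esub>"
      using x smult[of "\<zero>\<^bsub>R\<^esub>" x'] zero by (simp add: P.zero_smult)
    show "\<one>\<^bsub>R\<^esub> \<odot>\<^bsub>Q\<^esub> x = x" using x smult[of "\<one>\<^bsub>R\<^esub>" x'] by (simp add: P.smult_one)
    { assume r: "r \<in> carrier R"
      show "r \<odot>\<^bsub>Q\<^esub> x \<in> carrier Q" using r x smult im P.smult_closed by metis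
      assume s: "s \<in> carrier R"
      show "(r \<oplus>\<^bsub>R\<^esub> s) \<odot>\<^bsub>Q\<^esub> x = r \<odot>\<^bsub>Q\<^esub> x \<oplus>\<^bsub>Q\<^esub> s \<odot>\<^bsub>Q\<^esub> x"
        unfolding x(2) using r s x(1)
        by (simp add: smult[symmetric] add[symmetric] P.smult_add_ring P.smult_closed)
      show "s \<odot>\<^bsub>Q\<^esub> (r \<odot>\<^bsub>Q\<^esub> x) = (r \<otimes>\<^bsub>R\<^esub> s) \<odot>\<^bsub>Q\<^esub> x"
        unfolding x(2) using r s x(1)
        by (simp add: smult[symmetric] P.smult_assoc P.smult_closed) }
    assume "y \<in> carrier Q"
    then obtain y' where y: "y' \<in> carrier P" "y = f y'" using ex by blast
    show "x \<oplus>\<^bsub>Q\<^esub> y \<in> carrier Q" using x y add im P.M.a_closed by metis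
    show "x \<oplus>\<^bsub>Q\<^esub> y = y \<oplus>\<^bsub>Q\<^esub> x"
      unfolding x(2) y(2) using x(1) y(1) P.M.a_comm[of x' y'] by (simp add: add[symmetric])
    show "r \<odot>\<^bsub>Q\<^esub> (x \<oplus>\<^bsub>Q\<^esub> y) = r \<odot>\<^bsub>Q\<^esub> x \<oplus>\<^bsub>Q\<^esub> r \<odot>\<^bsub>Q\<^esub> y" if "r \<in> carrier R"
      unfolding x(2) y(2) using x(1) y(1) that
      by (simp add: add[symmetric] smult[symmetric] P.smult_closed P.smult_add_module)
    assume "z \<in> carrier Q"
    then obtain z' where z: "z' \<in> carrier P" "z = f z'" using ex by blast
    show "x \<oplus>\<^bsub>Q\<^esub> y \<oplus>\<^bsub>Q\<^esub> z = x \<oplus>\<^bsub>Q\<^esub> (y \<oplus>\<^bsub>Q\<^esub> z)"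
      unfolding x(2) y(2) z(2) using x(1) y(1) z(1) by (simp add: add[symmetric] P.M.a_assoc)
  qed
qed

lemma quotient_module_projection:
  fixes P :: "('a, 'b) module"
  assumes P: "right_module R P" and N: "submodule N R P"
  shows "right_module R (quotient_module P N)"
    "(\<lambda>x. N +>\<^bsub>P\<^esub> x) \<in> module_hom R P (quotient_module P N)"
    "(\<lambda>x. N +>\<^bsub>P\<^esub> x) ` carrier P = carrier (quotient_module P N)"
    "\<And>x. x \<in> carrier P \<Longrightarrow> N +>\<^bsub>P\<^esub> x = \<zero>\<^bsub>quotient_module P N\<^esub> \<longleftrightarrow> x \<in> N"
proof -
  interpret P: right_module R P by fact
  interpret N: submodule N R P by fact
  have sg: "subgroup N (add_monoid P)" by (rule submodule.axioms(1)[OF N])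
  interpret N: abelian_subgroup N P
    by (rule abelian_subgroupI3) (auto simp: additive_subgroup_def sg P.M.abelian_group_axioms)
  let ?q = "\<lambda>x. N +>\<^bsub>P\<^esub> x" and ?Q = "quotient_module P N"
  show img: "?q ` carrier P = carrier ?Q"
    by (auto simp: quotient_module_def A_RCOSETS_def')
  show z: "?q x = \<zero>\<^bsub>?Q\<^esub> \<longleftrightarrow> x \<in> N" if "x \<in> carrier P" for x
    using that P.M.a_coset_join1[OF _ that sg] P.M.a_coset_join2[OF that sg]
    by (auto simp: quotient_module_def)
  have add: "?q (x \<oplus>\<^bsub>P\<^esub> y) = ?q x \<oplus>\<^bsub>?Q\<^esub> ?q y" if "x \<in> carrier P" "y \<in> carrier P" for x y
    using N.a_rcos_sum[OF that] by (simp add: quotient_module_def)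
  have smult: "?q (r \<odot>\<^bsub>P\<^esub> x) = r \<odot>\<^bsub>?Q\<^esub> ?q x" if r: "r \<in> carrier R" and x: "x \<in> carrier P" for r x
  proof -
    \<comment> \<open>The action on cosets is a union over representatives; it is a single coset
      because all of them give the same one.\<close>
    have "?q (r \<odot>\<^bsub>P\<^esub> y) = ?q (r \<odot>\<^bsub>P\<^esub> x)" if y: "y \<in> ?q x" for y
    proof -
      obtain b where b: "b \<in> N" "y = b \<oplus>\<^bsub>P\<^esub> x" using y by (auto simp: a_r_coset_def')
      have bP: "b \<in> carrier P" using b(1) N.a_subset by auto
      have "r \<odot>\<^bsub>P\<^esub> y = r \<odot>\<^bsub>P\<^esub> b \<oplus>\<^bsub>P\<^esub> r \<odot>\<^bsub>P\<^esub> x"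
        using b bP r x by (simp add: P.smult_add_module)
      moreover have "r \<odot>\<^bsub>P\<^esub> b \<in> N" using r b(1) by simp
      ultimately have "r \<odot>\<^bsub>P\<^esub> y \<in> ?q (r \<odot>\<^bsub>P\<^esub> x)" by (auto simp: a_r_coset_def')
      then show ?thesis using N.a_repr_independence' P.smult_closed r x by metis
    qed
    moreover have "x \<in> ?q x" using N.a_rcos_self x by simp
    ultimately have "(\<Union>y\<in>?q x. ?q (r \<odot>\<^bsub>P\<^esub> y)) = ?q (r \<odot>\<^bsub>P\<^esub> x)" by blast
    then show ?thesis by (simp add: quotient_module_def)
  qed
  show "right_module R ?Q"
  proof (rule right_module_surj_image[OF P img])
    show "?q \<zero>\<^bsub>P\<^esub> = \<zero>\<^bsub>?Q\<^esub>" using z[of "\<zero>\<^bsub>P\<^esub>"] N.zero_closed by simp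
  qed (use add smult in auto)
  show "?q \<in> module_hom R P ?Q" by (rule module_homI) (use img add smult in auto)
qed

text \<open>Generators are lifted along the projection, and submodules are moved along it in both
  directions. The right-hand side mentions only elements and submodules of \<open>P\<close>, so
  finite generation of a quotient can be treated without cosets.\<close>

lemma finitely_generated_quotient_iff:
  fixes P :: "('a, 'b) module"
  assumes P: "right_module R P" and N: "submodule N R P"
  shows "finitely_generated R (quotient_module P N) \<longleftrightarrow>
    (\<exists>Y. finite Y \<and> Y \<subseteq> carrier P \<and> (\<forall>H. submodule H R P \<and> Y \<union> N \<subseteq> H \<longrightarrow> carrier P \<subseteq> H))"
proof -
  interpret P: right_module R P by fact
  let ?Q = "quotient_module P N" and ?q = "\<lambda>x. N +>\<^bsub>P\<^esub> x"
  note pr = quotient_module_projection[OF P N]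
  interpret Q: right_module R ?Q by (rule pr(1))
  note qc = module_hom_closed[OF pr(2)] and qa = module_hom_add[OF pr(2)] and qs = module_hom_smult[OF pr(2)]
  have q0: "?q \<zero>\<^bsub>P\<^esub> = \<zero>\<^bsub>?Q\<^esub>" by (rule module_hom_zero[OF P pr(1,2)])
  have sub0: "\<zero>\<^bsub>M\<^esub> \<in> H" "\<And>x y. \<lbrakk>x \<in> H; y \<in> H\<rbrakk> \<Longrightarrow> x \<oplus>\<^bsub>M\<^esub> y \<in> H"
    "\<And>r x. \<lbrakk>r \<in> carrier R; x \<in> H\<rbrakk> \<Longrightarrow> r \<odot>\<^bsub>M\<^esub> x \<in> H" "H \<subseteq> carrier M"
    if "submodule H R M" for H and M :: "('a, 'x) module"
    using subgroup.one_closed[OF submodule.axioms(1)[OF that]] subgroup.m_closed[OF submodule.axioms(1)[OF that]]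
      submodule.smult_closed[OF that] subgroup.subset[OF submodule.axioms(1)[OF that]] by auto
  show ?thesis
  proof
    assume "finitely_generated R ?Q"
    then obtain Y where Y: "finite Y" "Y \<subseteq> carrier ?Q" "module_span R ?Q Y = carrier ?Q"
      unfolding finitely_generated_def by auto
    then obtain W where W: "finite W" "W \<subseteq> carrier P" "Y = ?q ` W"
      using finite_subset_image[OF Y(1), of ?q "carrier P"] pr(3) by auto
    have "carrier P \<subseteq> H" if H: "submodule H R P" "W \<union> N \<subseteq> H" for H
    proof
      fix x assume x: "x \<in> carrier P"
      note h = sub0[OF H(1)]
      have "submodule (?q ` H) R ?Q"
      proof (rule Q.submoduleI)
        show "?q ` H \<subseteq> carrier ?Q" using h(4) qc by auto
        show "\<zero>\<^bsub>?Q\<^esub> \<in> ?q ` H" using q0 h(1) by (metis imageI)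
        show "u \<oplus>\<^bsub>?Q\<^esub> v \<in> ?q ` H" if "u \<in> ?q ` H" "v \<in> ?q ` H" for u v
        proof -
          obtain u' v' where "u' \<in> H" "v' \<in> H" "u = ?q u'" "v = ?q v'" using \<open>u \<in> _\<close> \<open>v \<in> _\<close> by blast
          moreover from this have "u' \<in> carrier P" "v' \<in> carrier P" using h(4) by blast+
          ultimately show ?thesis using h(2) by (simp add: qa[symmetric])
        qed
        show "r \<odot>\<^bsub>?Q\<^esub> u \<in> ?q ` H" if "r \<in> carrier R" "u \<in> ?q ` H" for r u
        proof -
          obtain u' where "u' \<in> H" "u = ?q u'" using \<open>u \<in> _\<close> by blast
          moreover from this have "u' \<in> carrier P" using h(4) by blast
          ultimately show ?thesis using h(3) \<open>r \<in> _\<close> by (simp add: qs[symmetric])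
        qed
      qed
      moreover have "Y \<subseteq> ?q ` H" using W(3) H(2) by auto
      ultimately have "carrier ?Q \<subseteq> ?q ` H" using Y(3) unfolding module_span_def by blast
      then obtain b where b: "b \<in> H" "?q x = ?q b" using qc[OF x] by blast
      have bP: "b \<in> carrier P" using b(1) h(4) by auto
      have "?q (x \<oplus>\<^bsub>P\<^esub> \<ominus>\<^bsub>P\<^esub> b) = ?q b \<oplus>\<^bsub>?Q\<^esub> ?q (\<ominus>\<^bsub>P\<^esub> b)" using qa x bP b(2) by simp
      also have "\<dots> = \<zero>\<^bsub>?Q\<^esub>" using qa[of b "\<ominus>\<^bsub>P\<^esub> b"] bP q0 by (simp add: P.M.r_neg)
      finally have "x \<oplus>\<^bsub>P\<^esub> \<ominus>\<^bsub>P\<^esub> b \<in> N" using pr(4) x bP by simp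
      then have "(x \<oplus>\<^bsub>P\<^esub> \<ominus>\<^bsub>P\<^esub> b) \<oplus>\<^bsub>P\<^esub> b \<in> H" using h(2) b(1) H(2) by blast
      then show "x \<in> H" using x bP by (simp add: P.M.a_assoc P.M.l_neg)
    qed
    then show "\<exists>Y. finite Y \<and> Y \<subseteq> carrier P \<and> (\<forall>H. submodule H R P \<and> Y \<union> N \<subseteq> H \<longrightarrow> carrier P \<subseteq> H)"
      using W(1,2) by blast
  next
    assume "\<exists>Y. finite Y \<and> Y \<subseteq> carrier P \<and> (\<forall>H. submodule H R P \<and> Y \<union> N \<subseteq> H \<longrightarrow> carrier P \<subseteq> H)"
    then obtain Y where Y: "finite Y" "Y \<subseteq> carrier P"
      "\<forall>H. submodule H R P \<and> Y \<union> N \<subseteq> H \<longrightarrow> carrier P \<subseteq> H" by auto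
    have "module_span R ?Q (?q ` Y) = carrier ?Q"
    proof (rule module_span_eq_carrierI[OF pr(1)])
      show "?q ` Y \<subseteq> carrier ?Q" using Y(2) qc by auto
      fix H assume H: "submodule H R ?Q" "?q ` Y \<subseteq> H"
      note h = sub0[OF H(1)]
      let ?H = "{x \<in> carrier P. ?q x \<in> H}"
      have "carrier P \<subseteq> ?H"
      proof (rule Y(3)[rule_format], rule conjI)
        show "submodule ?H R P"
          by (rule P.submoduleI) (simp_all add: subset_iff h(1-3) q0 qa qs P.smult_closed)
        have "?q x \<in> H" if "x \<in> N" for x
        proof -
          have "x \<in> carrier P" using that sub0(4)[OF N] by blast
          then show ?thesis using pr(4)[of x] that h(1) by simp
        qed
        then show "Y \<union> N \<subseteq> ?H" using Y(2) H(2) sub0(4)[OF N] by blast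
      qed
      then show "carrier ?Q \<subseteq> H" unfolding pr(3)[symmetric] by auto
    qed
    moreover have "?q ` Y \<subseteq> carrier ?Q" using Y(2) qc by auto
    ultimately show "finitely_generated R ?Q"
      unfolding finitely_generated_def using finite_imageI[OF Y(1)] by metis
  qed
qed

lemma finsum_regular_right: "finsum (regular_right R) f B = finsum R f B"
  by (simp add: finsum_def finprod_def regular_right_def)

context tower
begin

lemma generators_span:
  assumes "submodule H R (limit_module k U)" "z \<in> carrier (limit_module k U)"
    "\<And>s c. k \<le> s \<Longrightarrow> generator k U s c \<in> H"
  shows "z \<in> H"
proof -
  interpret L: right_module R "limit_module k U" by (rule limit_right_module)
  have zc: "coherent k U (entry z)" using assms(2) by simp
  obtain t where t: "t \<ge> k" "z = incl k U (Suc t) (entry z t)"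
    using eventually_incl[OF assms(2), of 0] by blast
  have "z = (\<Oplus>\<^bsub>limit_module k U\<^esub>c\<in>{..<n (Suc t)}. entry z t c \<odot>\<^bsub>limit_module k U\<^esub> generator k U (Suc t) c)"
    using incl_eq_sum[OF _ entry_block[OF zc t(1)], of "Suc t"] t by simp
  also have "\<dots> \<in> H"
    using submodule.smult_closed[OF assms(1)] assms(3)[of "Suc t"] t(1) coherentD(1)[OF zc]
    by (intro L.finsum_in_submodule[OF assms(1)]) auto
  finally show ?thesis .
qed

lemma limit_countably_generated: "countably_generated R (limit_module k U)"
proof -
  let ?Y = "(\<lambda>(s, c). generator k U s c) ` ({k..} \<times> UNIV)"
  have "module_span R (limit_module k U) ?Y = carrier (limit_module k U)"
  proof (rule module_span_eq_carrierI[OF limit_right_module])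
    show "?Y \<subseteq> carrier (limit_module k U)" using generator_carrier by auto
    show "carrier (limit_module k U) \<subseteq> H" if "submodule H R (limit_module k U)" "?Y \<subseteq> H" for H
      using generators_span[OF that(1)] that(2) by force
  qed
  moreover have "countable ?Y" by (intro countable_image countableI_type)
  moreover have "?Y \<subseteq> carrier (limit_module k U)" using generator_carrier by auto
  ultimately show ?thesis unfolding countably_generated_def by (intro exI[of _ ?Y] conjI)
qed

section \<open>Projectivity of the limit by a telescoping sum\<close>

lemma push_Suc: "push (Suc s) (A s y) j = push s y (Suc j)"
  by (induction j) auto

text \<open>The entry at \<open>s\<close> of the image of \<open>y\<close> is
  \<open>A\<^sub>s y\<close>, and the canonical maps of \<open>F\<^sub>s\<close> and
  \<open>F\<^sub>s\<^sub>+\<^sub>1\<close> are compatible with \<open>A\<^sub>s\<close>.\<close>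

lemma incl_incl:
  assumes "k \<le> s" "y \<in> block_vectors k U"
  shows "incl k U (Suc s) (entry (incl k U s y) s) = incl k U s y"
proof (rule incl_eqI)
  show "coherent k U (entry (incl k U s y))" by (rule incl(1)[OF assms])
  fix t assume t: "Suc s \<le> t"
  have "entry (incl k U s y) s = A s y" using incl_at[OF assms] by auto
  then show "entry (incl k U s y) t = push (Suc s) (entry (incl k U s y) s) (t - Suc s)"
    using incl(2)[OF assms, of t] t push_Suc[of s y "t - Suc s"] by (simp add: Suc_diff_Suc)
qed

text \<open>The endomorphism \<open>stage k U t\<close> of the limit factors through \<open>F\<^sub>t\<^sub>+\<^sub>1\<close> and is the identity
  on the image of \<open>F\<^sub>t\<close>.\<close>

definition stage :: "nat \<Rightarrow> nat set \<Rightarrow> nat \<Rightarrow> (nat \<Rightarrow> 'a) \<Rightarrow> nat \<Rightarrow> 'a"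
  where "stage k U t z = incl k U (Suc t) (entry z t)"

text \<open>With \<open>E\<^sub>t\<close> for the endomorphism \<open>stage k U t\<close>, this is
  the map \<open>1 - E\<^sub>t\<^sub>-\<^sub>1\<close>, where the endomorphism preceding
  \<open>E\<^sub>k\<close> counts as 0.\<close>

definition stage_diff :: "nat \<Rightarrow> nat set \<Rightarrow> nat \<Rightarrow> (nat \<Rightarrow> 'a) \<Rightarrow> nat \<Rightarrow> 'a"
  where "stage_diff k U t z j = (if t = k then z j else z j \<oplus> stage k U (t - 1) z j \<otimes> \<ominus> \<one>)"

lemma stage_hom:
  assumes "k \<le> t" shows "stage k U t \<in> module_hom R (limit_module k U) (limit_module k U)"
proof (rule module_homI)
  fix y assume "y \<in> carrier (limit_module k U)"
  then have y: "entry y t \<in> block_vectors k U" using entry_block assms by simp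
  show "stage k U t y \<in> carrier (limit_module k U)"
    using incl(1)[OF _ y] assms by (simp add: stage_def)
  show "stage k U t (x \<odot>\<^bsub>limit_module k U\<^esub> y) = x \<odot>\<^bsub>limit_module k U\<^esub> stage k U t y"
    if "x \<in> carrier R" for x
    using incl_mult[OF _ y that, of "Suc t"] assms by (simp add: stage_def)
  fix z assume "z \<in> carrier (limit_module k U)"
  then have z: "entry z t \<in> block_vectors k U" using entry_block assms by simp
  show "stage k U t (y \<oplus>\<^bsub>limit_module k U\<^esub> z) = stage k U t y \<oplus>\<^bsub>limit_module k U\<^esub> stage k U t z"
    using incl_add[OF _ y z, of "Suc t"] assms by (simp add: stage_def)
qed

lemma limit_carrier: "z \<in> carrier (limit_module k U) \<Longrightarrow> z j \<in> carrier R"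
  using coherentD(1)[of k U "entry z" "fst (prod_decode j)" "snd (prod_decode j)"]
  by (simp add: entry_def)

lemma stage_diff_hom:
  assumes "k \<le> t" shows "stage_diff k U t \<in> module_hom R (limit_module k U) (limit_module k U)"
proof (cases "t = k")
  case True
  then have "stage_diff k U t = (\<lambda>z. z)" by (simp add: fun_eq_iff stage_diff_def)
  then show ?thesis by (simp add: module_hom_def)
next
  case False
  interpret L: right_module R "limit_module k U" by (rule limit_right_module)
  let ?L = "limit_module k U"
  obtain p where p: "t = Suc p" using assms False by (cases t) auto
  have kt: "k \<le> p" using assms False p by simp
  let ?s = "stage k U p"
  note s = module_hom_closed[OF stage_hom[OF kt]] module_hom_add[OF stage_hom[OF kt]]
    module_hom_smult[OF stage_hom[OF kt]]
  have eq: "stage_diff k U t z = z \<oplus>\<^bsub>?L\<^esub> (\<ominus> \<one>) \<odot>\<^bsub>?L\<^esub> ?s z" for z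
    using False by (auto simp: stage_diff_def p)
  have neg: "(\<ominus> \<one>) \<odot>\<^bsub>?L\<^esub> z = \<ominus>\<^bsub>?L\<^esub> z" if "z \<in> carrier ?L" for z
    using L.minus_smult[OF one_closed that] L.smult_one[OF that] by (simp del: limit_module_simps)
  have c: "stage_diff k U t z = z \<ominus>\<^bsub>?L\<^esub> ?s z" if "z \<in> carrier ?L" for z
    unfolding eq using neg[OF s(1)[OF that]] by (simp add: a_minus_def del: limit_module_simps)
  show ?thesis
  proof (rule module_homI)
    fix y assume y: "y \<in> carrier ?L"
    show "stage_diff k U t y \<in> carrier ?L"
      unfolding c[OF y] using y s(1)[OF y] by (rule L.M.minus_closed)
    show "stage_diff k U t (x \<odot>\<^bsub>?L\<^esub> y) = x \<odot>\<^bsub>?L\<^esub> stage_diff k U t y" if x: "x \<in> carrier R" for x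
      unfolding c[OF y] c[OF L.smult_closed[OF x y]] using x y s(1)[OF y]
      by (simp add: s(3) a_minus_def L.smult_add_module L.smult_minus del: limit_module_simps)
    fix z assume z: "z \<in> carrier ?L"
    show "stage_diff k U t (y \<oplus>\<^bsub>?L\<^esub> z) = stage_diff k U t y \<oplus>\<^bsub>?L\<^esub> stage_diff k U t z"
      unfolding c[OF y] c[OF z] c[OF L.M.a_closed[OF y z]] using y z s(1)[OF y] s(1)[OF z]
      by (simp add: s(2) a_minus_def L.M.minus_add L.M.a_ac del: limit_module_simps)
  qed
qed

lemma entry_hom: "(\<lambda>z. entry z t c) \<in> module_hom R (limit_module k U) (regular_right R)"
  by (rule module_homI) (auto simp: coherentD(1))

lemma module_hom_comp:
  assumes "f \<in> module_hom R L M" "g \<in> module_hom R M N" shows "(\<lambda>x. g (f x)) \<in> module_hom R L N"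
  using assms by (auto simp: module_hom_def Pi_iff)

text \<open>Values of \<open>E\<^sub>t\<^sub>-\<^sub>1\<close> come from \<open>F\<^sub>t\<close>,
  where \<open>E\<^sub>t\<close> is the identity. Hence \<open>E\<^sub>t (1 -
  E\<^sub>t\<^sub>-\<^sub>1) = E\<^sub>t - E\<^sub>t\<^sub>-\<^sub>1\<close>, and the sum
  telescopes.\<close>

lemma stage_telescope:
  assumes z: "z \<in> carrier (limit_module k U)" and "k \<le> T"
  shows "(\<Oplus>\<^bsub>limit_module k U\<^esub>t\<in>{k..T}. stage k U t (stage_diff k U t z)) = stage k U T z"
  using assms(2)
proof (induction T rule: dec_induct)
  interpret L: right_module R "limit_module k U" by (rule limit_right_module)
  let ?L = "limit_module k U"
  have term_closed: "stage k U t (stage_diff k U t z) \<in> carrier ?L" if "k \<le> t" for t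
    using module_hom_closed[OF stage_hom[OF that] module_hom_closed[OF stage_diff_hom[OF that] z]] .
  { case base
    have "stage_diff k U k z = z" by (auto simp: stage_diff_def)
    then show ?case using L.M.finsum_insert[of "{}" k "\<lambda>t. stage k U t (stage_diff k U t z)"]
        term_closed[of k] by (simp del: limit_module_simps) }
  case (step T)
  let ?s = "stage k U T" and ?s' = "stage k U (Suc T)"
  have h: "?s' \<in> module_hom R ?L ?L" using stage_hom step.hyps by simp
  have sz: "?s z \<in> carrier ?L" using module_hom_closed[OF stage_hom z] step.hyps by simp
  have zc: "coherent k U (entry z)" using z by simp
  have ss: "?s' (?s z) = ?s z" unfolding stage_def
    by (rule incl_incl) (use step.hyps entry_block[OF zc] in auto)
  have s'z: "?s' z \<in> carrier ?L" by (rule module_hom_closed[OF h z])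
  have "stage_diff k U (Suc T) z = z \<oplus>\<^bsub>?L\<^esub> (\<ominus> \<one>) \<odot>\<^bsub>?L\<^esub> ?s z"
    using step.hyps by (auto simp: stage_diff_def)
  also have "\<dots> = z \<oplus>\<^bsub>?L\<^esub> \<ominus>\<^bsub>?L\<^esub> ?s z"
    using L.minus_smult[OF one_closed sz] L.smult_one[OF sz] by (simp del: limit_module_simps)
  finally have "?s' (stage_diff k U (Suc T) z) = ?s' z \<oplus>\<^bsub>?L\<^esub> \<ominus>\<^bsub>?L\<^esub> ?s z"
    using module_hom_add[OF h z L.M.a_inv_closed[OF sz]]
      module_hom_minus[OF limit_right_module limit_right_module h sz] ss by (simp del: limit_module_simps)
  moreover have "{k..Suc T} = insert (Suc T) {k..T}" using step.hyps by auto
  then have "(\<Oplus>\<^bsub>?L\<^esub>t\<in>{k..Suc T}. stage k U t (stage_diff k U t z))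
      = ?s' (stage_diff k U (Suc T) z) \<oplus>\<^bsub>?L\<^esub> (\<Oplus>\<^bsub>?L\<^esub>t\<in>{k..T}. stage k U t (stage_diff k U t z))"
    using L.M.finsum_insert[of "{k..T}" "Suc T" "\<lambda>t. stage k U t (stage_diff k U t z)"] term_closed step.hyps
    by (simp del: limit_module_simps)
  ultimately have "(\<Oplus>\<^bsub>?L\<^esub>t\<in>{k..Suc T}. stage k U t (stage_diff k U t z))
      = ?s' z \<oplus>\<^bsub>?L\<^esub> \<ominus>\<^bsub>?L\<^esub> ?s z \<oplus>\<^bsub>?L\<^esub> ?s z" using step.IH by (simp del: limit_module_simps)
  also have "\<dots> = ?s' z" using sz s'z by (simp add: L.M.a_assoc L.M.l_neg del: limit_module_simps)
  finally show ?case .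
qed


text \<open>The dual basis consists of the generators at stage \<open>t + 1\<close> together with the entries at \<open>t\<close>
  of the successive differences of the endomorphisms \<open>stage k U t\<close>.\<close>

lemma limit_projective: "projective R (limit_module k U)"
proof (cases "\<one> = \<zero>")
  case True
  let ?L = "limit_module k U"
  have "z = (\<lambda>_. \<zero>)" if "z \<in> carrier ?L" for z
  proof
    fix j show "z j = \<zero>" using limit_carrier[OF that, of j] True by (metis l_null l_one)
  qed
  then have z: "z = \<zero>\<^bsub>?L\<^esub>" if "z \<in> carrier ?L" for z using that by simp
  interpret L: right_module R ?L by (rule limit_right_module)
  show ?thesis
    by (rule dual_basis_projective[OF limit_right_module, where Y = "{}"])
      (use z in \<open>simp_all del: limit_module_simps\<close>)
next
  case False
  let ?L = "limit_module k U"
  interpret L: right_module R ?L by (rule limit_right_module)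
  \<comment> \<open>The basis has to be a set in the type of elements of the limit. The sequences
    \<open>h i\<close> are distinct names for the natural numbers as soon as
    \<open>1 \<noteq> 0\<close>; over the zero ring the limit is 0 and the empty basis is used
    instead.\<close>
  define h :: "nat \<Rightarrow> nat \<Rightarrow> 'a" where "h i j = (if i = j then \<one> else \<zero>)" for i j
  have inj: "inj h" using False by (auto simp: inj_def h_def fun_eq_iff split: if_splits)
  define ix where "ix y = prod_decode (inv_into UNIV h y)" for y
  have ix: "ix (h (prod_encode p)) = p" for p by (simp add: ix_def inv_into_f_f[OF inj])
  define Y where "Y = (\<lambda>p. h (prod_encode p)) ` ({k..} \<times> UNIV)"
  define e where "e y = (case ix y of (t, c) \<Rightarrow> generator k U (Suc t) c)" for y
  define f where "f y z = (case ix y of (t, c) \<Rightarrow> entry (stage_diff k U t z) t c)" for y z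
  have inj': "inj_on (\<lambda>p. h (prod_encode p)) B" for B
    using inj by (auto simp: inj_on_def dest!: injD[OF inj])
  show ?thesis
  proof (rule dual_basis_projective[OF limit_right_module, where Y = Y and e = e and f = f])
    show "e y \<in> carrier ?L" if "y \<in> Y" for y
      using that generator_carrier[of k _ U] by (auto simp: Y_def e_def ix simp del: limit_module_simps)
    show "f y \<in> module_hom R ?L (regular_right R)" if "y \<in> Y" for y
    proof -
      obtain t c where tc: "k \<le> t" "y = h (prod_encode (t, c))" using \<open>y \<in> Y\<close> by (auto simp: Y_def)
      have "ix y = (t, c)" using tc(2) ix by simp
      then have "f y = (\<lambda>z. entry (stage_diff k U t z) t c)" by (intro ext) (simp add: f_def)
      then show ?thesis using module_hom_comp[OF stage_diff_hom[OF tc(1)] entry_hom] by simp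
    qed
    fix z assume z: "z \<in> carrier ?L"
    note d = module_hom_closed[OF stage_diff_hom z]
    obtain T where T0: "T \<ge> k" "\<And>t. t \<ge> T \<Longrightarrow> z = incl k U (Suc t) (entry z t)"
      using eventually_incl[OF z, of 0] by blast
    have T: "T \<ge> k" "\<And>t. t \<ge> T \<Longrightarrow> stage k U t z = z"
      unfolding stage_def by (rule T0(1), rule T0(2)[symmetric])
    let ?B = "SIGMA t:{k..T}. {..<n (Suc t)}"
    let ?A = "(\<lambda>p. h (prod_encode p)) ` ?B"
    have entry_eq: "stage k U t (stage_diff k U t z) = (\<Oplus>\<^bsub>?L\<^esub>c\<in>{..<n (Suc t)}.
        entry (stage_diff k U t z) t c \<odot>\<^bsub>?L\<^esub> generator k U (Suc t) c)" if "k \<le> t" for t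
      unfolding stage_def
      by (rule incl_eq_sum) (use entry_block[of k U "stage_diff k U t z" t] d[OF that] that in auto)
    let ?g = "\<lambda>p. entry (stage_diff k U (fst p) z) (fst p) (snd p) \<odot>\<^bsub>?L\<^esub> generator k U (Suc (fst p)) (snd p)"
    have gc: "?g p \<in> carrier ?L" if "k \<le> fst p" for p
    proof (rule L.smult_closed)
      show "entry (stage_diff k U (fst p) z) (fst p) (snd p) \<in> carrier R"
        using coherentD(1) d[OF that] by simp
      show "generator k U (Suc (fst p)) (snd p) \<in> carrier ?L" using generator_carrier that by simp
    qed
    have "z = (\<Oplus>\<^bsub>?L\<^esub>t\<in>{k..T}. stage k U t (stage_diff k U t z))"
      using stage_telescope[OF z T(1)] T(2)[OF order_refl] by (simp del: limit_module_simps)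
    also have "\<dots> = (\<Oplus>\<^bsub>?L\<^esub>t\<in>{k..T}. finsum ?L ?g (Pair t ` {..<n (Suc t)}))"
    proof (rule L.M.finsum_cong')
      have c: "finsum ?L ?g (Pair t ` {..<n (Suc t)}) \<in> carrier ?L" if "k \<le> t" for t
        using gc that by (intro L.M.finsum_closed) (auto simp del: limit_module_simps)
      then show "(\<lambda>t. finsum ?L ?g (Pair t ` {..<n (Suc t)})) \<in> {k..T} \<rightarrow> carrier ?L"
        by (auto simp del: limit_module_simps)
      fix t assume t: "t \<in> {k..T}"
      have "finsum ?L ?g (Pair t ` {..<n (Suc t)}) = (\<Oplus>\<^bsub>?L\<^esub>c\<in>{..<n (Suc t)}. ?g (t, c))"
        by (rule L.M.finsum_reindex) (use gc t in \<open>auto simp: inj_on_def simp del: limit_module_simps\<close>)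
      then show "stage k U t (stage_diff k U t z) = finsum ?L ?g (Pair t ` {..<n (Suc t)})"
        using entry_eq t by simp
    qed simp
    also have "\<dots> = finsum ?L ?g (\<Union>t\<in>{k..T}. Pair t ` {..<n (Suc t)})"
      by (rule L.M.add.finprod_UN_disjoint[symmetric])
        (use gc in \<open>auto simp: pairwise_def disjnt_def simp del: limit_module_simps\<close>)
    also have "(\<Union>t\<in>{k..T}. Pair t ` {..<n (Suc t)}) = ?B" by auto
    also have "finsum ?L ?g ?B = (\<Oplus>\<^bsub>?L\<^esub>p\<in>?B. f (h (prod_encode p)) z \<odot>\<^bsub>?L\<^esub> e (h (prod_encode p)))"
      by (rule L.M.finsum_cong') (use gc in \<open>auto simp: f_def e_def ix simp del: limit_module_simps\<close>)
    also have "\<dots> = (\<Oplus>\<^bsub>?L\<^esub>y\<in>?A. f y z \<odot>\<^bsub>?L\<^esub> e y)"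
      by (rule L.M.finsum_reindex[symmetric, OF _ inj'])
        (use gc in \<open>auto simp: f_def e_def ix simp del: limit_module_simps\<close>)
    finally have "z = (\<Oplus>\<^bsub>?L\<^esub>y\<in>?A. f y z \<odot>\<^bsub>?L\<^esub> e y)" .
    moreover have "finite ?A" by auto
    moreover have "?A \<subseteq> Y" by (auto simp: Y_def)
    moreover have "f y z = \<zero>" if y: "y \<in> Y - ?A" for y
    proof -
      obtain t c where tc: "k \<le> t" "y = h (prod_encode (t, c))" using y by (auto simp: Y_def)
      have "T < t \<or> n (Suc t) \<le> c"
      proof (rule ccontr)
        assume "\<not> ?thesis"
        then have "(t, c) \<in> ?B" using tc(1) by auto
        then show False using y tc(2) by blast
      qed
      then have "entry (stage_diff k U t z) t c = \<zero>"
      proof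
        assume t: "T < t"
        then have "stage k U (t - 1) z = z" using T(2)[of "t - 1"] by simp
        then have "stage_diff k U t z = (\<lambda>j. z j \<oplus> z j \<otimes> \<ominus> \<one>)"
          using t T(1) by (auto simp: stage_diff_def)
        then have "stage_diff k U t z = (\<lambda>_. \<zero>)"
          using limit_carrier[OF z] by (auto simp: r_minus r_neg)
        then show ?thesis by simp
      next
        assume "n (Suc t) \<le> c"
        then show ?thesis using coherent_beyond d[OF tc(1)] by simp
      qed
      then show ?thesis by (simp add: f_def tc(2) ix)
    qed
    ultimately show "\<exists>A. finite A \<and> A \<subseteq> Y \<and> (\<forall>y\<in>Y - A. f y z = \<zero>) \<and>
      z = (\<Oplus>\<^bsub>?L\<^esub>y\<in>A. f y z \<odot>\<^bsub>?L\<^esub> e y)"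
      by (intro exI[of _ ?A] conjI ballI)
  qed
qed

section \<open>The trace ideal of the limit\<close>

lemma entry_level:
  assumes z: "coherent k U (entry z)" and U: "\<And>u. \<lbrakk>u \<in> U; u < n k\<rbrakk> \<Longrightarrow> j \<le> level n u"
  shows "entry z t c \<in> I j"
proof (cases "t < k \<or> c mod n k \<notin> U")
  case True
  then have "entry z t c = \<zero>" using coherentD(2,4)[OF z] by (cases "t < k") auto
  then show ?thesis by (simp add: I_zero)
next
  case False
  then have "j \<le> level n (c mod n k)" using U n_positive by simp
  then have "j \<le> level n c" using level_mod[of c "n k"] by simp
  then show ?thesis using coherent_in[OF z, of t c] I_mono by blast
qed

text \<open>An element is a combination of generators with its entries as coefficients, and these
  lie in \<open>I j\<close>; so do its images under all functionals. Conversely the entries of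
  column \<open>u\<close> of \<open>A\<^sub>k\<close> generate the left ideal \<open>I j\<close>,
  and they are the coordinates of a single generator.\<close>

lemma limit_trace:
  assumes U: "\<And>u. \<lbrakk>u \<in> U; u < n k\<rbrakk> \<Longrightarrow> j \<le> level n u"
    and u: "u \<in> U" "u < n k" "level n u = j"
  shows "trace_ideal R (limit_module k U) = I j"
proof
  let ?L = "limit_module k U"
  let ?G = "\<Union>f\<in>module_hom R ?L (regular_right R). f ` carrier ?L"
  have rr: "right_module R (regular_right R)" by (rule regular_right_module)
  interpret L: right_module R ?L by (rule limit_right_module)
  have sgI: "subgroup (I j) (add_monoid R)"
    using ideal.axioms(1)[OF ideal_I] by (simp add: additive_subgroup_def)
  have "?G \<subseteq> I j"
  proof clarify
    fix f z assume f: "f \<in> module_hom R ?L (regular_right R)" and z: "z \<in> carrier ?L"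
    have zc: "coherent k U (entry z)" using z by simp
    obtain t where t: "t \<ge> k" "z = incl k U (Suc t) (entry z t)"
      using eventually_incl[OF z, of 0] by blast
    have "z = (\<Oplus>\<^bsub>?L\<^esub>c\<in>{..<n (Suc t)}. entry z t c \<odot>\<^bsub>?L\<^esub> generator k U (Suc t) c)"
      using incl_eq_sum[OF _ entry_block[OF zc t(1)], of "Suc t"] t by simp
    then have "f z = f (\<Oplus>\<^bsub>?L\<^esub>c\<in>{..<n (Suc t)}. entry z t c \<odot>\<^bsub>?L\<^esub> generator k U (Suc t) c)" by simp
    also have "\<dots> = (\<Oplus>c\<in>{..<n (Suc t)}. f (entry z t c \<odot>\<^bsub>?L\<^esub> generator k U (Suc t) c))"
      unfolding finsum_regular_right[of R, symmetric]
      by (rule module_hom_finsum[OF L.right_module_axioms rr f])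
        (use L.smult_closed coherentD(1)[OF zc] generator_carrier[of k "Suc t" U] t(1)
          in \<open>auto simp del: limit_module_simps\<close>)
    also have "\<dots> \<in> I j"
    proof (rule I_finsum)
      fix c
      have "generator k U (Suc t) c \<in> carrier ?L" using generator_carrier t(1) by simp
      then have "f (entry z t c \<odot>\<^bsub>?L\<^esub> generator k U (Suc t) c) = f (generator k U (Suc t) c) \<otimes> entry z t c"
        "f (generator k U (Suc t) c) \<in> carrier R"
        using module_hom_smult[OF f coherentD(1)[OF zc]] module_hom_closed[OF f]
        by (simp_all del: limit_module_simps)
      then show "f (entry z t c \<odot>\<^bsub>?L\<^esub> generator k U (Suc t) c) \<in> I j"
        using I_lmult entry_level[OF zc U] by simp
    qed
    finally show "f z \<in> I j" .
  qed
  then show "trace_ideal R ?L \<subseteq> I j" unfolding trace_ideal_def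
    by (rule group.generate_subgroup_incl[OF a_group _ sgI])
  have "?G \<subseteq> carrier (add_monoid R)" using module_hom_closed by fastforce
  then have sgT: "subgroup (trace_ideal R ?L) (add_monoid R)" unfolding trace_ideal_def
    by (rule group.generate_is_subgroup[OF a_group])
  let ?D = "{c. c < n (Suc k) \<and> c mod n k = u}"
  show "I j \<subseteq> trace_ideal R ?L"
  proof
    fix x assume "x \<in> I j"
    then obtain q where q: "q \<in> ?D \<rightarrow> carrier R" "x = (\<Oplus>d\<in>?D. q d \<otimes> a k d)"
      using a_gen[OF u(2), of x] u(3) unfolding left_span_def by auto
    have g: "generator k U k u \<in> carrier ?L" by (rule generator_carrier) simp
    have "q d \<otimes> a k d \<in> trace_ideal R ?L" if d: "d \<in> ?D" for d
    proof -
      have qd: "q d \<in> carrier R" using q(1) d by auto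
      \<comment> \<open>Left multiplication commutes with the right action, so a left multiple of a
        coordinate is again a functional.\<close>
      have "(\<lambda>z. q d \<otimes> entry z k d) \<in> module_hom R ?L (regular_right R)"
        by (rule module_homI) (use qd coherentD(1) in \<open>auto simp: r_distr m_assoc\<close>)
      moreover have "entry (generator k U k u) k d = a k d"
        using incl_at[OF order_refl unit_vector_block, of k U u d] d u(1,2) a_carrier
        by (auto simp: generator_def A_def unit_vector_def)
      ultimately have "q d \<otimes> a k d \<in> ?G"
        using g by (intro UN_I[of "\<lambda>z. q d \<otimes> entry z k d"] image_eqI[of _ _ "generator k U k u"]) simp_all
      then show ?thesis unfolding trace_ideal_def by (rule generate.incl)
    qed
    then show "x \<in> trace_ideal R ?L" unfolding q(2) by (rule finsum_in_subgroup[OF sgT])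
  qed
qed

end

section \<open>Quotients of the limit\<close>

lemma times_ideal_subgroup:
  assumes "right_module R P" "ideal J R" shows "subgroup (module_times_ideal P J) (add_monoid P)"
proof -
  interpret right_module R P by fact
  have "{r \<odot>\<^bsub>P\<^esub> x | r x. r \<in> J \<and> x \<in> carrier P} \<subseteq> carrier (add_monoid P)"
    using smult_closed ideal.Icarr[OF assms(2)] by auto
  then show ?thesis unfolding module_times_ideal_def by (rule group.generate_is_subgroup[OF M.a_group])
qed

lemma times_ideal_incl: "\<lbrakk>r \<in> J; x \<in> carrier P\<rbrakk> \<Longrightarrow> r \<odot>\<^bsub>P\<^esub> x \<in> module_times_ideal P J"
  unfolding module_times_ideal_def by (rule generate.incl) auto

lemma times_ideal_least:
  assumes "right_module R P" "subgroup H (add_monoid P)"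
    "\<And>r x. \<lbrakk>r \<in> J; x \<in> carrier P\<rbrakk> \<Longrightarrow> r \<odot>\<^bsub>P\<^esub> x \<in> H"
  shows "module_times_ideal P J \<subseteq> H"
proof -
  interpret right_module R P by fact
  show ?thesis unfolding module_times_ideal_def
    by (rule group.generate_subgroup_incl[OF M.a_group _ assms(2)]) (use assms(3) in auto)
qed

lemma times_ideal_submodule:
  assumes P: "right_module R P" and J: "ideal J R" shows "submodule (module_times_ideal P J) R P"
proof -
  interpret right_module R P by fact
  let ?N = "module_times_ideal P J"
  have sg: "subgroup ?N (add_monoid P)" by (rule times_ideal_subgroup[OF P J])
  interpret N: subgroup ?N "add_monoid P" by (rule sg)
  have "r \<odot>\<^bsub>P\<^esub> x \<in> ?N" if r: "r \<in> carrier R" and x: "x \<in> ?N" for r x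
  proof -
    let ?H = "{x \<in> carrier P. r \<odot>\<^bsub>P\<^esub> x \<in> ?N}"
    have "?N \<subseteq> ?H"
    proof (rule times_ideal_least[OF P])
      show "subgroup ?H (add_monoid P)"
      proof (rule M.submoduleI_gen)
        show "x \<oplus>\<^bsub>P\<^esub> y \<in> ?H" if "x \<in> ?H" "y \<in> ?H" for x y
          using that r N.m_closed by (simp add: smult_add_module)
        show "\<ominus>\<^bsub>P\<^esub> x \<in> ?H" if "x \<in> ?H" for x
          using that r N.m_inv_closed[folded a_inv_def] by (simp add: smult_minus)
      qed (use r N.one_closed in \<open>auto simp: smult_zero\<close>)
      show "s \<odot>\<^bsub>P\<^esub> x \<in> ?H" if "s \<in> J" "x \<in> carrier P" for s x
      proof -
        have sR: "s \<in> carrier R" using ideal.Icarr[OF J] that by blast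
        have "r \<odot>\<^bsub>P\<^esub> (s \<odot>\<^bsub>P\<^esub> x) = (s \<otimes>\<^bsub>R\<^esub> r) \<odot>\<^bsub>P\<^esub> x"
          using smult_assoc[OF sR r] that by simp
        also have "\<dots> \<in> ?N" using that r by (intro times_ideal_incl) (auto intro: ideal.I_r_closed[OF J])
        finally show ?thesis using that sR smult_closed by simp
      qed
    qed
    then show ?thesis using x by blast
  qed
  then show ?thesis using sg by (simp add: submodule_def submodule_axioms_def)
qed

lemma module_hom_times_ideal:
  assumes P: "right_module R P" and Q: "right_module R Q" and J: "ideal J R"
    and f: "f \<in> module_hom R P Q" and x: "x \<in> module_times_ideal P J"
  shows "f x \<in> module_times_ideal Q J"
proof -
  interpret P: right_module R P by fact
  interpret N: subgroup "module_times_ideal Q J" "add_monoid Q" by (rule times_ideal_subgroup[OF Q J])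
  let ?H = "{x \<in> carrier P. f x \<in> module_times_ideal Q J}"
  have "module_times_ideal P J \<subseteq> ?H"
  proof (rule times_ideal_least[OF P])
    show "subgroup ?H (add_monoid P)"
    proof (rule P.M.submoduleI_gen)
      show "x \<oplus>\<^bsub>P\<^esub> y \<in> ?H" if "x \<in> ?H" "y \<in> ?H" for x y
        using that N.m_closed by (simp add: module_hom_add[OF f])
      show "\<ominus>\<^bsub>P\<^esub> x \<in> ?H" if "x \<in> ?H" for x
        using that N.m_inv_closed[folded a_inv_def] by (simp add: module_hom_minus[OF P Q f])
    qed (use N.one_closed module_hom_zero[OF P Q f] in auto)
    show "r \<odot>\<^bsub>P\<^esub> x \<in> ?H" if "r \<in> J" "x \<in> carrier P" for r x
    proof -
      have rR: "r \<in> carrier R" using ideal.Icarr[OF J] that by blast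
      then show ?thesis using that times_ideal_incl[of r J "f x" Q] module_hom_closed[OF f]
        by (simp add: module_hom_smult[OF f] P.smult_closed)
    qed
  qed
  then show ?thesis using x by blast
qed

text \<open>If \<open>P = Y\<^sub>1 R + P J\<^sub>1\<close> and \<open>P = Y\<^sub>2 R + P J\<^sub>2\<close>, then
  \<open>P = Y\<^sub>2 R + (Y\<^sub>1 R + P J\<^sub>1) J\<^sub>2\<close>.\<close>

lemma fg_quotient_ideals_inter:
  fixes P :: "('a, 'b) module"
  assumes P: "right_module R P" and J: "J1 \<in> fg_quotient_ideals R P" "J2 \<in> fg_quotient_ideals R P"
  shows "J1 \<inter> J2 \<in> fg_quotient_ideals R P"
proof -
  interpret P: right_module R P by fact
  have J1: "ideal J1 R" and J2: "ideal J2 R" using J by (auto simp: fg_quotient_ideals_def)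
  have J12: "ideal (J1 \<inter> J2) R" by (rule P.R.i_intersect[OF J1 J2])
  obtain Y1 where Y1: "finite Y1" "Y1 \<subseteq> carrier P"
    "\<forall>H. submodule H R P \<and> Y1 \<union> module_times_ideal P J1 \<subseteq> H \<longrightarrow> carrier P \<subseteq> H"
    using J(1) finitely_generated_quotient_iff[OF P times_ideal_submodule[OF P J1]]
    unfolding fg_quotient_ideals_def by auto
  obtain Y2 where Y2: "finite Y2" "Y2 \<subseteq> carrier P"
    "\<forall>H. submodule H R P \<and> Y2 \<union> module_times_ideal P J2 \<subseteq> H \<longrightarrow> carrier P \<subseteq> H"
    using J(2) finitely_generated_quotient_iff[OF P times_ideal_submodule[OF P J2]]
    unfolding fg_quotient_ideals_def by auto
  have "carrier P \<subseteq> H" if H: "submodule H R P" and sub: "(Y1 \<union> Y2) \<union> module_times_ideal P (J1 \<inter> J2) \<subseteq> H" for H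
  proof -
    interpret H: submodule H R P by (rule H)
    have Hc: "x \<in> carrier P" if "x \<in> H" for x using H.subset that by auto
    have J2R: "r \<in> carrier R" if "r \<in> J2" for r using ideal.Icarr[OF J2 that] .
    \<comment> \<open>The elements \<open>x\<close> with \<open>x J2 \<subseteq> H\<close>. They
      contain \<open>P J1\<close> because \<open>J1 J2 \<subseteq> J1 \<inter> J2\<close>.\<close>
    let ?K = "{x \<in> carrier P. \<forall>r\<in>J2. r \<odot>\<^bsub>P\<^esub> x \<in> H}"
    have K: "submodule ?K R P"
    proof (rule P.submoduleI)
      show "x \<oplus>\<^bsub>P\<^esub> y \<in> ?K" if "x \<in> ?K" "y \<in> ?K" for x y
        using that J2R H.m_closed by (simp add: P.smult_add_module)
      show "s \<odot>\<^bsub>P\<^esub> x \<in> ?K" if "s \<in> carrier R" "x \<in> ?K" for s x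
        using that J2R ideal.I_l_closed[OF J2] by (simp add: P.smult_assoc P.smult_closed)
    qed (use J2R H.one_closed in \<open>auto simp: P.smult_zero\<close>)
    have "carrier P \<subseteq> ?K"
    proof (rule Y1(3)[rule_format], rule conjI[OF K])
      have "Y1 \<subseteq> ?K" using Y1(2) sub J2R H.smult_closed by blast
      moreover have "module_times_ideal P J1 \<subseteq> ?K"
      proof (rule times_ideal_least[OF P submodule.axioms(1)[OF K]])
        fix s x assume s: "s \<in> J1" and x: "x \<in> carrier P"
        have sR: "s \<in> carrier R" using ideal.Icarr[OF J1 s] .
        have "r \<odot>\<^bsub>P\<^esub> (s \<odot>\<^bsub>P\<^esub> x) \<in> H" if r: "r \<in> J2" for r
        proof -
          have "s \<otimes>\<^bsub>R\<^esub> r \<in> J1 \<inter> J2"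
            using ideal.I_r_closed[OF J1 s J2R[OF r]] ideal.I_l_closed[OF J2 r sR] by simp
          from times_ideal_incl[OF this x] show ?thesis
            using P.smult_assoc[OF sR J2R[OF r] x] sub by auto
        qed
        then show "s \<odot>\<^bsub>P\<^esub> x \<in> ?K" using P.smult_closed[OF sR x] by simp
      qed
      ultimately show "Y1 \<union> module_times_ideal P J1 \<subseteq> ?K" by (rule Un_least)
    qed
    then have "module_times_ideal P J2 \<subseteq> H"
      by (intro times_ideal_least[OF P submodule.axioms(1)[OF H]]) auto
    then show ?thesis using Y2(3) H sub by blast
  qed
  moreover have "finite (Y1 \<union> Y2)" "Y1 \<union> Y2 \<subseteq> carrier P" using Y1 Y2 by auto
  ultimately have "finitely_generated R (quotient_module P (module_times_ideal P (J1 \<inter> J2)))"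
    unfolding finitely_generated_quotient_iff[OF P times_ideal_submodule[OF P J12]]
    by (intro exI[of _ "Y1 \<union> Y2"]) auto
  then show ?thesis using J12 by (simp add: fg_quotient_ideals_def)
qed

context tower
begin

section \<open>Congruences between the entries of an element\<close>

lemma limit_entry_carrier: "z \<in> carrier (limit_module k U) \<Longrightarrow> entry z t c \<in> carrier R"
  using coherentD(1)[of k U "entry z"] by simp

lemma I_cong_trans:
  assumes "x \<ominus> y \<in> I i" "y \<ominus> z \<in> I i" "x \<in> carrier R" "y \<in> carrier R" "z \<in> carrier R"
  shows "x \<ominus> z \<in> I i"
proof -
  have "(x \<ominus> y) \<oplus> (y \<ominus> z) = x \<oplus> (\<ominus> y \<oplus> y) \<oplus> \<ominus> z"
    using assms(3-5) by (simp add: minus_eq a_assoc)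
  also have "\<dots> = x \<ominus> z" using assms(3-5) by (simp add: minus_eq l_neg)
  finally show ?thesis using I_add[OF assms(1,2)] by simp
qed

lemma I_cong_sym:
  assumes "x \<ominus> y \<in> I i" "x \<in> carrier R" "y \<in> carrier R" shows "y \<ominus> x \<in> I i"
proof -
  have "y \<ominus> x = \<zero> \<ominus> (x \<ominus> y)" using assms(2,3) by (simp add: minus_eq minus_add a_comm)
  then show ?thesis using I_minus[OF I_zero assms(1)] by simp
qed

lemma I_cong_lmult:
  assumes "x \<ominus> y \<in> I i" "x \<in> carrier R" "y \<in> carrier R" "q \<in> carrier R"
  shows "q \<otimes> x \<ominus> q \<otimes> y \<in> I i"
proof -
  have "q \<otimes> x \<ominus> q \<otimes> y = q \<otimes> (x \<ominus> y)" using assms(2-4) by (simp add: minus_eq r_distr r_minus)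
  then show ?thesis using I_lmult[OF assms(4,1)] by simp
qed

lemma I_cong_in:
  assumes "x \<ominus> y \<in> I i" "x \<in> carrier R" "y \<in> I i" shows "x \<in> I i"
proof -
  have "x = (x \<ominus> y) \<oplus> y" using assms(2) I_carrier[OF assms(3)] by (simp add: minus_eq a_assoc l_neg)
  then show ?thesis using I_add[OF assms(1,3)] by simp
qed

lemma I_cong_finsum:
  assumes "\<And>d. d \<in> D \<Longrightarrow> f d \<ominus> g d \<in> I i" "\<And>d. d \<in> D \<Longrightarrow> f d \<in> carrier R" "\<And>d. d \<in> D \<Longrightarrow> g d \<in> carrier R"
  shows "(\<Oplus>d\<in>D. f d) \<ominus> (\<Oplus>d\<in>D. g d) \<in> I i"
  using assms
proof (induction D rule: infinite_finite_induct)
  case (insert x F)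
  have "(\<Oplus>d\<in>insert x F. f d) \<ominus> (\<Oplus>d\<in>insert x F. g d)
      = (f x \<oplus> (\<Oplus>d\<in>F. f d)) \<ominus> (g x \<oplus> (\<Oplus>d\<in>F. g d))"
    using insert by (subst (1 2) finsum_insert) auto
  also have "\<dots> = (f x \<ominus> g x) \<oplus> ((\<Oplus>d\<in>F. f d) \<ominus> (\<Oplus>d\<in>F. g d))"
    using insert by (simp add: minus_eq minus_add a_ac)
  also have "\<dots> \<in> I i" using insert by (intro I_add) auto
  finally show ?case .
qed (simp_all add: minus_eq I_zero)

text \<open>Below \<open>n t\<close> the matrix entry is a left identity modulo
  \<open>I (Suc t)\<close>. From \<open>n t\<close> on the level exceeds \<open>t\<close>, and both
  terms lie in \<open>I (Suc t)\<close>.\<close>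

lemma A_cong:
  assumes y: "\<And>c. y c \<in> I (level n c)" shows "A t y c \<ominus> y c \<in> I (Suc t)"
proof (cases "c < n t")
  case True then show ?thesis using a_id[OF True y] by (simp add: A_def)
next
  case False
  then have "I (level n c) \<subseteq> I (Suc t)" using level_ge[of t c] by (intro I_mono) auto
  then show ?thesis using A_in[of y t c] y[of c] I_carrier[OF y] by (intro I_minus) auto
qed

text \<open>For \<open>v = Z (Suc t)\<close> the vector
  \<open>A\<^sub>t\<^sub>+\<^sub>1 A\<^sub>t v\<close> is congruent to \<open>v\<close>. Applying
  \<open>C\<^sub>t\<close> gives \<open>A\<^sub>t v\<close> on one side and
  \<open>C\<^sub>t v = Z t\<close> on the other, while \<open>A\<^sub>t v\<close> is itself
  congruent to \<open>v\<close>.\<close>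

lemma entry_stable:
  assumes Z: "coherent k U Z" and t: "k \<le> t"
  shows "Z (Suc t) c \<ominus> Z t c \<in> I (Suc t)"
proof -
  let ?v = "Z (Suc t)"
  have v: "?v c \<in> I (level n c)" for c by (rule coherent_in[OF Z])
  note vR = I_carrier[OF v]
  have At: "A t ?v c \<in> I (level n c)" for c by (rule A_in[OF vR])
  note AtR = I_carrier[OF At]
  have AA: "A (Suc t) (A t ?v) d \<ominus> ?v d \<in> I (Suc t)" for d
  proof (rule I_cong_trans)
    show "A (Suc t) (A t ?v) d \<ominus> A t ?v d \<in> I (Suc t)"
      using A_cong[OF At, of "Suc t" d] I_dec[of "Suc t"] by blast
    show "A t ?v d \<ominus> ?v d \<in> I (Suc t)" by (rule A_cong[OF v])
  qed (use AtR vR A_carrier in auto)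
  have "C t (A (Suc t) (A t ?v)) c \<ominus> C t ?v c \<in> I (Suc t)"
    unfolding C_def
    by (intro I_cong_finsum I_cong_lmult AA m_closed r_carrier A_carrier AtR vR)
  then have 1: "A t ?v c \<ominus> Z t c \<in> I (Suc t)"
    using CAA[of ?v t c, OF vR] coherentD(3)[OF Z t, of c] by simp
  have 2: "?v c \<ominus> A t ?v c \<in> I (Suc t)"
    by (rule I_cong_sym[OF A_cong[OF v]]) (use AtR vR in auto)
  show ?thesis by (rule I_cong_trans[OF 2 1]) (use AtR vR coherentD(1)[OF Z] in auto)
qed

text \<open>Coordinates of higher level lie in \<open>I (Suc t)\<close> anyway, and later stages are
  congruent to stage \<open>t\<close>. So the \<open>n t\<close> coordinates at stage
  \<open>t\<close> decide about all later entries.\<close>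

lemma entry_stable_in:
  assumes Z: "coherent k U Z" and t: "k \<le> t" and in_I: "\<And>c. c < n t \<Longrightarrow> Z t c \<in> I (Suc t)" and "t \<le> t'"
  shows "Z t' c \<in> I (Suc t)"
  using assms(4)
proof (induction t' arbitrary: c rule: dec_induct)
  case base
  show ?case
  proof (cases "c < n t")
    case False
    then have "I (level n c) \<subseteq> I (Suc t)" using level_ge[of t c] by (intro I_mono) auto
    then show ?thesis using coherent_in[OF Z, of t c] by blast
  qed (rule in_I)
next
  case (step s)
  have "I (Suc s) \<subseteq> I (Suc t)" using step.hyps by (intro I_mono) auto
  then have "Z (Suc s) c \<ominus> Z s c \<in> I (Suc t)" using entry_stable[OF Z, of s c] t step.hyps by auto
  then show ?case by (rule I_cong_in[OF _ coherentD(1)[OF Z] step.IH])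
qed

text \<open>At a late stage \<open>z\<close> is the combination of generators whose coefficients are
  its entries. Together with \<open>times_idealD\<close>, this describes the submodule
  \<open>P J\<close> by entries.\<close>

lemma times_idealI:
  assumes J: "ideal J R" and z: "z \<in> carrier (limit_module k U)"
    and in_J: "\<And>t c. T \<le> t \<Longrightarrow> entry z t c \<in> J"
  shows "z \<in> module_times_ideal (limit_module k U) J"
proof -
  let ?L = "limit_module k U"
  interpret L: right_module R ?L by (rule limit_right_module)
  have zc: "coherent k U (entry z)" using z by simp
  obtain t where t: "t \<ge> T" "t \<ge> k" "z = incl k U (Suc t) (entry z t)"
    using eventually_incl[OF z, of T] by blast
  have "z = (\<Oplus>\<^bsub>?L\<^esub>c\<in>{..<n (Suc t)}. entry z t c \<odot>\<^bsub>?L\<^esub> generator k U (Suc t) c)"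
    using incl_eq_sum[OF _ entry_block[OF zc t(2)], of "Suc t"] t(2,3) by simp
  also have "\<dots> \<in> module_times_ideal ?L J"
    by (rule L.finsum_in_submodule[OF times_ideal_submodule[OF limit_right_module J]])
      (intro times_ideal_incl in_J t(1) generator_carrier le_SucI[OF t(2)])
  finally show ?thesis .
qed

lemma times_idealD:
  assumes J: "ideal J R" and z: "z \<in> module_times_ideal (limit_module k U) J"
  shows "z \<in> carrier (limit_module k U)" "entry z t c \<in> J"
proof -
  let ?L = "limit_module k U"
  interpret L: right_module R ?L by (rule limit_right_module)
  interpret J: ideal J R by (rule J)
  let ?H = "{z \<in> carrier ?L. entry z t c \<in> J}"
  have "submodule ?H R ?L"
    by (rule L.submoduleI)
      (auto simp: coherent_zero coherent_add coherent_mult J.I_r_closed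
        additive_subgroup.zero_closed[OF J.is_additive_subgroup] additive_subgroup.a_closed[OF J.is_additive_subgroup])
  then have "module_times_ideal ?L J \<subseteq> ?H"
  proof (intro times_ideal_least[OF limit_right_module] submodule.axioms(1))
    fix r x assume "r \<in> J" "x \<in> carrier ?L"
    then show "r \<odot>\<^bsub>?L\<^esub> x \<in> ?H"
      using J.Icarr J.I_l_closed by (auto simp: coherent_mult coherentD(1))
  qed
  then show "z \<in> carrier ?L" "entry z t c \<in> J" using z by auto
qed

lemma limit_minus:
  assumes "y \<in> carrier (limit_module k U)" "z \<in> carrier (limit_module k U)"
  shows "entry (y \<ominus>\<^bsub>limit_module k U\<^esub> z) t c = entry y t c \<ominus> entry z t c"
  using module_hom_add[OF entry_hom assms(1), of "\<ominus>\<^bsub>limit_module k U\<^esub> z" t c]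
    module_hom_minus[OF limit_right_module regular_right_module entry_hom assms(2), of t c]
    abelian_group.a_inv_closed[OF right_module.axioms(2)[OF limit_right_module] assms(2)]
  by (simp add: a_minus_def a_inv_def regular_right_def m_inv_def del: limit_module_simps)

lemma limit_minus_closed:
  "\<lbrakk>y \<in> carrier (limit_module k U); z \<in> carrier (limit_module k U)\<rbrakk>
    \<Longrightarrow> y \<ominus>\<^bsub>limit_module k U\<^esub> z \<in> carrier (limit_module k U)"
  by (rule abelian_group.minus_closed[OF right_module.axioms(2)[OF limit_right_module]])

text \<open>The entry at \<open>t\<close> is a vector of \<open>F\<^sub>t\<^sub>+\<^sub>1\<close>,
  here truncated to \<open>F\<^sub>t\<close>. The discarded coordinates lie in
  \<open>I (Suc t)\<close>, and on the others \<open>A\<^sub>t\<close> is the identity modulo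
  \<open>I (Suc t)\<close>. So the \<open>n t\<close> generators of stage \<open>t\<close> suffice
  modulo \<open>P I (Suc t)\<close>.\<close>

lemma incl_approx:
  assumes z: "z \<in> carrier (limit_module k U)" and t: "k \<le> t"
  shows "z \<ominus>\<^bsub>limit_module k U\<^esub> incl k U t (entry z t) \<in> module_times_ideal (limit_module k U) (I (Suc t))"
proof -
  let ?L = "limit_module k U" and ?w = "incl k U t (entry z t)"
  have zc: "coherent k U (entry z)" using z by simp
  have eb: "entry z t \<in> block_vectors k U" by (rule entry_block[OF zc t])
  have w: "?w \<in> carrier ?L" using incl(1)[OF t eb] by simp
  have d: "z \<ominus>\<^bsub>?L\<^esub> ?w \<in> carrier ?L" by (rule limit_minus_closed[OF z w])
  show ?thesis
  proof (rule times_idealI[OF ideal_I d, where T = t])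
    fix t' c assume "t \<le> t'"
    show "entry (z \<ominus>\<^bsub>?L\<^esub> ?w) t' c \<in> I (Suc t)"
    proof (rule entry_stable_in[OF _ t _ \<open>t \<le> t'\<close>])
      show "coherent k U (entry (z \<ominus>\<^bsub>?L\<^esub> ?w))" using d by simp
      fix c assume "c < n t"
      have "entry z t c \<ominus> A t (entry z t) c \<in> I (Suc t)"
        by (rule I_cong_sym[OF A_cong]) (use coherent_in[OF zc] coherentD(1)[OF zc] A_carrier in auto)
      then show "entry (z \<ominus>\<^bsub>?L\<^esub> ?w) t c \<in> I (Suc t)"
        using limit_minus[OF z w] incl_at[OF t eb] by simp
    qed
  qed
qed

text \<open>For \<open>i = 0\<close> the quotient vanishes, as all entries lie in
  \<open>I 0\<close>. For \<open>i = Suc t\<close> it is generated by the generators of stage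
  \<open>t\<close>.\<close>

lemma I_fg_quotient: "I i \<in> fg_quotient_ideals R (limit_module 0 U)"
proof -
  let ?L = "limit_module 0 U"
  interpret L: right_module R ?L by (rule limit_right_module)
  have "\<exists>Y. finite Y \<and> Y \<subseteq> carrier ?L \<and>
    (\<forall>H. submodule H R ?L \<and> Y \<union> module_times_ideal ?L (I i) \<subseteq> H \<longrightarrow> carrier ?L \<subseteq> H)"
  proof (cases i)
    case 0
    have "carrier ?L \<subseteq> module_times_ideal ?L (I 0)"
    proof
      fix z assume z: "z \<in> carrier ?L"
      then show "z \<in> module_times_ideal ?L (I 0)"
        by (rule times_idealI[OF ideal_I, where T = 0]) (use z entry_level[of 0 U z 0] in auto)
    qed
    then show ?thesis using 0 by (intro exI[of _ "{}"]) auto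
  next
    case (Suc t)
    let ?Y = "generator 0 U t ` {..<n t}"
    have "carrier ?L \<subseteq> H" if H: "submodule H R ?L" and Y: "?Y \<union> module_times_ideal ?L (I (Suc t)) \<subseteq> H" for H
    proof
      fix z assume z: "z \<in> carrier ?L"
      have zc: "coherent 0 U (entry z)" using z by simp
      have eb: "entry z t \<in> block_vectors 0 U" by (rule entry_block[OF zc]) simp
      have w: "incl 0 U t (entry z t) \<in> carrier ?L" using incl(1)[OF _ eb] by simp
      have "incl 0 U t (entry z t) = (\<Oplus>\<^bsub>?L\<^esub>c\<in>{..<n t}. entry z t c \<odot>\<^bsub>?L\<^esub> generator 0 U t c)"
        by (rule incl_eq_sum[OF _ eb]) simp
      also have "\<dots> \<in> H"
        using Y submodule.smult_closed[OF H] coherentD(1)[OF zc]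
        by (intro L.finsum_in_submodule[OF H]) auto
      finally have 1: "incl 0 U t (entry z t) \<in> H" .
      have "z \<ominus>\<^bsub>?L\<^esub> incl 0 U t (entry z t) \<in> H" using incl_approx[OF z, of t] Y by auto
      from subgroup.m_closed[OF submodule.axioms(1)[OF H] this 1]
      show "z \<in> H" using z w by (simp add: a_minus_def L.M.a_assoc L.M.l_neg del: limit_module_simps)
    qed
    moreover have "?Y \<subseteq> carrier ?L" using generator_carrier[of 0 t U] by auto
    ultimately show ?thesis unfolding Suc by (intro exI[of _ ?Y]) auto
  qed
  then show ?thesis
    using ideal_I finitely_generated_quotient_iff[OF limit_right_module times_ideal_submodule[OF limit_right_module ideal_I]]
    by (simp add: fg_quotient_ideals_def)
qed

section \<open>Lower bounds for numbers of generators, and fair size\<close>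

text \<open>If \<open>m < n q\<close>, the entries of the \<open>x i\<close> at stage
  \<open>q\<close> and the coefficients \<open>s\<close> factor \<open>e\<close> times the unit
  matrix of size \<open>n q\<close> through size \<open>m\<close>, modulo \<open>I (Suc q)\<close>.
  The rank condition puts \<open>e\<close> into \<open>I (Suc q)\<close>, and
  \<open>I q = I (Suc q)\<close> follows since \<open>e\<close> is a left identity of
  \<open>I q\<close> modulo \<open>I (Suc q)\<close>.\<close>

lemma limit_rank:
  assumes ss: "semisimple_artinian (R Quot I (Suc q))" and strict: "I (Suc q) \<subset> I q"
    and x: "\<And>i. x i \<in> carrier (limit_module 0 UNIV)"
    and gen: "\<And>z. z \<in> carrier (limit_module 0 UNIV) \<Longrightarrow> \<exists>s. (\<forall>i. s i \<in> carrier R) \<and>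
      (\<forall>c<n q. entry z q c \<ominus> (\<Oplus>i\<in>{..<m}. entry (x i) q c \<otimes> s i) \<in> I (Suc q))"
  shows "n q \<le> m"
proof (rule ccontr)
  assume "\<not> n q \<le> m"
  then have m: "m < n q" by simp
  obtain e where e: "e \<in> I q" "\<And>x. x \<in> I q \<Longrightarrow> e \<otimes> x \<ominus> x \<in> I (Suc q)"
    and "\<And>x. x \<in> I q \<Longrightarrow> x \<otimes> e \<ominus> x \<in> I (Suc q)"
    by (rule quotient_semisimple_identity[OF ideal_I ideal_I I_dec ss]) (rule that; assumption)
  have eR: "e \<in> carrier R" by (rule I_carrier[OF e(1)])
  \<comment> \<open>Indices below \<open>n q\<close> have level at most \<open>q\<close>, so the
    coordinates of these vectors lie in the ideals of their levels and \<open>A\<^sub>q\<close>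
    fixes them modulo \<open>I (Suc q)\<close>.\<close>
  define y where "y c' c = (if c = c' then e else \<zero>)" for c' c :: nat
  have yb: "y c' \<in> block_vectors 0 UNIV" for c' using eR by (simp add: y_def block_vectors_def)
  define z where "z c' = incl 0 UNIV q (y c')" for c'
  have z: "z c' \<in> carrier (limit_module 0 UNIV)" for c' using incl(1)[OF _ yb] by (simp add: z_def)
  obtain s where s: "\<And>c' i. s c' i \<in> carrier R"
    "\<And>c' c. c < n q \<Longrightarrow> entry (z c') q c \<ominus> (\<Oplus>i\<in>{..<m}. entry (x i) q c \<otimes> s c' i) \<in> I (Suc q)"
    using gen[OF z] by metis
  have xR: "entry (x i) q c \<in> carrier R" for i c by (rule limit_entry_carrier[OF x])
  have "e \<in> I (Suc q)"
  proof (rule quotient_rank_condition[OF ideal_I ideal_I I_dec _ e, where C = "\<lambda>c i. entry (x i) q c" and B = "\<lambda>i c'. s c' i"])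
    show "artinian_module (R Quot I (Suc q)) (regular_right (R Quot I (Suc q)))"
      using ss by (simp add: semisimple_artinian_def)
    show "m < n q" by (rule m)
    fix c c' assume c: "c < n q" and "c' < n q"
    have "I q \<subseteq> I (level n c)" using c less_n_iff by (intro I_mono) auto
    then have yc: "y c' c \<in> I (level n c)" using e(1) I_zero by (auto simp: y_def)
    have "entry (z c') q c = a q c \<otimes> y c' c"
      using incl_at[of 0 q "y c'" UNIV c] yb c by (simp add: z_def A_def)
    then have 1: "entry (z c') q c \<ominus> y c' c \<in> I (Suc q)" using a_id[OF c yc] by simp
    have zR: "entry (z c') q c \<in> carrier R" by (rule limit_entry_carrier[OF z])
    have sumR: "(\<Oplus>i\<in>{..<m}. entry (x i) q c \<otimes> s c' i) \<in> carrier R"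
      using xR s(1) by (intro finsum_closed) auto
    have "(\<Oplus>i\<in>{..<m}. entry (x i) q c \<otimes> s c' i) \<ominus> y c' c \<in> I (Suc q)"
      by (rule I_cong_trans[OF I_cong_sym[OF s(2)[OF c] zR sumR] 1 sumR zR I_carrier[OF yc]])
    then show "(\<Oplus>i\<in>{..<m}. entry (x i) q c \<otimes> s c' i) \<ominus> (if c = c' then e else \<zero>) \<in> I (Suc q)"
      by (simp add: y_def)
  qed (use xR s in auto)
  have "I q \<subseteq> I (Suc q)"
  proof
    fix b assume b: "b \<in> I q"
    have bR: "b \<in> carrier R" by (rule I_carrier[OF b])
    show "b \<in> I (Suc q)"
      by (rule I_cong_in[OF I_cong_sym[OF e(2)[OF b] m_closed[OF eR bR] bR] bR I_rmult[OF \<open>e \<in> I (Suc q)\<close> bR]])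
  qed
  then show False using strict by blast
qed

lemma limit_not_fair_sized:
  assumes ss: "\<And>i. semisimple_artinian (R Quot I i)" and strict: "\<And>i. I (Suc i) \<subset> I i"
  shows "\<not> fair_sized R (limit_module 0 UNIV)"
proof
  let ?L = "limit_module 0 UNIV"
  interpret L: right_module R ?L by (rule limit_right_module)
  assume "fair_sized R ?L"
  then obtain J where J: "J \<in> fg_quotient_ideals R ?L"
    and min: "\<And>J'. \<lbrakk>J' \<in> fg_quotient_ideals R ?L; J' \<subseteq> J\<rbrakk> \<Longrightarrow> J' = J"
    unfolding fair_sized_def by blast
  have JI: "J \<subseteq> I i" for i
    using min[OF fg_quotient_ideals_inter[OF limit_right_module J I_fg_quotient[of i]]] by blast
  have Ji: "ideal J R" using J by (simp add: fg_quotient_ideals_def)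
  let ?N = "module_times_ideal ?L J"
  have N: "submodule ?N R ?L" by (rule times_ideal_submodule[OF limit_right_module Ji])
  obtain Y where Y: "finite Y" "Y \<subseteq> carrier ?L"
    "\<forall>H. submodule H R ?L \<and> Y \<union> ?N \<subseteq> H \<longrightarrow> carrier ?L \<subseteq> H"
    using J finitely_generated_quotient_iff[OF limit_right_module N]
    unfolding fg_quotient_ideals_def by auto
  have "\<exists>T. \<forall>t\<ge>T. incl 0 UNIV (Suc t) (entry y t) = y" if "y \<in> Y" for y
  proof -
    have "y \<in> carrier ?L" using Y(2) that by blast
    then obtain T where "\<And>t. t \<ge> T \<Longrightarrow> y = incl 0 UNIV (Suc t) (entry y t)"
      using eventually_incl[of y 0 UNIV 0] by blast
    then have "\<forall>t\<ge>T. incl 0 UNIV (Suc t) (entry y t) = y" by (intro allI impI) (rule sym)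
    then show ?thesis by (rule exI)
  qed
  then have "\<forall>y\<in>Y. \<exists>T. \<forall>t\<ge>T. incl 0 UNIV (Suc t) (entry y t) = y" by blast
  then obtain T where T: "\<forall>y\<in>Y. \<forall>t\<ge>T y. incl 0 UNIV (Suc t) (entry y t) = y"
    unfolding bchoice_iff by blast
  \<comment> \<open>A common stage: all of the finitely many generators come from
    \<open>F\<^sub>t\<^sub>+\<^sub>1\<close>.\<close>
  define t where "t = Max (insert 0 (T ` Y))"
  have tY: "T y \<le> t" if "y \<in> Y" for y unfolding t_def using Y(1) that by (intro Max_ge) auto
  let ?s = "Suc t"
  \<comment> \<open>The sum of the image of \<open>F\<^sub>t\<^sub>+\<^sub>1\<close> and
    \<open>P J\<close>; it contains \<open>Y\<close>, hence is everything.\<close>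
  let ?H = "{z \<in> carrier ?L. \<exists>v\<in>block_vectors 0 UNIV. z \<ominus>\<^bsub>?L\<^esub> incl 0 UNIV ?s v \<in> ?N}"
  have ic: "incl 0 UNIV ?s v \<in> carrier ?L" if "v \<in> block_vectors 0 UNIV" for v
    using incl(1)[OF _ that] by simp
  have ia: "incl 0 UNIV ?s (\<lambda>c. v c \<oplus> w c) = incl 0 UNIV ?s v \<oplus>\<^bsub>?L\<^esub> incl 0 UNIV ?s w"
    if "v \<in> block_vectors 0 UNIV" "w \<in> block_vectors 0 UNIV" for v w
    using incl_add[OF _ that] by simp
  have im: "incl 0 UNIV ?s (\<lambda>c. v c \<otimes> b) = b \<odot>\<^bsub>?L\<^esub> incl 0 UNIV ?s v"
    if "v \<in> block_vectors 0 UNIV" "b \<in> carrier R" for v b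
    using incl_mult[OF _ that] by simp
  have Nadd: "u \<oplus>\<^bsub>?L\<^esub> v \<in> ?N" if "u \<in> ?N" "v \<in> ?N" for u v
    using subgroup.m_closed[OF submodule.axioms(1)[OF N] that] by simp
  have N0: "\<zero>\<^bsub>?L\<^esub> \<in> ?N" using subgroup.one_closed[OF submodule.axioms(1)[OF N]] by simp
  have zb: "(\<lambda>_. \<zero>) \<in> block_vectors 0 UNIV" by (simp add: block_vectors_def)
  have i0: "incl 0 UNIV ?s (\<lambda>_. \<zero>) = \<zero>\<^bsub>?L\<^esub>"
    using im[OF zb zero_closed] L.zero_smult[OF ic[OF zb]] by (simp del: limit_module_simps)
  have "carrier ?L \<subseteq> ?H"
  proof (rule Y(3)[rule_format], rule conjI)
    show "submodule ?H R ?L"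
    proof (rule L.submoduleI)
      show "\<zero>\<^bsub>?L\<^esub> \<in> ?H"
      proof -
        have "\<zero>\<^bsub>?L\<^esub> \<ominus>\<^bsub>?L\<^esub> incl 0 UNIV ?s (\<lambda>_. \<zero>) = \<zero>\<^bsub>?L\<^esub>"
          unfolding i0 by (simp add: a_minus_def L.M.r_neg del: limit_module_simps)
        then show ?thesis using N0 zb by (auto intro!: bexI[of _ "\<lambda>_. \<zero>"] simp del: limit_module_simps)
      qed
      fix y assume "y \<in> ?H"
      then obtain v where v: "y \<in> carrier ?L" "v \<in> block_vectors 0 UNIV"
        "y \<ominus>\<^bsub>?L\<^esub> incl 0 UNIV ?s v \<in> ?N" by blast
      show "b \<odot>\<^bsub>?L\<^esub> y \<in> ?H" if b: "b \<in> carrier R" for b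
      proof -
        have "b \<odot>\<^bsub>?L\<^esub> y \<ominus>\<^bsub>?L\<^esub> incl 0 UNIV ?s (\<lambda>c. v c \<otimes> b) = b \<odot>\<^bsub>?L\<^esub> (y \<ominus>\<^bsub>?L\<^esub> incl 0 UNIV ?s v)"
          unfolding im[OF v(2) b] using v(1) ic[OF v(2)] b
          by (simp add: a_minus_def L.smult_add_module L.smult_minus del: limit_module_simps)
        moreover have "(\<lambda>c. v c \<otimes> b) \<in> block_vectors 0 UNIV" using v(2) b by (simp add: block_vectors_def)
        ultimately show ?thesis
          using submodule.smult_closed[OF N b v(3)] L.smult_closed[OF b v(1)]
          by (auto intro!: bexI[of _ "\<lambda>c. v c \<otimes> b"] simp del: limit_module_simps)
      qed
      fix z assume "z \<in> ?H"
      then obtain w where w: "z \<in> carrier ?L" "w \<in> block_vectors 0 UNIV"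
        "z \<ominus>\<^bsub>?L\<^esub> incl 0 UNIV ?s w \<in> ?N" by blast
      have "(y \<oplus>\<^bsub>?L\<^esub> z) \<ominus>\<^bsub>?L\<^esub> incl 0 UNIV ?s (\<lambda>c. v c \<oplus> w c)
          = (y \<ominus>\<^bsub>?L\<^esub> incl 0 UNIV ?s v) \<oplus>\<^bsub>?L\<^esub> (z \<ominus>\<^bsub>?L\<^esub> incl 0 UNIV ?s w)"
        unfolding ia[OF v(2) w(2)] using v(1) w(1) ic[OF v(2)] ic[OF w(2)]
        by (simp add: a_minus_def L.M.minus_add L.M.a_ac del: limit_module_simps)
      moreover have "(\<lambda>c. v c \<oplus> w c) \<in> block_vectors 0 UNIV" using v(2) w(2) by (simp add: block_vectors_def)
      ultimately show "y \<oplus>\<^bsub>?L\<^esub> z \<in> ?H"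
        using Nadd[OF v(3) w(3)] L.M.a_closed[OF v(1) w(1)]
        by (auto intro!: bexI[of _ "\<lambda>c. v c \<oplus> w c"] simp del: limit_module_simps)
    qed auto
    have "y \<in> ?H" if y: "y \<in> Y" for y
    proof -
      have yL: "y \<in> carrier ?L" using Y(2) y by blast
      have eb: "entry y t \<in> block_vectors 0 UNIV" using entry_block yL by simp
      have eq: "incl 0 UNIV ?s (entry y t) = y" using T y tY[OF y] by blast
      have "y \<ominus>\<^bsub>?L\<^esub> incl 0 UNIV ?s (entry y t) = \<zero>\<^bsub>?L\<^esub>"
        unfolding eq using yL by (simp add: a_minus_def L.M.r_neg del: limit_module_simps)
      then show ?thesis using N0 eb yL by (auto intro!: bexI[of _ "entry y t"] simp del: limit_module_simps)
    qed
    moreover have "z \<in> ?H" if z: "z \<in> ?N" for z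
    proof -
      have zL: "z \<in> carrier ?L" by (rule times_idealD(1)[OF Ji z])
      then have "z \<ominus>\<^bsub>?L\<^esub> incl 0 UNIV ?s (\<lambda>_. \<zero>) = z" unfolding i0
        by (simp add: a_minus_def del: limit_module_simps)
      then show ?thesis using z zL zb by (auto intro!: bexI[of _ "\<lambda>_. \<zero>"] simp del: limit_module_simps)
    qed
    ultimately show "Y \<union> ?N \<subseteq> ?H" by blast
  qed
  \<comment> \<open>The rank bound is used one stage later, for \<open>q = Suc ?s\<close>: the
    \<open>n ?s\<close> generators of stage \<open>?s\<close> suffice modulo \<open>P J\<close>,
    thus also modulo the larger \<open>P I (Suc q)\<close>.\<close>
  have "n (Suc ?s) \<le> n ?s"
  proof (rule limit_rank[OF ss strict, where x = "generator 0 UNIV ?s"])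
    show "generator 0 UNIV ?s i \<in> carrier ?L" for i by (rule generator_carrier) simp
    fix z assume z: "z \<in> carrier ?L"
    then obtain v where v: "v \<in> block_vectors 0 UNIV" "z \<ominus>\<^bsub>?L\<^esub> incl 0 UNIV ?s v \<in> ?N"
      using \<open>carrier ?L \<subseteq> ?H\<close> by blast
    have vR: "v c \<in> carrier R" for c using v(1) by (simp add: block_vectors_def)
    have "entry z (Suc ?s) c \<ominus> (\<Oplus>i\<in>{..<n ?s}. entry (generator 0 UNIV ?s i) (Suc ?s) c \<otimes> v i) \<in> I (Suc (Suc ?s))" for c
    proof -
      have "incl 0 UNIV ?s v = (\<Oplus>\<^bsub>?L\<^esub>i\<in>{..<n ?s}. v i \<odot>\<^bsub>?L\<^esub> generator 0 UNIV ?s i)"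
        by (rule incl_eq_sum[OF _ v(1)]) simp
      then have "entry (incl 0 UNIV ?s v) (Suc ?s) c
          = (\<Oplus>\<^bsub>regular_right R\<^esub>i\<in>{..<n ?s}. entry (v i \<odot>\<^bsub>?L\<^esub> generator 0 UNIV ?s i) (Suc ?s) c)"
        using module_hom_finsum[OF limit_right_module regular_right_module entry_hom,
            of "\<lambda>i. v i \<odot>\<^bsub>?L\<^esub> generator 0 UNIV ?s i" "{..<n ?s}" 0 UNIV "Suc ?s" c]
          L.smult_closed[OF vR generator_carrier] by (simp del: limit_module_simps)
      then have "entry (incl 0 UNIV ?s v) (Suc ?s) c
          = (\<Oplus>i\<in>{..<n ?s}. entry (generator 0 UNIV ?s i) (Suc ?s) c \<otimes> v i)"
        by (simp add: finsum_regular_right)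
      moreover have "entry (z \<ominus>\<^bsub>?L\<^esub> incl 0 UNIV ?s v) (Suc ?s) c \<in> I (Suc (Suc ?s))"
        using times_idealD(2)[OF Ji v(2)] JI by blast
      ultimately show ?thesis using limit_minus[OF z ic[OF v(1)]] by simp
    qed
    then show "\<exists>s. (\<forall>i. s i \<in> carrier R) \<and> (\<forall>c<n (Suc ?s). entry z (Suc ?s) c \<ominus>
        (\<Oplus>i\<in>{..<n ?s}. entry (generator 0 UNIV ?s i) (Suc ?s) c \<otimes> s i) \<in> I (Suc (Suc ?s)))"
      using vR by blast
  qed
  then show False using n_less[of ?s] by simp
qed

end

section \<open>Base change and decomposition of the limit\<close>

lemma (in ring) ideal_right_submodule: "ideal J R \<Longrightarrow> submodule J R (regular_right R)"
proof -
  assume "ideal J R"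
  then interpret J: ideal J R .
  interpret M: right_module R "regular_right R" by (rule regular_right_module)
  show ?thesis
    by (rule M.submoduleI) (auto simp: J.I_r_closed J.Icarr
        additive_subgroup.zero_closed[OF J.is_additive_subgroup] additive_subgroup.a_closed[OF J.is_additive_subgroup])
qed

context level_sizes
begin

text \<open>The indices of level \<open>i\<close> form the interval of this length starting at
  \<open>offset i\<close>. These lengths are the numbers \<alpha> of the theorem.\<close>

definition new_indices :: "nat \<Rightarrow> nat"
  where "new_indices i = (if i = 0 then n 0 else n i - n (i - 1))"

definition offset :: "nat \<Rightarrow> nat"
  where "offset i = (if i = 0 then 0 else n (i - 1))"

lemma level_offset: "l < new_indices i \<Longrightarrow> level n (offset i + l) = i"
proof -
  assume l: "l < new_indices i"
  then have "offset i + l < n i"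
    using n_mono[of "i - 1" i] by (auto simp: offset_def new_indices_def split: if_splits)
  moreover have "i \<le> level n (offset i + l)"
    by (cases i) (auto simp: offset_def intro: level_ge)
  ultimately show ?thesis using less_n_iff by (meson le_antisym)
qed

lemma offset_level: "offset (level n c) \<le> c" "c - offset (level n c) < new_indices (level n c)"
proof -
  have c: "c < n (level n c)" using less_n_iff by simp
  show le: "offset (level n c) \<le> c"
  proof (cases "level n c")
    case (Suc j)
    then have "\<not> c < n j" using less_n_iff[of c j] by simp
    then show ?thesis using Suc by (simp add: offset_def)
  qed (simp add: offset_def)
  then show "c - offset (level n c) < new_indices (level n c)"
    using c by (auto simp: offset_def new_indices_def split: if_splits)
qed

end

context tower
begin

text \<open>The isomorphism reads off the entries at stage \<open>k\<close> modulo
  \<open>I (Suc k)\<close>, sorted by level. If these vanish for all indices below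
  \<open>n k\<close>, the element lies in \<open>P I (Suc k)\<close> by
  \<open>entry_stable_in\<close>. Prescribed entries are realised by the image of a vector of
  \<open>F\<^sub>k\<close>, which \<open>A\<^sub>k\<close> fixes modulo
  \<open>I (Suc k)\<close>.\<close>

lemma limit_tensor_iso:
  "module_iso (R Quot I (Suc k)) (tensor_quotient R (limit_module 0 UNIV) (I (Suc k)))
    (direct_sum {..k} (\<lambda>i. module_power (ideal_quotient R (I i) (I (Suc k))) (new_indices i)))"
proof -
  let ?J = "I (Suc k)" and ?L = "limit_module 0 UNIV"
  let ?Q = "R Quot ?J"
  let ?co = "\<lambda>x. ?J +> x"
  let ?B = "\<lambda>i. ideal_quotient R (I i) ?J"
  let ?X = "direct_sum {..k} (\<lambda>i. module_power (?B i) (new_indices i))"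
  interpret J: ideal ?J R by (rule ideal_I)
  interpret Q: ring ?Q by (rule J.quotient_is_ring)
  interpret L: right_module R ?L by (rule limit_right_module)
  have B: "right_module ?Q (?B i)" for i
  proof -
    have "submodule (?co ` I i) ?Q (regular_right ?Q)"
      using Q.ideal_right_submodule ring_ideal_imp_quot_ideal[OF ideal_I ideal_I] by simp
    then show ?thesis unfolding ideal_quotient_def
      by (rule restrict_right_module[OF Q.regular_right_module])
  qed
  have Bs: "carrier (?B i) = ?co ` I i" "\<zero>\<^bsub>?B i\<^esub> = ?J" "x \<oplus>\<^bsub>?B i\<^esub> y = x \<oplus>\<^bsub>?Q\<^esub> y"
    "r \<odot>\<^bsub>?B i\<^esub> x = x \<otimes>\<^bsub>?Q\<^esub> r" for i x y r
    by (simp_all add: ideal_quotient_def J.quot_simps)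
  have X: "right_module ?Q ?X"
    unfolding module_power_def by (intro direct_sum_right_module B Q.ring_axioms)
  define th where "th z = (\<lambda>i\<in>{..k}. \<lambda>l\<in>{..<new_indices i}. ?co (entry z k (offset i + l)))" for z
  have eR: "entry z k c \<in> carrier R" if "z \<in> carrier ?L" for z c by (rule limit_entry_carrier[OF that])
  have eI: "entry z k (offset i + l) \<in> I i" if "z \<in> carrier ?L" "l < new_indices i" for z i l
    using coherent_in[of 0 UNIV "entry z" k "offset i + l"] that level_offset[OF that(2)] by simp
  show ?thesis
  proof (rule tensor_quotient_iso[OF limit_right_module ideal_I X, where th = th])
    fix z assume z: "z \<in> carrier ?L"
    show "th z \<in> carrier ?X"
      using eI[OF z] by (auto simp: th_def module_power_def Bs)
    show "th (z \<oplus>\<^bsub>?L\<^esub> y) = th z \<oplus>\<^bsub>?X\<^esub> th y" if y: "y \<in> carrier ?L" for y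
      using eR[OF z] eR[OF y]
      by (auto simp: th_def module_power_def Bs J.quot_simps fun_eq_iff restrict_def)
    show "th (r \<odot>\<^bsub>?L\<^esub> z) = ?co r \<odot>\<^bsub>?X\<^esub> th z" if r: "r \<in> carrier R" for r
      using eR[OF z] r
      by (auto simp: th_def module_power_def Bs J.quot_simps fun_eq_iff restrict_def)
    assume th0: "th z = \<zero>\<^bsub>?X\<^esub>"
    have zc: "coherent 0 UNIV (entry z)" using z by simp
    have in_J: "entry z k c \<in> ?J" if c: "c < n k" for c
    proof -
      let ?i = "level n c"
      have i: "?i \<le> k" using c less_n_iff by simp
      have "th z ?i (c - offset ?i) = \<zero>\<^bsub>?X\<^esub> ?i (c - offset ?i)" using th0 by simp
      then have "?co (entry z k c) = ?J"
        using i offset_level[of c] by (simp add: th_def module_power_def Bs)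
      then show ?thesis using J.quot_eq_zero_iff eR[OF z] by blast
    qed
    show "z \<in> module_times_ideal ?L ?J"
    proof (rule times_idealI[OF ideal_I z, where T = k])
      show "entry z t c \<in> ?J" if "k \<le> t" for t c
        by (rule entry_stable_in[OF zc _ in_J that]) simp_all
    qed
  next
    fix w assume w: "w \<in> carrier ?X"
    have "\<exists>x\<in>I i. l < new_indices i \<longrightarrow> w i l = ?co x" if "i \<le> k" for i l
    proof (cases "l < new_indices i")
      case True
      have "w i \<in> carrier (module_power (?B i) (new_indices i))" using w that by auto
      then have "w i l \<in> ?co ` I i" using True by (auto simp: module_power_def Bs)
      then show ?thesis by blast
    next
      case False then show ?thesis using I_zero by blast
    qed
    then obtain x where x: "\<And>i l. i \<le> k \<Longrightarrow> x i l \<in> I i"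
      "\<And>i l. \<lbrakk>i \<le> k; l < new_indices i\<rbrakk> \<Longrightarrow> w i l = ?co (x i l)" by metis
    define y where "y c = (if c < n k then x (level n c) (c - offset (level n c)) else \<zero>)" for c
    have yI: "y c \<in> I (level n c)" for c using x(1) less_n_iff I_zero by (auto simp: y_def)
    have yb: "y \<in> block_vectors 0 UNIV" using I_carrier[OF yI] by (simp add: block_vectors_def)
    define z where "z = incl 0 UNIV k y"
    have z: "z \<in> carrier ?L" using incl(1)[OF _ yb] by (simp add: z_def)
    have zy: "?co (entry z k c) = ?co (y c)" for c
    proof -
      have "entry z k c \<ominus> y c \<in> I (Suc k)"
        using A_cong[OF yI, of k c] incl_at[OF _ yb, of k c] by (simp add: z_def)
      then show ?thesis using J.quot_eq_iff eR[OF z] I_carrier[OF yI] by blast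
    qed
    have "th z = w"
    proof
      fix i show "th z i = w i"
      proof (cases "i \<le> k")
        case True
        then have wi: "w i \<in> extensional {..<new_indices i}"
          using w by (auto simp: module_power_def PiE_def Pi_def)
        show ?thesis
        proof
          fix l show "th z i l = w i l"
          proof (cases "l < new_indices i")
            case l: True
            have "level n (offset i + l) = i" by (rule level_offset[OF l])
            moreover from this have "offset i + l < n k" using True less_n_iff by simp
            ultimately have "y (offset i + l) = x i l" by (simp add: y_def)
            then show ?thesis using True l x(2)[OF True l] zy[of "offset i + l"] by (simp add: th_def)
          next
            case False
            then show ?thesis using True wi by (simp add: th_def extensional_def)
          qed
        qed
      next
        case False
        then show ?thesis using w by (auto simp: th_def PiE_def extensional_def)
      qed
    qed
    then show "\<exists>x\<in>carrier ?L. th x = w" using z by blast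
  qed
qed

text \<open>From stage \<open>k\<close> on all maps preserve residues modulo \<open>n k\<close>, so
  an element splits according to the level of the residue of the index, which is at most
  \<open>k\<close>. The stages below \<open>k\<close> are dropped; the \<open>C\<^sub>t\<close>
  restore them.\<close>

lemma limit_decomposition:
  "module_iso R (limit_module 0 UNIV)
    (direct_sum {..k} (\<lambda>i. limit_module k {u. u < n k \<and> level n u = i}))"
proof -
  let ?L = "limit_module 0 UNIV" and ?U = "\<lambda>i. {u. u < n k \<and> level n u = i}"
  let ?M = "\<lambda>i. limit_module k (?U i)"
  let ?X = "direct_sum {..k} ?M"
  define part where "part Z i t c = (if k \<le> t \<and> level n (c mod n k) = i then Z t c else \<zero>)"
    for Z :: "nat \<Rightarrow> nat \<Rightarrow> 'a" and i t c
  define f where "f z = (\<lambda>i\<in>{..k}. of_entries (part (entry z) i))" for z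
  have modk: "c mod n k < n k" for c using n_positive by simp
  have lev: "level n (c mod n k) \<le> k" for c using modk less_n_iff by blast
  have part: "coherent k (?U i) (part Z i)" if Z: "coherent 0 UNIV Z" for Z i
  proof -
    note ZR = coherentD(1)[OF Z]
    have pR: "part Z i t c \<in> carrier R" for t c using ZR by (simp add: part_def)
    obtain T where T: "T \<ge> k" "\<And>t c. t \<ge> T \<Longrightarrow> Z (Suc t) c = A (Suc t) (Z t) c"
      using coherent_eventually[OF Z] by blast
    have C: "part Z i t c = C t (part Z i (Suc t)) c" if t: "k \<le> t" for t c
    proof (cases "level n (c mod n k) = i")
      case True
      have "C t (part Z i (Suc t)) c = C t (Z (Suc t)) c"
      proof (rule C_cong)
        fix d assume "d mod n t = c mod n t"
        then have "d mod n k = c mod n k" using mod_mod_n[OF t, of c] mod_mod_n[OF t, of d] by simp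
        then show "part Z i (Suc t) d = Z (Suc t) d" using t True by (simp add: part_def)
      qed (use pR ZR in auto)
      then show ?thesis using coherentD(3)[OF Z, of t c] t True by (simp add: part_def)
    next
      case False
      have "C t (part Z i (Suc t)) c = C t (\<lambda>_. \<zero>) c"
      proof (rule C_cong)
        fix d assume "d mod n t = c mod n t"
        then have "d mod n k = c mod n k" using mod_mod_n[OF t, of c] mod_mod_n[OF t, of d] by simp
        then show "part Z i (Suc t) d = \<zero>" using False by (simp add: part_def)
      qed (use pR in auto)
      then show ?thesis using False by (simp add: part_def C_zero)
    qed
    have A: "part Z i (Suc t) c = A (Suc t) (part Z i t) c" if "T \<le> t" for t c
      using T(2)[OF that, of c] T(1) that mod_mod_n[of k "Suc t" c] a_carrier
      by (auto simp: part_def A_def)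
    show ?thesis
      by (rule coherentI[OF pR _ C _ A]) (use modk in \<open>auto simp: part_def\<close>)
  qed
  have "f \<in> module_hom R ?L ?X"
  proof (rule module_homI)
    fix z assume "z \<in> carrier ?L"
    then have z: "coherent 0 UNIV (entry z)" by simp
    show "f z \<in> carrier ?X" using part[OF z] by (auto simp: f_def)
    show "f (x \<odot>\<^bsub>?L\<^esub> z) = x \<odot>\<^bsub>?X\<^esub> f z" if x: "x \<in> carrier R" for x
    proof
      fix i show "f (x \<odot>\<^bsub>?L\<^esub> z) i = (x \<odot>\<^bsub>?X\<^esub> f z) i"
        using x by (auto simp: f_def restrict_def part_def of_entries_def fun_eq_iff split: prod.split)
    qed
    fix y assume "y \<in> carrier ?L"
    show "f (z \<oplus>\<^bsub>?L\<^esub> y) = f z \<oplus>\<^bsub>?X\<^esub> f y"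
    proof
      fix i show "f (z \<oplus>\<^bsub>?L\<^esub> y) i = (f z \<oplus>\<^bsub>?X\<^esub> f y) i"
        by (auto simp: f_def restrict_def part_def of_entries_def fun_eq_iff split: prod.split)
    qed
  qed
  moreover have "bij_betw f (carrier ?L) (carrier ?X)"
    unfolding bij_betw_def
  proof
    show "inj_on f (carrier ?L)"
    proof (rule inj_onI)
      fix y z assume yz: "y \<in> carrier ?L" "z \<in> carrier ?L" "f y = f z"
      have "entry y t c = entry z t c" if t: "k \<le> t" for t c
      proof -
        let ?i = "level n (c mod n k)"
        have "entry (f y ?i) t c = entry (f z ?i) t c" using yz(3) by simp
        then show ?thesis using t lev[of c] by (simp add: f_def part_def)
      qed
      then have "entry y = entry z"
        using coherent_unique[of 0 UNIV "entry y" UNIV "entry z" k] yz(1,2) by simp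
      then show "y = z" by (rule entry_inject)
    qed
    show "f ` carrier ?L = carrier ?X"
    proof
      show "f ` carrier ?L \<subseteq> carrier ?X"
        using module_hom_closed[OF \<open>f \<in> module_hom R ?L ?X\<close>] by blast
      show "carrier ?X \<subseteq> f ` carrier ?L"
      proof
        fix w assume w: "w \<in> carrier ?X"
        have wc: "coherent k (?U i) (entry (w i))" if "i \<le> k" for i using w that by auto
        \<comment> \<open>Gluing: each coordinate is taken from the component to which its residue
          belongs.\<close>
        define Z where "Z t c = entry (w (level n (c mod n k))) t c" for t c
        have ZR: "Z t c \<in> carrier R" for t c unfolding Z_def by (rule coherentD(1)[OF wc[OF lev]])
        have ZC: "Z t c = C t (Z (Suc t)) c" if t: "k \<le> t" for t c
        proof -
          let ?i = "level n (c mod n k)"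
          have "C t (Z (Suc t)) c = C t (entry (w ?i) (Suc t)) c"
          proof (rule C_cong)
            fix d assume "d mod n t = c mod n t"
            then have "d mod n k = c mod n k" using mod_mod_n[OF t, of c] mod_mod_n[OF t, of d] by simp
            then show "Z (Suc t) d = entry (w ?i) (Suc t) d" by (simp add: Z_def)
          qed (use ZR coherentD(1)[OF wc[OF lev]] in auto)
          then show ?thesis using coherentD(3)[OF wc[OF lev] t, of c] by (simp add: Z_def)
        qed
        have "\<exists>T. \<forall>t\<ge>T. \<forall>c. entry (w i) (Suc t) c = A (Suc t) (entry (w i) t) c" if "i \<le> k" for i
          using wc[OF that] by (simp add: coherent_def)
        then obtain T where T: "\<And>i t c. \<lbrakk>i \<le> k; t \<ge> T i\<rbrakk> \<Longrightarrow> entry (w i) (Suc t) c = A (Suc t) (entry (w i) t) c"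
          by metis
        have "Z (Suc t) c = A (Suc t) (Z t) c" if t: "Max (insert k (T ` {..k})) \<le> t" for t c
        proof -
          have "T (level n (c mod n k)) \<le> t" "k \<le> t" using t lev by auto
          then show ?thesis
            using T[OF lev, of c t c] mod_mod_n[of k "Suc t" c] by (simp add: Z_def A_def)
        qed
        then have "\<exists>T. \<forall>t\<ge>T. \<forall>c. Z (Suc t) c = A (Suc t) (Z t) c" by blast
        then have "\<exists>Y. coherent 0 UNIV Y \<and> (\<forall>t\<ge>k. Y t = Z t)"
          by (intro coherent_extend ZR ZC) simp_all
        then obtain Y where Y: "coherent 0 UNIV Y" "\<forall>t\<ge>k. Y t = Z t" by blast
        have "f (of_entries Y) = w"
        proof
          fix i show "f (of_entries Y) i = w i"
          proof (cases "i \<le> k")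
            case True
            have "part Y i t c = entry (w i) t c" for t c
              using Y(2) coherentD(2,4)[OF wc[OF True], of t c] modk
              by (cases "k \<le> t") (auto simp: part_def Z_def)
            then have "entry (of_entries (part Y i)) = entry (w i)" by (simp add: fun_eq_iff)
            then have "of_entries (part Y i) = w i" by (rule entry_inject)
            then show ?thesis using True by (simp add: f_def)
          next
            case False then show ?thesis using w by (auto simp: f_def PiE_def extensional_def)
          qed
        qed
        then show "w \<in> f ` carrier ?L" using Y(1) by (intro image_eqI[of _ _ "of_entries Y"]) auto
      qed
    qed
  qed
  ultimately show ?thesis unfolding module_iso_def by blast
qed

text \<open>All residues in the block have level exactly \<open>i\<close>, and
  \<open>offset i\<close> is one of them because the sizes strictly increase.\<close>

lemma limit_block_trace:
  assumes "i \<le> k" shows "trace_ideal R (limit_module k {u. u < n k \<and> level n u = i}) = I i"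
proof (rule limit_trace[where u = "offset i"])
  have "0 < new_indices i"
    using n_strict[of "i - 1" i] n_pos by (auto simp: new_indices_def)
  then have l: "level n (offset i) = i" using level_offset[of 0 i] by simp
  then show "level n (offset i) = i" "offset i < n k" "offset i \<in> {u. u < n k \<and> level n u = i}"
    using less_n_iff[of "offset i" k] assms by auto
qed simp

end

text \<open>The \<open>n q\<close> generators of stage \<open>q\<close> generate the first limit
  modulo \<open>I (Suc q)\<close>. A homomorphism maps \<open>P J\<close> into \<open>P' J\<close>,
  so their images do the same for the second limit, and \<open>limit_rank\<close> applies
  there.\<close>

lemma tower_size_le:
  assumes "tower R n I a r" "tower R n' I a' r'"
    and iso: "module_iso R (tower.limit_module R n a r 0 UNIV) (tower.limit_module R n' a' r' 0 UNIV)"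
    and ss: "semisimple_artinian (R Quot I (Suc q))" and strict: "I (Suc q) \<subset> I q"
  shows "n' q \<le> n q"
proof -
  interpret T: tower R n I a r by fact
  interpret T': tower R n' I a' r' by fact
  let ?L = "T.limit_module 0 UNIV" and ?L' = "T'.limit_module 0 UNIV"
  interpret L: right_module R ?L by (rule T.limit_right_module)
  interpret L': right_module R ?L' by (rule T'.limit_right_module)
  obtain f where f: "f \<in> module_hom R ?L ?L'" and bij: "bij_betw f (carrier ?L) (carrier ?L')"
    using iso unfolding module_iso_def by blast
  note fc = module_hom_closed[OF f]
  have gc: "T.generator 0 UNIV q i \<in> carrier ?L" for i by (rule T.generator_carrier) simp
  show ?thesis
  proof (rule T'.limit_rank[OF ss strict, where x = "\<lambda>i. f (T.generator 0 UNIV q i)"])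
    show "f (T.generator 0 UNIV q i) \<in> carrier ?L'" for i by (rule fc[OF gc])
    fix z' assume "z' \<in> carrier ?L'"
    then have "z' \<in> f ` carrier ?L" using bij unfolding bij_betw_def by blast
    then obtain z where z: "z \<in> carrier ?L" "z' = f z" by blast
    have zc: "T.coherent 0 UNIV (entry z)" using z(1) by simp
    let ?v = "entry z q" and ?w = "T.incl 0 UNIV q (entry z q)"
    have vb: "?v \<in> T.block_vectors 0 UNIV" by (rule T.entry_block[OF zc]) simp
    have vR: "?v c \<in> carrier R" for c by (rule T.limit_entry_carrier[OF z(1)])
    have w: "?w \<in> carrier ?L" using T.incl(1)[OF _ vb] by simp
    have "f (z \<ominus>\<^bsub>?L\<^esub> ?w) \<in> module_times_ideal ?L' (I (Suc q))"
      by (rule module_hom_times_ideal[OF L.right_module_axioms L'.right_module_axioms T.ideal_I f])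
        (rule T.incl_approx[OF z(1)], simp)
    moreover have "f (z \<ominus>\<^bsub>?L\<^esub> ?w) = z' \<ominus>\<^bsub>?L'\<^esub> f ?w"
      using module_hom_add[OF f z(1) L.M.a_inv_closed[OF w]]
        module_hom_minus[OF L.right_module_axioms L'.right_module_axioms f w] z(2)
      by (simp add: a_minus_def del: T.limit_module_simps T'.limit_module_simps)
    ultimately have d: "z' \<ominus>\<^bsub>?L'\<^esub> f ?w \<in> module_times_ideal ?L' (I (Suc q))" by simp
    have "?w = (\<Oplus>\<^bsub>?L\<^esub>i\<in>{..<n q}. ?v i \<odot>\<^bsub>?L\<^esub> T.generator 0 UNIV q i)"
      by (rule T.incl_eq_sum[OF _ vb]) simp
    then have "f ?w = f (\<Oplus>\<^bsub>?L\<^esub>i\<in>{..<n q}. ?v i \<odot>\<^bsub>?L\<^esub> T.generator 0 UNIV q i)" by simp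
    also have "\<dots> = (\<Oplus>\<^bsub>?L'\<^esub>i\<in>{..<n q}. f (?v i \<odot>\<^bsub>?L\<^esub> T.generator 0 UNIV q i))"
      by (rule module_hom_finsum[OF L.right_module_axioms L'.right_module_axioms f])
        (use L.smult_closed[OF vR gc] in \<open>simp del: T.limit_module_simps\<close>)
    also have "\<dots> = (\<Oplus>\<^bsub>?L'\<^esub>i\<in>{..<n q}. ?v i \<odot>\<^bsub>?L'\<^esub> f (T.generator 0 UNIV q i))"
      by (rule L'.M.finsum_cong')
        (use L'.smult_closed[OF vR fc[OF gc]] module_hom_smult[OF f vR gc]
          in \<open>simp_all del: T.limit_module_simps T'.limit_module_simps\<close>)
    finally have fw: "f ?w = (\<Oplus>\<^bsub>?L'\<^esub>i\<in>{..<n q}. ?v i \<odot>\<^bsub>?L'\<^esub> f (T.generator 0 UNIV q i))" .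
    have "entry z' q c \<ominus>\<^bsub>R\<^esub> (\<Oplus>\<^bsub>R\<^esub>i\<in>{..<n q}. entry (f (T.generator 0 UNIV q i)) q c \<otimes>\<^bsub>R\<^esub> ?v i) \<in> I (Suc q)" for c
    proof -
      have "entry (f ?w) q c
          = (\<Oplus>\<^bsub>regular_right R\<^esub>i\<in>{..<n q}. entry (?v i \<odot>\<^bsub>?L'\<^esub> f (T.generator 0 UNIV q i)) q c)"
        unfolding fw
        by (rule module_hom_finsum[OF L'.right_module_axioms T.regular_right_module T'.entry_hom])
          (use L'.smult_closed[OF vR fc[OF gc]] in \<open>simp del: T'.limit_module_simps\<close>)
      then have "entry (f ?w) q c = (\<Oplus>\<^bsub>R\<^esub>i\<in>{..<n q}. entry (f (T.generator 0 UNIV q i)) q c \<otimes>\<^bsub>R\<^esub> ?v i)"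
        by (simp add: finsum_regular_right)
      moreover have "entry (z' \<ominus>\<^bsub>?L'\<^esub> f ?w) q c \<in> I (Suc q)"
        by (rule T'.times_idealD(2)[OF T.ideal_I d])
      moreover have "z' \<in> carrier ?L'" using fc[OF z(1)] z(2) by simp
      ultimately show ?thesis using T'.limit_minus[OF _ fc[OF w]] by simp
    qed
    then show "\<exists>s. (\<forall>i. s i \<in> carrier R) \<and> (\<forall>c<n' q. entry z' q c \<ominus>\<^bsub>R\<^esub>
        (\<Oplus>\<^bsub>R\<^esub>i\<in>{..<n q}. entry (f (T.generator 0 UNIV q i)) q c \<otimes>\<^bsub>R\<^esub> s i) \<in> I (Suc q))"
      using vR by blast
  qed
qed

section \<open>Existence of towers\<close>

lemma module_iso_sym:
  assumes M: "right_module R M" and iso: "module_iso R M N" shows "module_iso R N M"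
proof -
  interpret right_module R M by fact
  obtain f where f: "f \<in> module_hom R M N" and bij: "bij_betw f (carrier M) (carrier N)"
    using iso unfolding module_iso_def by blast
  let ?g = "inv_into (carrier M) f"
  have inj: "inj_on f (carrier M)" using bij by (simp add: bij_betw_def)
  have img: "f ` carrier M = carrier N" using bij by (simp add: bij_betw_def)
  have fg: "f (?g y) = y" "?g y \<in> carrier M" if "y \<in> carrier N" for y
    using f_inv_into_f[of y f "carrier M"] inv_into_into[of y f "carrier M"] that img by auto
  have gf: "?g (f x) = x" if "x \<in> carrier M" for x by (rule inv_into_f_f[OF inj that])
  have "?g \<in> module_hom R N M"
  proof (rule module_homI)
    fix y assume y: "y \<in> carrier N"
    show "?g y \<in> carrier M" by (rule fg(2)[OF y])
    show "?g (x \<odot>\<^bsub>N\<^esub> y) = x \<odot>\<^bsub>M\<^esub> ?g y" if x: "x \<in> carrier R" for x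
      using gf[OF smult_closed[OF x fg(2)[OF y]]] module_hom_smult[OF f x fg(2)[OF y]] fg(1)[OF y] by simp
    fix z assume z: "z \<in> carrier N"
    show "?g (y \<oplus>\<^bsub>N\<^esub> z) = ?g y \<oplus>\<^bsub>M\<^esub> ?g z"
      using gf[OF M.a_closed[OF fg(2)[OF y] fg(2)[OF z]]] module_hom_add[OF f fg(2)[OF y] fg(2)[OF z]]
        fg(1)[OF y] fg(1)[OF z] by simp
  qed
  moreover have "bij_betw ?g (carrier N) (carrier M)" by (rule bij_betw_inv_into[OF bij])
  ultimately show ?thesis unfolding module_iso_def by blast
qed

text \<open>At step \<open>t + 1\<close> every basis element of \<open>F\<^sub>t\<close> gives rise to \<open>m (t + 1)\<close> new ones, indexed
  by generators of \<open>I (t + 1)\<close>, and to \<open>s (t + 1)\<close> further ones, on which \<open>A\<^sub>t\<close> has zero rows.\<close>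

primrec sizes :: "(nat \<Rightarrow> nat) \<Rightarrow> (nat \<Rightarrow> nat) \<Rightarrow> nat \<Rightarrow> nat" where
  "sizes m s 0 = s 0"
| "sizes m s (Suc t) = sizes m s t * (1 + m (Suc t) + s (Suc t))"

lemma sizes_level_sizes:
  assumes "\<And>t. s t \<ge> 1" shows "level_sizes (sizes m s)"
proof
  have pos: "0 < sizes m s t" for t
    by (induction t) (use assms in \<open>auto simp: Suc_le_eq\<close>)
  show "0 < sizes m s 0" by (rule pos)
  show "sizes m s t dvd sizes m s (Suc t)" for t by simp
  have "1 < 1 + m (Suc t) + s (Suc t)" for t using assms[of "Suc t"] by simp
  then show "sizes m s t < sizes m s (Suc t)" for t
    using pos[of t] by (metis mult.right_neutral mult_less_cancel1 sizes.simps(2))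
qed

lemma (in ring) left_span_finsum:
  assumes "ideal J R" "w \<in> D \<rightarrow> carrier R" "\<And>d. d \<in> E \<Longrightarrow> f d \<in> left_span R J D w"
    "\<And>d. d \<in> E \<Longrightarrow> f d \<in> carrier R"
  shows "(\<Oplus>d\<in>E. f d) \<in> left_span R J D w"
  using assms(3,4)
proof (induction E rule: infinite_finite_induct)
  case (insert x F)
  then have "(\<Oplus>d\<in>insert x F. f d) = f x \<oplus> (\<Oplus>d\<in>F. f d)" by (intro finsum_insert) auto
  then show ?case using insert left_span_add[OF assms(1,2)] by simp
qed (simp_all add: left_span_zero[OF assms(1,2)])

lemma (in ring) left_span_carrier:
  assumes "w \<in> D \<rightarrow> carrier R" "x \<in> left_span R (carrier R) D w" shows "x \<in> carrier R"
proof -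
  obtain q where "q \<in> D \<rightarrow> carrier R" "x = (\<Oplus>d\<in>D. q d \<otimes> w d)"
    using assms(2) unfolding left_span_def by auto
  then show ?thesis using assms(1) by (auto intro!: finsum_closed simp: Pi_iff)
qed

text \<open>Written as a left linear combination of \<open>x e\<close> and \<open>x e - x\<close>,
  so that membership of both in a left ideal gives membership of \<open>x\<close>.\<close>

lemma (in ring) split_off:
  assumes "x \<in> carrier R" "e \<in> carrier R"
  shows "x = x \<otimes> e \<oplus> \<ominus> \<one> \<otimes> (x \<otimes> e \<ominus> x)"
proof -
  have "\<ominus> \<one> \<otimes> (x \<otimes> e \<ominus> x) = \<ominus> (x \<otimes> e) \<oplus> x"
    using assms by (simp add: l_minus minus_eq minus_add)
  then show ?thesis using assms by (simp add: a_assoc[symmetric] r_neg)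
qed

lemma ideal_prod_least:
  assumes "\<And>x y. \<lbrakk>x \<in> I; y \<in> J\<rbrakk> \<Longrightarrow> x \<otimes>\<^bsub>R\<^esub> y \<in> L" "\<And>x y. \<lbrakk>x \<in> L; y \<in> L\<rbrakk> \<Longrightarrow> x \<oplus>\<^bsub>R\<^esub> y \<in> L"
    "z \<in> ideal_prod R I J"
  shows "z \<in> L"
  using assms(3) by (induction rule: ideal_prod.induct) (use assms(1,2) in auto)

text \<open>The choices that do not depend on the sequence: left generators \<open>g k l\<close> of
  \<open>I k\<close>, numbered by \<open>l < m k\<close>, and elements \<open>e j k\<close> that are
  two-sided identities of \<open>I j\<close> modulo \<open>I k\<close>.\<close>

locale ideal_chain = ring R for R (structure) +
  fixes I :: "nat \<Rightarrow> 'a set" and m :: "nat \<Rightarrow> nat"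
    and g :: "nat \<Rightarrow> nat \<Rightarrow> 'a" and e :: "nat \<Rightarrow> nat \<Rightarrow> 'a"
  assumes chain_ideal: "\<And>i. ideal (I i) R"
    and chain_dec: "\<And>i. I (Suc i) \<subseteq> I i"
    and idem: "\<And>i. ideal_prod R (I i) (I i) = I i"
    and g_in: "\<And>k l. l < m k \<Longrightarrow> g k l \<in> I k"
    and g_gen: "\<And>k L. \<lbrakk>submodule L R (regular_left R); g k ` {..<m k} \<subseteq> L\<rbrakk> \<Longrightarrow> I k \<subseteq> L"
    and e_in: "\<And>j k. j \<le> k \<Longrightarrow> e j k \<in> I j"
    and e_left: "\<And>j k x. \<lbrakk>j \<le> k; x \<in> I j\<rbrakk> \<Longrightarrow> e j k \<otimes> x \<ominus> x \<in> I k"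
    and e_right: "\<And>j k x. \<lbrakk>j \<le> k; x \<in> I j\<rbrakk> \<Longrightarrow> x \<otimes> e j k \<ominus> x \<in> I k"
begin

lemma chain_mono: "i \<le> j \<Longrightarrow> I j \<subseteq> I i"
  by (rule lift_Suc_antimono_le[of I]) (rule chain_dec)

lemma chain_carrier: "x \<in> I i \<Longrightarrow> x \<in> carrier R"
  using ideal.Icarr[OF chain_ideal] by blast

text \<open>The entries of \<open>A\<^sub>t\<close> in column \<open>p\<close> generate the left ideal \<open>I (level n p)\<close>: row \<open>p\<close>
  contains an identity of this ideal modulo \<open>I (t + 1)\<close>, the new rows contain generators
  of \<open>I (t + 1)\<close>.\<close>

definition coef :: "(nat \<Rightarrow> nat) \<Rightarrow> nat \<Rightarrow> nat \<Rightarrow> 'a"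
  where "coef n t c = (if c < n t then e (level n c) (Suc t)
    else if c div n t \<le> m (Suc t) then g (Suc t) (c div n t - 1) else \<zero>)"

context
  fixes s n assumes s: "\<And>t. s t \<ge> 1" and n_def: "n = sizes m s"
begin

interpretation level_sizes n unfolding n_def by (rule sizes_level_sizes[OF s])

lemma n_Suc: "n (Suc t) = n t * (1 + m (Suc t) + s (Suc t))" by (simp add: n_def)

text \<open>The indices of stage \<open>t + 1\<close> over \<open>p\<close> are the
  \<open>p + l * n t\<close>. The value \<open>l = 0\<close> is \<open>p\<close> itself, and
  generators belong to \<open>l\<close> from 1 to \<open>m (Suc t)\<close>.\<close>

lemma new_index_less: "\<lbrakk>p < n t; l \<le> m (Suc t)\<rbrakk> \<Longrightarrow> p + l * n t < n (Suc t)"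
proof -
  assume p: "p < n t" and l: "l \<le> m (Suc t)"
  have "p + l * n t < n t * (1 + l)" using p by simp
  also have "\<dots> \<le> n (Suc t)" unfolding n_Suc using l by (intro mult_le_mono) auto
  finally show ?thesis .
qed

lemma new_index_mod: "p < n t \<Longrightarrow> (p + l * n t) mod n t = p"
  and new_index_div: "p < n t \<Longrightarrow> (p + l * n t) div n t = l"
  by simp_all

lemma coef_in: "coef n t c \<in> I (level n c)"
proof -
  consider "c < n t" | "n t \<le> c" "c div n t \<le> m (Suc t)" | "n t \<le> c" "c div n t > m (Suc t)"
    by linarith
  then show ?thesis
  proof cases
    case 1
    then have "level n c \<le> Suc t" using less_n_iff[of c t] by simp
    then show ?thesis using 1 e_in by (simp add: coef_def)
  next
    case 2
    have q: "0 < c div n t" using 2(1) n_positive[of t] by (simp add: div_greater_zero_iff)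
    have "c mod n t + c div n t * n t < n (Suc t)"
      using new_index_less[OF _ 2(2), of "c mod n t"] n_positive[of t] by simp
    then have "c < n (Suc t)" by simp
    then have "level n c = Suc t" using level_ge[OF 2(1)] less_n_iff[of c "Suc t"] by simp
    moreover have "c div n t - 1 < m (Suc t)" using 2(2) q by linarith
    ultimately show ?thesis using 2 g_in by (simp add: coef_def)
  next
    case 3
    then show ?thesis
      using additive_subgroup.zero_closed[OF ideal.axioms(1)[OF chain_ideal]] by (simp add: coef_def)
  qed
qed

lemma coef_carrier: "coef n t c \<in> carrier R"
  using coef_in chain_carrier by blast

text \<open>The row of \<open>p\<close> itself contributes \<open>x e\<close>, and
  \<open>x e - x\<close> lies in \<open>I (Suc t)\<close>, which the new rows generate. Here
  \<open>e\<close> is used as a right identity.\<close>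

lemma coef_gen:
  assumes p: "p < n t" and x: "x \<in> I (level n p)"
  shows "x \<in> left_span R (carrier R) {c. c < n (Suc t) \<and> c mod n t = p} (coef n t)"
proof -
  let ?D = "{c. c < n (Suc t) \<and> c mod n t = p}"
  let ?L = "left_span R (carrier R) ?D (coef n t)"
  have fin: "finite ?D" by simp
  have w: "coef n t \<in> ?D \<rightarrow> carrier R" using coef_carrier by auto
  note L = left_span_zero[OF oneideal w] left_span_add[OF oneideal w] left_span_mult[OF oneideal w]
    left_span_incl[OF oneideal w fin]
  have "I (Suc t) \<subseteq> ?L"
  proof (rule g_gen)
    show "g (Suc t) ` {..<m (Suc t)} \<subseteq> ?L"
    proof clarify
      fix l assume l: "l < m (Suc t)"
      let ?c = "p + Suc l * n t"
      have "?c < n (Suc t)" using new_index_less[OF p, of "Suc l"] l by simp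
      moreover have "?c mod n t = p" "?c div n t = Suc l"
        by (rule new_index_mod[OF p], rule new_index_div[OF p])
      ultimately have "\<one> \<otimes> coef n t ?c \<in> ?L" "coef n t ?c = g (Suc t) l"
        using L(4)[of ?c \<one>] l by (auto simp: coef_def)
      then show "g (Suc t) l \<in> ?L" using coef_carrier[of t ?c] by simp
    qed
    have "?L \<subseteq> carrier R" using left_span_carrier[OF w] by blast
    then show "submodule ?L R (regular_left R)"
      by (rule left_ideal_submoduleI) (use L in auto)
  qed
  moreover have le: "level n p \<le> Suc t" using p less_n_iff[of p t] by simp
  ultimately have d: "x \<otimes> e (level n p) (Suc t) \<ominus> x \<in> ?L" using e_right[OF le x] by blast
  have xR: "x \<in> carrier R" by (rule chain_carrier[OF x])
  have eR: "e (level n p) (Suc t) \<in> carrier R" using e_in[OF le] chain_carrier by blast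
  have "p \<in> ?D" using p n_less[of t] by simp
  from L(4)[OF this xR] have xe: "x \<otimes> e (level n p) (Suc t) \<in> ?L" using p by (simp add: coef_def)
  have "x = x \<otimes> e (level n p) (Suc t) \<oplus> \<ominus> \<one> \<otimes> (x \<otimes> e (level n p) (Suc t) \<ominus> x)"
    by (rule split_off[OF xR eR])
  also have "\<dots> \<in> ?L" by (intro L(2)[OF xe] L(3)[OF _ d]) simp
  finally show ?thesis .
qed

text \<open>This is where idempotence is used: an entry of level \<open>j\<close> lies in \<open>I\<^sub>j = I\<^sub>j I\<^sub>j\<close>, and the left
  ideal generated by the entries of \<open>A\<^sub>t\<^sub>+\<^sub>1 A\<^sub>t\<close> in a column contains \<open>I\<^sub>j\<close>.\<close>

lemma coef_retract:
  assumes c: "c < n (Suc t)"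
  defines "D \<equiv> {d. d < n (Suc (Suc t)) \<and> d mod n t = c mod n t}"
    and "w \<equiv> \<lambda>d. coef n (Suc t) d \<otimes> coef n t (d mod n (Suc t))"
  shows "coef n t c \<in> left_span R (I (level n c)) D w"
proof -
  let ?L = "left_span R (carrier R) D w"
  let ?p = "c mod n t"
  have fin: "finite D" by (simp add: D_def)
  have w: "w \<in> D \<rightarrow> carrier R" using coef_carrier by (auto simp: w_def)
  note L = left_span_zero[OF oneideal w] left_span_add[OF oneideal w] left_span_mult[OF oneideal w]
    left_span_incl[OF oneideal w fin] left_span_finsum[OF oneideal w]
  have p: "?p < n t" using n_positive by simp
  \<comment> \<open>Expanding \<open>x\<close> in the entries of column \<open>d\<close> at step
    \<open>t + 1\<close> turns the product into a combination of the \<open>w b\<close>.\<close>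
  have 1: "x \<otimes> coef n t d \<in> ?L" if d: "d < n (Suc t)" "d mod n t = ?p" and x: "x \<in> I (level n d)" for d x
  proof -
    let ?E = "{b. b < n (Suc (Suc t)) \<and> b mod n (Suc t) = d}"
    obtain q where q: "q \<in> ?E \<rightarrow> carrier R" "x = (\<Oplus>b\<in>?E. q b \<otimes> coef n (Suc t) b)"
      using coef_gen[OF d(1) x] unfolding left_span_def by auto
    have "x \<otimes> coef n t d = (\<Oplus>b\<in>?E. q b \<otimes> coef n (Suc t) b \<otimes> coef n t d)"
      unfolding q(2) using q(1) coef_carrier by (intro finsum_ldistr) auto
    also have "\<dots> = (\<Oplus>b\<in>?E. q b \<otimes> w b)"
      using q(1) coef_carrier by (intro finsum_cong') (auto simp: w_def m_assoc Pi_iff)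
    also have "\<dots> \<in> ?L"
    proof (rule L(5))
      fix b assume b: "b \<in> ?E"
      then have "b mod n t = ?p" using d(2) mod_mod_n[of t "Suc t" b] by simp
      then have bD: "b \<in> D" using b by (simp add: D_def)
      have qb: "q b \<in> carrier R" using q(1) b by blast
      show "q b \<otimes> w b \<in> ?L" by (rule L(4)[OF bD qb])
      show "q b \<otimes> w b \<in> carrier R" using qb w bD by (auto simp: Pi_iff)
    qed
    finally show ?thesis .
  qed
  have 2: "I (Suc t) \<subseteq> ?L"
  proof -
    \<comment> \<open>A left ideal, because \<open>I (Suc t)\<close> is also closed under right
      multiplication. Thus \<open>I (Suc t) y \<subseteq> ?L\<close> need only be tested on
      generators, and it yields that the square of \<open>I (Suc t)\<close> is in
      \<open>?L\<close>.\<close>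
    let ?M = "{y \<in> carrier R. \<forall>x\<in>I (Suc t). x \<otimes> y \<in> ?L}"
    have "I (Suc t) \<subseteq> ?M"
    proof (rule g_gen)
      show "submodule ?M R (regular_left R)"
      proof (rule left_ideal_submoduleI)
        show "\<zero> \<in> ?M" using L(1) chain_carrier by auto
        show "x \<oplus> y \<in> ?M" if "x \<in> ?M" "y \<in> ?M" for x y
          using that L(2) chain_carrier by (auto simp: r_distr)
        show "b \<otimes> y \<in> ?M" if b: "b \<in> carrier R" and y: "y \<in> ?M" for b y
        proof -
          have "x \<otimes> (b \<otimes> y) \<in> ?L" if x: "x \<in> I (Suc t)" for x
          proof -
            have "x \<otimes> b \<in> I (Suc t)" by (rule ideal.I_r_closed[OF chain_ideal x b])
            then have "x \<otimes> b \<otimes> y \<in> ?L" using y by blast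
            then show ?thesis using chain_carrier[OF x] b y by (simp add: m_assoc)
          qed
          then show ?thesis using b y by simp
        qed
      qed auto
      show "g (Suc t) ` {..<m (Suc t)} \<subseteq> ?M"
      proof clarify
        fix l assume l: "l < m (Suc t)"
        let ?d = "?p + Suc l * n t"
        have d: "?d < n (Suc t)" using new_index_less[OF p, of "Suc l"] l by simp
        have dd: "?d mod n t = ?p" "?d div n t = Suc l"
          by (rule new_index_mod[OF p], rule new_index_div[OF p])
        have "coef n t ?d = g (Suc t) l" using dd l by (auto simp: coef_def)
        moreover have "level n ?d = Suc t" using level_ge[of t ?d] d less_n_iff[of ?d "Suc t"] by simp
        ultimately show "g (Suc t) l \<in> carrier R \<and> (\<forall>x\<in>I (Suc t). x \<otimes> g (Suc t) l \<in> ?L)"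
          using 1[OF d dd(1)] coef_carrier[of t ?d] by simp
      qed
    qed
    then have "x \<otimes> y \<in> ?L" if "x \<in> I (Suc t)" "y \<in> I (Suc t)" for x y using that by blast
    then have "ideal_prod R (I (Suc t)) (I (Suc t)) \<subseteq> ?L"
      using ideal_prod_least[of "I (Suc t)" "I (Suc t)" R ?L] L(2) by blast
    then show ?thesis using idem by simp
  qed
  have 3: "x \<in> ?L" if x: "x \<in> I (level n ?p)" for x
  proof -
    have le: "level n ?p \<le> Suc t" using p less_n_iff[of ?p t] by simp
    have xR: "x \<in> carrier R" by (rule chain_carrier[OF x])
    have eR: "e (level n ?p) (Suc t) \<in> carrier R" using e_in[OF le] chain_carrier by blast
    have "x \<otimes> coef n t ?p \<in> ?L" using 1[of ?p x] x p n_less[of t] by simp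
    then have xe: "x \<otimes> e (level n ?p) (Suc t) \<in> ?L" using p by (simp add: coef_def)
    have d: "x \<otimes> e (level n ?p) (Suc t) \<ominus> x \<in> ?L" using e_right[OF le x] 2 by blast
    have "x = x \<otimes> e (level n ?p) (Suc t) \<oplus> \<ominus> \<one> \<otimes> (x \<otimes> e (level n ?p) (Suc t) \<ominus> x)"
      by (rule split_off[OF xR eR])
    also have "\<dots> \<in> ?L" by (intro L(2)[OF xe] L(3)[OF _ d]) simp
    finally show ?thesis .
  qed
  let ?J = "I (level n c)"
  have JI: "?J \<subseteq> I (level n ?p)" by (rule chain_mono[OF level_mod])
  \<comment> \<open>In each product of two elements of \<open>?J\<close> the right factor lies in
    \<open>?L\<close>, and the left factor moves the coefficients into \<open>?J\<close>.\<close>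
  have "coef n t c \<in> ideal_prod R ?J ?J" using idem coef_in by simp
  then show ?thesis
  proof (rule ideal_prod_least[rotated -1])
    show "x \<otimes> y \<in> left_span R ?J D w" if "x \<in> ?J" "y \<in> ?J" for x y
      by (rule left_span_mult[OF chain_ideal w that(1)]) (use 3 JI that(2) in blast)
    show "x \<oplus> y \<in> left_span R ?J D w" if "x \<in> left_span R ?J D w" "y \<in> left_span R ?J D w" for x y
      by (rule left_span_add[OF chain_ideal w that])
  qed
qed

text \<open>The matrices of the \<open>C\<^sub>t\<close> are chosen row by row: the coefficients of
  \<open>coef_retract\<close> over one residue class, extended by 0.\<close>

lemma tower_exists: "\<exists>r. tower R n I (coef n) r"
proof -
  define retracts where "retracts t c q \<longleftrightarrow> (\<forall>d. q d \<in> I (level n c)) \<and>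
    (\<forall>d. n (Suc t) \<le> c \<or> d mod n t \<noteq> c mod n t \<longrightarrow> q d = \<zero>) \<and>
    (c < n (Suc t) \<longrightarrow> (\<Oplus>d\<in>{..<n (Suc (Suc t))}. q d \<otimes> (coef n (Suc t) d \<otimes> coef n t (d mod n (Suc t))))
      = coef n t c)" for t c q
  have ex: "\<exists>q. retracts t c q" for t c
  proof (cases "c < n (Suc t)")
    case True
    let ?D = "{d. d < n (Suc (Suc t)) \<and> d mod n t = c mod n t}"
    let ?w = "\<lambda>d. coef n (Suc t) d \<otimes> coef n t (d mod n (Suc t))"
    obtain q where q: "q \<in> ?D \<rightarrow> I (level n c)" "coef n t c = (\<Oplus>d\<in>?D. q d \<otimes> ?w d)"
      using coef_retract[OF True] unfolding left_span_def by auto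
    let ?q = "\<lambda>d. if d \<in> ?D then q d else \<zero>"
    have qI: "?q d \<in> I (level n c)" for d
      using q(1) additive_subgroup.zero_closed[OF ideal.axioms(1)[OF chain_ideal]] by auto
    have wR: "?w d \<in> carrier R" for d using coef_carrier by simp
    have qR: "q d \<in> carrier R" if "d \<in> ?D" for d using q(1) that chain_carrier by blast
    have "(\<Oplus>d\<in>{..<n (Suc (Suc t))}. ?q d \<otimes> ?w d) = (\<Oplus>d\<in>?D. q d \<otimes> ?w d)"
      by (rule add.finprod_mono_neutral_cong_right)
        (use qR wR in auto)
    then have "retracts t c ?q" unfolding retracts_def using qI q(2) True by auto
    then show ?thesis by blast
  next
    case False
    then have "retracts t c (\<lambda>_. \<zero>)"
      using additive_subgroup.zero_closed[OF ideal.axioms(1)[OF chain_ideal]]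
      by (simp add: retracts_def)
    then show ?thesis by blast
  qed
  define r where "r t c = (SOME q. retracts t c q)" for t c
  have "retracts t c (r t c)" for t c unfolding r_def by (rule someI_ex[OF ex])
  then have r: "\<And>t c d. r t c d \<in> I (level n c)"
    "\<And>t c d. n (Suc t) \<le> c \<or> d mod n t \<noteq> c mod n t \<Longrightarrow> r t c d = \<zero>"
    "\<And>t c. c < n (Suc t) \<Longrightarrow> (\<Oplus>d\<in>{..<n (Suc (Suc t))}. r t c d \<otimes>
      (coef n (Suc t) d \<otimes> coef n t (d mod n (Suc t)))) = coef n t c"
    unfolding retracts_def by blast+
  have "tower R n I (coef n) r"
  proof (intro tower.intro tower_axioms.intro)
    show "ring R" by (rule ring_axioms)
    show "level_sizes n" by (rule level_sizes_axioms)
    show "coef n t c = \<zero>" if "n (Suc t) \<le> c" for t c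
    proof -
      have "n t \<le> c" using that n_less[of t] by simp
      moreover have "1 + m (Suc t) + s (Suc t) \<le> c div n t"
        using div_le_mono[OF that, of "n t"] n_positive[of t] unfolding n_Suc by simp
      ultimately show ?thesis using s[of "Suc t"] by (simp add: coef_def)
    qed
    show "coef n t c \<otimes> x \<ominus> x \<in> I (Suc t)" if "c < n t" "x \<in> I (level n c)" for t c x
      using that e_left[of "level n c" "Suc t" x] less_n_iff[of c t] by (simp add: coef_def)
  qed (use chain_ideal chain_dec coef_in coef_gen r in auto)
  then show ?thesis by blast
qed

end

end

lemma ideal_chain_exists:
  assumes "ring R" and I: "\<And>i. ideal (I i) R" and dec: "\<And>i. I (Suc i) \<subseteq> I i"
    and ss: "\<And>i. semisimple_artinian (R Quot I i)"
    and idem: "\<And>i. ideal_prod R (I i) (I i) = I i"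
    and fg: "\<And>i. finitely_generated R (restrict_module (regular_left R) (I i))"
  shows "\<exists>m g e. ideal_chain R I m g e"
proof -
  interpret ring R by fact
  have mono: "I k \<subseteq> I j" if "j \<le> k" for j k
    using lift_Suc_antimono_le[of I j k] dec that by blast
  define generates where "generates k m g \<longleftrightarrow> g ` {..<m} \<subseteq> I k \<and>
    (\<forall>L. submodule L R (regular_left R) \<and> g ` {..<m} \<subseteq> L \<longrightarrow> I k \<subseteq> L)" for k m and g :: "nat \<Rightarrow> 'a"
  have "\<exists>m g. generates k m g" for k
  proof -
    obtain Y where Y: "finite Y" "Y \<subseteq> I k" "\<forall>L. submodule L R (regular_left R) \<and> Y \<subseteq> L \<longrightarrow> I k \<subseteq> L"
      using fg_left_ideal_generators[OF I[of k] fg[of k]] by blast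
    obtain m :: nat and g where "Y = g ` {i. i < m}"
      using finite_imp_nat_seg_image_inj_on[OF Y(1)] by blast
    then have "g ` {..<m} = Y" by (simp add: lessThan_def)
    then have "generates k m g" unfolding generates_def using Y(2,3) by simp
    then show ?thesis by blast
  qed
  then obtain m g where mg: "\<And>k. generates k (m k) (g k)" by metis
  define unit where "unit j k e \<longleftrightarrow> e \<in> I j \<and>
    (\<forall>x\<in>I j. e \<otimes>\<^bsub>R\<^esub> x \<ominus>\<^bsub>R\<^esub> x \<in> I k \<and> x \<otimes>\<^bsub>R\<^esub> e \<ominus>\<^bsub>R\<^esub> x \<in> I k)" for j k e
  have "\<exists>e. j \<le> k \<longrightarrow> unit j k e" for j k
  proof (cases "j \<le> k")
    case True
    obtain e where "e \<in> I j" "\<And>x. x \<in> I j \<Longrightarrow> e \<otimes>\<^bsub>R\<^esub> x \<ominus>\<^bsub>R\<^esub> x \<in> I k"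
      "\<And>x. x \<in> I j \<Longrightarrow> x \<otimes>\<^bsub>R\<^esub> e \<ominus>\<^bsub>R\<^esub> x \<in> I k"
      by (rule quotient_semisimple_identity[OF I I mono[OF True] ss]) (rule that; assumption)
    then have "unit j k e" unfolding unit_def by blast
    then show ?thesis by blast
  qed blast
  then obtain e where e: "\<And>j k. j \<le> k \<Longrightarrow> unit j k (e j k)" by metis
  have "ideal_chain R I m g e"
  proof (intro ideal_chain.intro ideal_chain_axioms.intro)
    show "I k \<subseteq> L" if "submodule L R (regular_left R)" "g k ` {..<m k} \<subseteq> L" for k L
      using mg[of k] that unfolding generates_def by blast
    show "g k l \<in> I k" if "l < m k" for k l
      using mg[of k] that unfolding generates_def by auto
  qed (use assms e in \<open>auto simp: unit_def\<close>)
  then show ?thesis by blast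
qed

theorem lemma6p6:
  fixes R :: "('a, 'm) ring_scheme" and I :: "nat \<Rightarrow> 'a set"
  assumes "ring R"
    and "\<And>i. ideal (I i) R"
    and "\<And>i. I (Suc i) \<subseteq> I i"
    and "\<And>i. semisimple_artinian (R Quot I i)"
    and "\<And>i. ideal_prod R (I i) (I i) = I i"
    and "\<And>i. finitely_generated R (restrict_module (regular_left R) (I i))"
  shows "\<exists>(P :: (nat \<Rightarrow> nat) \<Rightarrow> ('a, nat \<Rightarrow> 'a) module) (\<alpha> :: (nat \<Rightarrow> nat) \<Rightarrow> nat \<Rightarrow> nat).
    (\<forall>s. (\<forall>n. s n \<ge> 1) \<longrightarrow>
        right_module R (P s) \<and> countably_generated R (P s) \<and> projective R (P s) \<and>
        trace_ideal R (P s) = I 0) \<and>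
    (\<forall>s k. (\<forall>n. s n \<ge> 1) \<longrightarrow>
        module_iso (R Quot I (Suc k)) (tensor_quotient R (P s) (I (Suc k)))
          (direct_sum {..k} (\<lambda>i. module_power (ideal_quotient R (I i) (I (Suc k))) (\<alpha> s i)))) \<and>
    (\<forall>s s' k. (\<forall>n. s n \<ge> 1) \<and> (\<forall>n. s' n \<ge> 1) \<and> (\<forall>i\<le>k. \<alpha> s i = \<alpha> s' i)
        \<longrightarrow> (\<forall>i\<le>k. s i = s' i)) \<and>
    (\<forall>s k. (\<forall>n. s n \<ge> 1) \<longrightarrow>
        finitely_generated R (quotient_module (P s) (module_times_ideal (P s) (I k)))) \<and>
    ((\<forall>k. I (Suc k) \<subset> I k) \<longrightarrow>
      (\<forall>s s'. (\<forall>n. s n \<ge> 1) \<and> (\<forall>n. s' n \<ge> 1) \<and> module_iso R (P s) (P s') \<longrightarrow> s = s')) \<and>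
    (\<forall>s k. (\<forall>n. s n \<ge> 1) \<longrightarrow>
      (\<exists>Q :: nat \<Rightarrow> ('a, nat \<Rightarrow> 'a) module.
        (\<forall>i\<le>k. right_module R (Q i) \<and> trace_ideal R (Q i) = I i) \<and>
        module_iso R (P s) (direct_sum {..k} Q))) \<and>
    (right_noetherian R \<and> (\<forall>k. I (Suc k) \<subset> I k) \<longrightarrow>
      (\<forall>s. (\<forall>n. s n \<ge> 1) \<longrightarrow> \<not> fair_sized R (P s)))"
proof -
  interpret ring R by fact
  obtain m g e where "ideal_chain R I m g e" using ideal_chain_exists[where R = R and I = I, OF assms] by blast
  then interpret C: ideal_chain R I m g e .
  let ?n = "sizes m" and ?pos = "\<lambda>s :: nat \<Rightarrow> nat. \<forall>n. s n \<ge> 1"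
  let ?a = "\<lambda>s. C.coef (?n s)"
  have "\<exists>r. tower R (?n s) I (?a s) r" if "?pos s" for s
    by (rule C.tower_exists[OF _ refl]) (use that in blast)
  then obtain r where r: "\<And>s. ?pos s \<Longrightarrow> tower R (?n s) I (?a s) (r s)" by metis
  define P where "P s = tower.limit_module R (?n s) (?a s) (r s) 0 UNIV" for s
  define \<alpha> where "\<alpha> s = level_sizes.new_indices (?n s)" for s
  show ?thesis
  proof (intro exI[of _ P] exI[of _ \<alpha>] conjI allI impI)
    fix s :: "nat \<Rightarrow> nat" assume s: "?pos s"
    interpret T: tower R "?n s" I "?a s" "r s" by (rule r[OF s])
    show "right_module R (P s)" unfolding P_def by (rule T.limit_right_module)
    show "countably_generated R (P s)" unfolding P_def by (rule T.limit_countably_generated)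
    show "projective R (P s)" unfolding P_def by (rule T.limit_projective)
    \<comment> \<open>Index 0 witnesses that the lowest level, 0, occurs in the full block.\<close>
    have "level (?n s) 0 = 0" using T.less_n_iff[of 0 0] T.n_pos by simp
    then show "trace_ideal R (P s) = I 0" unfolding P_def
      by (intro T.limit_trace[where u = 0]) (use T.n_pos in auto)
    fix k
    show "module_iso (R Quot I (Suc k)) (tensor_quotient R (P s) (I (Suc k)))
      (direct_sum {..k} (\<lambda>i. module_power (ideal_quotient R (I i) (I (Suc k))) (\<alpha> s i)))"
      unfolding P_def \<alpha>_def by (rule T.limit_tensor_iso)
    show "finitely_generated R (quotient_module (P s) (module_times_ideal (P s) (I k)))"
      using T.I_fg_quotient[of k UNIV] unfolding P_def fg_quotient_ideals_def by blast
    show "\<exists>Q :: nat \<Rightarrow> ('a, nat \<Rightarrow> 'a) module.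
        (\<forall>i\<le>k. right_module R (Q i) \<and> trace_ideal R (Q i) = I i) \<and>
        module_iso R (P s) (direct_sum {..k} Q)"
      unfolding P_def
      by (intro exI[of _ "\<lambda>i. T.limit_module k {u. u < ?n s k \<and> level (?n s) u = i}"] conjI allI impI
          T.limit_right_module T.limit_block_trace T.limit_decomposition)
  next
    \<comment> \<open>The positive factor \<open>?n s t\<close> cancels in the recursion for the
      sizes; \<open>m\<close> is the same for both sequences.\<close>
    have sizes_eq: "s i = s' i"
      if "?pos s" and eq: "\<And>j. j \<le> i \<Longrightarrow> ?n s j = ?n s' j" for s s' i
    proof (cases i)
      case 0 then show ?thesis using eq[of 0] by simp
    next
      case (Suc t)
      interpret T: tower R "?n s" I "?a s" "r s" by (rule r[OF that(1)])
      have "?n s t * (1 + m (Suc t) + s (Suc t)) = ?n s t * (1 + m (Suc t) + s' (Suc t))"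
        using eq[of "Suc t"] eq[of t] Suc by simp
      then show ?thesis using T.n_positive[of t] Suc by simp
    qed
    {
      fix s s' k i assume h: "?pos s \<and> ?pos s' \<and> (\<forall>i\<le>k. \<alpha> s i = \<alpha> s' i)" and "i \<le> k"
      interpret T: tower R "?n s" I "?a s" "r s" by (rule r) (use h in blast)
      interpret T': tower R "?n s'" I "?a s'" "r s'" by (rule r) (use h in blast)
      have "?n s j = ?n s' j" if "j \<le> k" for j
        using that
      proof (induction j)
        case 0 then show ?case
          using h by (auto simp: \<alpha>_def T.new_indices_def T'.new_indices_def simp del: sizes.simps dest: spec[of _ 0])
      next
        case (Suc j)
        \<comment> \<open>The numbers \<alpha> are the first size and the successive differences, so
          they determine the sizes.\<close>
        have "\<alpha> s (Suc j) = \<alpha> s' (Suc j)" using h Suc.prems by blast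
        then have "?n s (Suc j) - ?n s j = ?n s' (Suc j) - ?n s' j"
          by (simp add: \<alpha>_def T.new_indices_def T'.new_indices_def del: sizes.simps)
        then show ?case using Suc T.n_less[of j] T'.n_less[of j] by (simp del: sizes.simps)
      qed
      then show "s i = s' i" using sizes_eq[of s i s'] h \<open>i \<le> k\<close> by simp
    next
      fix s s' assume strict: "\<forall>k. I (Suc k) \<subset> I k" and h: "?pos s \<and> ?pos s' \<and> module_iso R (P s) (P s')"
      interpret T: tower R "?n s" I "?a s" "r s" by (rule r) (use h in blast)
      interpret T': tower R "?n s'" I "?a s'" "r s'" by (rule r) (use h in blast)
      have iso: "module_iso R (P s) (P s')" using h by blast
      have iso': "module_iso R (P s') (P s)"
        by (rule module_iso_sym[OF _ iso]) (simp add: P_def T.limit_right_module)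
      show "s = s'"
      proof
        fix i
        have "?n s j = ?n s' j" for j
        proof (rule antisym)
          show "?n s' j \<le> ?n s j"
            by (rule tower_size_le[OF T.tower_axioms T'.tower_axioms iso[unfolded P_def]])
              (use assms strict in blast)+
          show "?n s j \<le> ?n s' j"
            by (rule tower_size_le[OF T'.tower_axioms T.tower_axioms iso'[unfolded P_def]])
              (use assms strict in blast)+
        qed
        then show "s i = s' i" using sizes_eq h by blast
      qed
    next
      fix s assume "right_noetherian R \<and> (\<forall>k. I (Suc k) \<subset> I k)" and s: "?pos s"
      interpret T: tower R "?n s" I "?a s" "r s" by (rule r[OF s])
      show "\<not> fair_sized R (P s)" unfolding P_def
        by (rule T.limit_not_fair_sized) (use assms \<open>_ \<and> _\<close> in blast)+
    }
  qed
qed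

end
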